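(* Suppose that $1<p<\infty$ and $1\le q\le\infty$, and that $(X,d,\mu)$ is a complete metric measure space. The set function $E\mapsto \mathrm{Cap}_{p,q}(E)$, $E\subset X$, has the following properties. (i) If $E_1\subset E_2$, then $\mathrm{Cap}_{p,q}(E_1)\le\mathrm{Cap}_{p,q}(E_2)$. (ii) Suppose that $\mu$ is nonatomic and that $1<q\le p$. If $E_1\subset E_2\subset\cdots\subset E=\bigcup_{i=1}^\infty E_i\subset X$, then $\mathrm{Cap}_{p,q}(E)=\lim_{i\to\infty}\mathrm{Cap}_{p,q}(E_i)$. (iii) Suppose that $p<q\le\infty$. If $E=\bigcup_{i=1}^\infty E_i\subset X$, then $\mathrm{Cap}_{p,q}(E)\le\sum_{i=1}^\infty\mathrm{Cap}_{p,q}(E_i)$. (iv) Suppose that $1\le q\le p$. If $E=\bigcup_{i=1}^\infty E_i\subset X$, then $\mathrm{Cap}_{p,q}(E)^{q/p}\le\sum_{i=1}^\infty\mathrm{Cap}_{p,q}(E_i)^{q/p}$.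
   Context: Setting: $(X,d)$ is a complete metric space endowed with a nontrivial Borel regular measure $\mu$ that is finite and nonzero on nonempty bounded open sets. $\mu$ is nonatomic if every measurable set $A$ of positive measure contains a measurable $B\subset A$ with $0<\mu(B)<\mu(A)$. Lorentz quasinorm: for a $\mu$-measurable $f:X\to[-\infty,\infty]$ let $\mu_{[f]}(t)=\mu(\{x\in X:|f(x)|>t\})$, $t\ge0$, and $f^*(t)=\inf\{v\ge 0:\mu_{[f]}(v)\le t\}$, $t\ge0$. For $1<p<\infty$ put $\|f\|_{L^{p,q}(X,\mu)}=\left(\int_0^\infty (t^{1/p}f^*(t))^q\,\frac{dt}{t}\right)^{1/q}$ if $1\le q<\infty$, and $\|f\|_{L^{p,\infty}(X,\mu)}=\sup_{t>0}t\,\mu_{[f]}(t)^{1/p}$. $L^{p,q}(X,\mu)$ is the set of $\mu$-measurable $f$ with $\|f\|_{L^{p,q}(X,\mu)}<\infty$. Modulus: a curve in $X$ is rectifiable if it has finite length; a rectifiable curve $\gamma$ is parametrized by arc length on $[0,\ell(\gamma)]$, and $\int_\gamma\rho=\int_0^{\ell(\gamma)}\rho(\gamma(s))\,ds$ for Borel $\rho\ge0$. $\Gamma_{\rm rect}$ is the family of all nonconstant rectifiable curves. For $\Gamma\subset\Gamma_{\rm rect}$, $F(\Gamma)$ is the family of Borel $\rho:X\to[0,\infty]$ with $\int_\gamma\rho\ge1$ for every $\gamma\in\Gamma$, and $\mathrm{Mod}_{p,q}(\Gamma)=\inf_{\rho\in F(\Gamma)}\|\rho\|_{L^{p,q}(X,\mu)}^p$.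 A property holds for $p,q$-almost every curve if it holds on all curves of $\Gamma_{\rm rect}$ outside a family of zero $\mathrm{Mod}_{p,q}$. Weak upper gradient: a Borel $g:X\to[0,\infty]$ is an upper gradient of a Borel $u:X\to[-\infty,\infty]$ if for every rectifiable curve $\gamma$ one has $|u(\gamma(0))-u(\gamma(\ell(\gamma)))|\le\int_\gamma g$ whenever both $u(\gamma(0)),u(\gamma(\ell(\gamma)))$ are finite, and $\int_\gamma g=\infty$ otherwise; it is a $p,q$-weak upper gradient of $u$ if this holds for $p,q$-almost every $\gamma\in\Gamma_{\rm rect}$. Newtonian space: $\widetilde N^{1,L^{p,q}}(X,\mu)$ is the space of Borel functions $u\in L^{p,q}(X,\mu)$ having a $p,q$-weak upper gradient in $L^{p,q}(X,\mu)$, with $\|u\|_{N^{1,L^{p,q}}}=(\|u\|_{L^{p,q}}^{q}+\inf_g\|g\|_{L^{p,q}}^{q})^{1/q}$ if $1\le q\le p$ and $\|u\|_{N^{1,L^{p,q}}}=(\|u\|_{L^{p,q}}^{p}+\inf_g\|g\|_{L^{p,q}}^{p})^{1/p}$ if $p<q\le\infty$, the infimum over all $p,q$-weak upper gradients $g\in L^{p,q}(X,\mu)$ of $u$. $N^{1,L^{p,q}}(X,\mu)$ is the quotient by the relation $u\sim v\iff\|u-v\|_{N^{1,L^{p,q}}}=0$. Capacity: for $E\subset X$, $\mathrm{Cap}_{p,q}(E)=\inf\{\|u\|_{N^{1,L^{p,q}}}^p:u\in\mathcal A(E)\}$, where $\mathcal A(E)$ is the set of functions $u$ (representatives of elements)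 of $N^{1,L^{p,q}}(X,\mu)$ with $u\ge1$ on $E$; $\mathrm{Cap}_{p,q}(E)=\infty$ if $\mathcal A(E)=\emptyset$. *)

theory Defs
  imports "HOL-Analysis.Analysis"
begin

text \<open>Real powers of extended nonnegative reals; used for exponents \<open>a > 0\<close> only, so that
  \<open>0\<close> and \<open>\<infinity>\<close> are fixed.\<close>

definition ennpow :: "ennreal \<Rightarrow> real \<Rightarrow> ennreal" where
  "ennpow x a = (if x = \<infinity> then \<infinity> else ennreal (enn2real x powr a))"


section \<open>Metric measure spaces\<close>

text \<open>The space \<open>X\<close> is the whole type. The sigma-algebra of \<open>M\<close> may be any one that contains the
  Borel sets and satisfies Borel regularity: both the Borel sets themselves and
  all sets measurable for a Borel regular outer measure are allowed.\<close>

definition metric_measure_space :: "'a::metric_space measure \<Rightarrow> bool" where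
  "metric_measure_space M \<longleftrightarrow>
     space M = UNIV \<and>
     sets borel \<subseteq> sets M \<and>
     (\<forall>A\<in>sets M. \<exists>B\<in>sets borel. A \<subseteq> B \<and> emeasure M B = emeasure M A) \<and>
     emeasure M UNIV \<noteq> 0 \<and>
     (\<forall>U. open U \<and> bounded U \<and> U \<noteq> {} \<longrightarrow> 0 < emeasure M U \<and> emeasure M U < \<infinity>)"

definition nonatomic :: "'a measure \<Rightarrow> bool" where
  "nonatomic M \<longleftrightarrow>
     (\<forall>A\<in>sets M. 0 < emeasure M A \<longrightarrow>
        (\<exists>B\<in>sets M. B \<subseteq> A \<and> 0 < emeasure M B \<and> emeasure M B < emeasure M A))"


section \<open>Lorentz quasinorms\<close>

definition distribution :: "'a measure \<Rightarrow> ('a \<Rightarrow> ereal) \<Rightarrow> real \<Rightarrow> ennreal" where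
  "distribution M f t = emeasure M {x \<in> space M. \<bar>f x\<bar> > ereal t}"

definition rearrangement :: "'a measure \<Rightarrow> ('a \<Rightarrow> ereal) \<Rightarrow> real \<Rightarrow> ennreal" where
  "rearrangement M f t = (INF v\<in>{v. 0 \<le> v \<and> distribution M f v \<le> ennreal t}. ennreal v)"

definition lorentz_norm ::
    "'a measure \<Rightarrow> real \<Rightarrow> ennreal \<Rightarrow> ('a \<Rightarrow> ereal) \<Rightarrow> ennreal" where
  "lorentz_norm M p q f =
     (if q = \<infinity> then (SUP t\<in>{0<..}. ennreal t * ennpow (distribution M f t) (1 / p))
      else ennpow
        (\<integral>\<^sup>+t\<in>{0<..}. (ennpow (ennreal (t powr (1 / p)) * rearrangement M f t) (enn2real q)
                      * ennreal (1 / t)) \<partial>lborel)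
        (1 / enn2real q))"

definition lorentz_space ::
    "'a measure \<Rightarrow> real \<Rightarrow> ennreal \<Rightarrow> ('a \<Rightarrow> ereal) set" where
  "lorentz_space M p q = {f \<in> borel_measurable M. lorentz_norm M p q f < \<infinity>}"


section \<open>Rectifiable curves and line integrals\<close>

text \<open>Curves are continuous maps on \<open>{0..1}\<close>; values outside this interval never matter.\<close>

definition length_on :: "(real \<Rightarrow> 'a::metric_space) \<Rightarrow> real \<Rightarrow> real \<Rightarrow> ennreal" where
  "length_on \<gamma> a b =
     (SUP (n, t)\<in>{(n::nat, t). t 0 = a \<and> t n = b \<and> (\<forall>i<n. t i \<le> t (Suc i))}.
        \<Sum>i<n. ennreal (dist (\<gamma> (t i)) (\<gamma> (t (Suc i)))))"

definition curve_length :: "(real \<Rightarrow> 'a::metric_space) \<Rightarrow> ennreal" where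
  "curve_length \<gamma> = length_on \<gamma> 0 1"

definition rect_curves :: "(real \<Rightarrow> 'a::metric_space) set" where
  "rect_curves = {\<gamma>. path \<gamma> \<and> curve_length \<gamma> < \<infinity> \<and> \<not> \<gamma> constant_on {0..1}}"

text \<open>The parameters \<open>t\<close> for which the initial piece of \<open>\<gamma>\<close> up to \<open>t\<close> has length \<open>s\<close> form an interval
  on which \<open>\<gamma>\<close> is constant, so the choice of \<open>t\<close> is irrelevant.\<close>

definition arc_length_param :: "(real \<Rightarrow> 'a::metric_space) \<Rightarrow> real \<Rightarrow> 'a" where
  "arc_length_param \<gamma> s = \<gamma> (SOME t. t \<in> {0..1} \<and> length_on \<gamma> 0 t = ennreal s)"

definition line_integral :: "(real \<Rightarrow> 'a::metric_space) \<Rightarrow> ('a \<Rightarrow> ennreal) \<Rightarrow> ennreal" where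
  "line_integral \<gamma> \<rho> =
     (\<integral>\<^sup>+s\<in>{0..enn2real (curve_length \<gamma>)}. \<rho> (arc_length_param \<gamma> s) \<partial>lborel)"


section \<open>Modulus\<close>

definition admissible :: "(real \<Rightarrow> 'a::metric_space) set \<Rightarrow> ('a \<Rightarrow> ennreal) set" where
  "admissible \<Gamma> = {\<rho> \<in> borel_measurable borel. \<forall>\<gamma>\<in>\<Gamma>. 1 \<le> line_integral \<gamma> \<rho>}"

definition modulus ::
    "'a::metric_space measure \<Rightarrow> real \<Rightarrow> ennreal \<Rightarrow> (real \<Rightarrow> 'a) set \<Rightarrow> ennreal" where
  "modulus M p q \<Gamma> =
     (INF \<rho>\<in>admissible \<Gamma>. ennpow (lorentz_norm M p q (\<lambda>x. enn2ereal (\<rho> x))) p)"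

definition ae_curve ::
    "'a::metric_space measure \<Rightarrow> real \<Rightarrow> ennreal \<Rightarrow> ((real \<Rightarrow> 'a) \<Rightarrow> bool) \<Rightarrow> bool" where
  "ae_curve M p q P \<longleftrightarrow>
     (\<exists>\<Gamma>\<subseteq>rect_curves. modulus M p q \<Gamma> = 0 \<and> (\<forall>\<gamma>\<in>rect_curves - \<Gamma>. P \<gamma>))"


section \<open>Weak upper gradients and Newtonian spaces\<close>

definition gradient_ineq ::
    "('a::metric_space \<Rightarrow> ereal) \<Rightarrow> ('a \<Rightarrow> ennreal) \<Rightarrow> (real \<Rightarrow> 'a) \<Rightarrow> bool" where
  "gradient_ineq u g \<gamma> \<longleftrightarrow>
     (if \<bar>u (pathstart \<gamma>)\<bar> \<noteq> \<infinity> \<and> \<bar>u (pathfinish \<gamma>)\<bar> \<noteq> \<infinity>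
      then \<bar>u (pathstart \<gamma>) - u (pathfinish \<gamma>)\<bar> \<le> enn2ereal (line_integral \<gamma> g)
      else line_integral \<gamma> g = \<infinity>)"

definition weak_upper_gradient ::
    "'a::metric_space measure \<Rightarrow> real \<Rightarrow> ennreal \<Rightarrow> ('a \<Rightarrow> ereal) \<Rightarrow> ('a \<Rightarrow> ennreal) \<Rightarrow> bool" where
  "weak_upper_gradient M p q u g \<longleftrightarrow>
     u \<in> borel_measurable borel \<and> g \<in> borel_measurable borel \<and>
     ae_curve M p q (gradient_ineq u g)"

definition lorentz_weak_gradients ::
    "'a::metric_space measure \<Rightarrow> real \<Rightarrow> ennreal \<Rightarrow> ('a \<Rightarrow> ereal) \<Rightarrow> ('a \<Rightarrow> ennreal) set" where
  "lorentz_weak_gradients M p q u =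
     {g. weak_upper_gradient M p q u g \<and> (\<lambda>x. enn2ereal (g x)) \<in> lorentz_space M p q}"

definition pre_newtonian ::
    "'a::metric_space measure \<Rightarrow> real \<Rightarrow> ennreal \<Rightarrow> ('a \<Rightarrow> ereal) set" where
  "pre_newtonian M p q =
     {u \<in> borel_measurable borel. u \<in> lorentz_space M p q \<and> lorentz_weak_gradients M p q u \<noteq> {}}"

definition newtonian_norm ::
    "'a::metric_space measure \<Rightarrow> real \<Rightarrow> ennreal \<Rightarrow> ('a \<Rightarrow> ereal) \<Rightarrow> ennreal" where
  "newtonian_norm M p q u =
     (let r = (if q \<le> ennreal p then enn2real q else p)
      in ennpow
           (ennpow (lorentz_norm M p q u) r
            + (INF g\<in>lorentz_weak_gradients M p q u.
                 ennpow (lorentz_norm M p q (\<lambda>x. enn2ereal (g x))) r))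
           (1 / r))"

text \<open>Differences of functions with infinite values are taken to be \<open>0\<close> where the two values
  agree; the other undefined cases do not arise, as \<open>\<infinity> - (-\<infinity>) = \<infinity>\<close> and
  \<open>-\<infinity> - \<infinity> = -\<infinity>\<close>.\<close>

definition ereal_fun_diff :: "('a \<Rightarrow> ereal) \<Rightarrow> ('a \<Rightarrow> ereal) \<Rightarrow> 'a \<Rightarrow> ereal" where
  "ereal_fun_diff u v x = (if u x = v x then 0 else u x - v x)"

definition newtonian ::
    "'a::metric_space measure \<Rightarrow> real \<Rightarrow> ennreal \<Rightarrow> ('a \<Rightarrow> ereal) set set" where
  "newtonian M p q =
     pre_newtonian M p q //
       {(u, v). u \<in> pre_newtonian M p q \<and> v \<in> pre_newtonian M p q \<and>
                newtonian_norm M p q (ereal_fun_diff u v) = 0}"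


section \<open>Capacity\<close>

definition capacity_admissible ::
    "'a::metric_space measure \<Rightarrow> real \<Rightarrow> ennreal \<Rightarrow> 'a set \<Rightarrow> ('a \<Rightarrow> ereal) set" where
  "capacity_admissible M p q E = {u \<in> \<Union> (newtonian M p q). \<forall>x\<in>E. 1 \<le> u x}"

text \<open>The infimum over the empty set is \<open>\<infinity>\<close> in \<^typ>\<open>ennreal\<close>.\<close>

definition capacity ::
    "'a::metric_space measure \<Rightarrow> real \<Rightarrow> ennreal \<Rightarrow> 'a set \<Rightarrow> ennreal" where
  "capacity M p q E = (INF u\<in>capacity_admissible M p q E. ennpow (newtonian_norm M p q u) p)"

end

theory Submission
  imports Defs
begin

text \<open>
Write \<open>\<parallel>\<cdot>\<parallel>\<close> for the Lorentz quasinorm and \<open>r\<close> for the minimum of \<open>p\<close> and \<open>q\<close>. Truncation to \<open>[0, 1]\<close> shows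
that the power \<open>r/p\<close> of the capacity of \<open>E\<close> is the infimum of the energy \<open>\<parallel>u\<parallel>\<^sup>r + \<parallel>g\<parallel>\<^sup>r\<close> over all Borel
functions \<open>0 \<le> u \<le> 1\<close> that equal \<open>1\<close> on \<open>E\<close> and all weak upper gradients \<open>g\<close> of \<open>u\<close>
(\<open>capacity_eq_min_energy\<close>). Monotonicity is immediate.

Subadditivity holds because such pairs can be combined by pointwise suprema: \<open>(sup u\<^sub>i, sup g\<^sub>i)\<close> is a
competitor for the union of the \<open>E\<^sub>i\<close> (\<open>cap_pairs_SUP\<close>), and \<open>\<parallel>sup f\<^sub>i\<parallel>\<^sup>r \<le> \<Sum> \<parallel>f\<^sub>i\<parallel>\<^sup>r\<close> (\<open>lnorm_SUP_le\<close>). The latter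
follows from the formula \<open>\<parallel>f\<parallel>\<^sup>q = (p/q) C(f\<^sup>q)\<close> with the Choquet integral
\<open>C(F) = \<integral>\<^sub>0\<^sup>\<infinity> \<mu>(F > \<tau>)\<^sup>\<theta> d\<tau>\<close>, \<open>\<theta> = q/p\<close> (\<open>lorentz_norm_eq_choquet\<close>), by the subadditivity of \<open>\<mu>\<close> and of
the power \<open>\<theta>\<close> if \<open>q \<le> p\<close>, and by Minkowski's inequality for the exponent \<open>\<theta>\<close> if \<open>p < q < \<infinity>\<close>; the case \<open>q = \<infinity>\<close> is direct.

Continuity from below, for \<open>1 < q \<le> p\<close>, rests on uniform convexity in a form adapted to suprema: if
the midpoint of \<open>f\<close> and \<open>g\<close> has nearly the mean value of \<open>\<parallel>f\<parallel>\<^sup>q\<close> and \<open>\<parallel>g\<parallel>\<^sup>q\<close>, then \<open>g \<le> (1 + \<eta>) f\<close> outside a set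
on which \<open>g\<close> is small in quasinorm (\<open>lnorm_uniform_convexity\<close>). Take near minimizers for a sequence
of sets \<open>E\<^sub>n\<close> whose minimal energies are close to their limit \<open>a\<close>. The midpoint of two consecutive
ones is a competitor for the smaller set, so its energy is nearly \<open>a\<close> as well, and uniform convexity
applies. Hence each member of the sequence is at most a factor close to \<open>1\<close> times the maximum of the
preceding one and a small error. Consequently the supremum of the whole sequence, which is a
competitor for the union, has energy close to \<open>a\<close> (\<open>lnorm_SUP_chain\<close>, \<open>min_energy_Union_le\<close>).

Uniform convexity of \<open>f \<mapsto> C(f\<^sup>q)\<close> combines the strict convexity of the power \<open>q > 1\<close> with the
subadditivity of \<open>C\<close>, which is the submodularity of \<open>\<mu>(\<cdot>)\<^sup>\<theta>\<close> for \<open>\<theta> \<le> 1\<close> integrated over all levels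
(\<open>choquet_add_le\<close>).
\<close>

section \<open>Inequalities for real powers\<close>

text \<open>Bernoulli's inequality: a concave power lies below its tangent at \<open>1\<close>.\<close>

lemma powr_le_tangent:
  fixes t \<theta> :: real
  assumes "0 \<le> t" "0 < \<theta>" "\<theta> \<le> 1"
  shows "t powr \<theta> \<le> \<theta> * t + (1 - \<theta>)"
  using Youngs_inequality_0[of \<theta> "1 - \<theta>" t 1] assms
  by (cases "t = 0"; cases "\<theta> = 1") auto

lemma powr_concave_comb:
  fixes x y \<theta> l :: real
  assumes "0 \<le> x" "0 \<le> y" "0 < \<theta>" "\<theta> \<le> 1" "0 \<le> l" "l \<le> 1"
  shows "l * x powr \<theta> + (1 - l) * y powr \<theta> \<le> (l * x + (1 - l) * y) powr \<theta>"
proof -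
  define z where "z = l * x + (1 - l) * y"
  have z0: "0 \<le> z" using assms by (simp add: z_def)
  show ?thesis
  proof (cases "z = 0")
    case True
    then have "l * x = 0" "(1 - l) * y = 0"
      using assms unfolding z_def by (smt (verit) mult_nonneg_nonneg)+
    then show ?thesis using assms by auto
  next
    case False
    then have z: "0 < z" using z0 by simp
    have b: "w powr \<theta> \<le> z powr \<theta> * (\<theta> * (w / z) + (1 - \<theta>))" if "0 \<le> w" for w
    proof -
      have "w powr \<theta> = z powr \<theta> * (w / z) powr \<theta>"
        using z that by (simp add: powr_divide)
      also have "\<dots> \<le> z powr \<theta> * (\<theta> * (w / z) + (1 - \<theta>))"
        using powr_le_tangent[of "w / z" \<theta>] assms z that by (intro mult_left_mono) auto
      finally show ?thesis .
    qed
    have "l * x powr \<theta> + (1 - l) * y powr \<theta>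
        \<le> l * (z powr \<theta> * (\<theta> * (x / z) + (1 - \<theta>))) + (1 - l) * (z powr \<theta> * (\<theta> * (y / z) + (1 - \<theta>)))"
      using assms b by (intro add_mono mult_left_mono) auto
    also have "\<dots> = z powr \<theta> * (\<theta> * ((l * x + (1 - l) * y) / z) + (1 - \<theta>))"
      using z by (simp add: field_simps)
    also have "\<dots> = z powr \<theta>"
      using z by (simp add: z_def[symmetric])
    finally show ?thesis by (simp add: z_def)
  qed
qed

text \<open>Both \<open>a + b\<close> and \<open>a + d\<close> are convex combinations of the end points \<open>a\<close> and \<open>a + b + d\<close>, with
complementary weights; adding the two instances of concavity gives the claim. For measures of
sets this says that \<open>A \<mapsto> \<mu>(A)\<^sup>\<theta>\<close> is submodular.\<close>

lemma powr_submodular: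
  fixes a b d \<theta> :: real
  assumes "0 \<le> a" "0 \<le> b" "0 \<le> d" "0 < \<theta>" "\<theta> \<le> 1"
  shows "(a + b + d) powr \<theta> + a powr \<theta> \<le> (a + b) powr \<theta> + (a + d) powr \<theta>"
proof (cases "b + d = 0")
  case True then show ?thesis using assms by (auto simp: add_nonneg_eq_0_iff)
next
  case False
  define l where "l = b / (b + d)"
  have l: "0 \<le> l" "l \<le> 1" using False assms by (auto simp: l_def divide_simps)
  have lb: "l * (b + d) = b" using False by (simp add: l_def)
  have "l * (a + b + d) + (1 - l) * a = a + l * (b + d)" by (simp add: algebra_simps)
  then have e1: "l * (a + b + d) + (1 - l) * a = a + b" using lb by simp
  have "(1 - l) * (a + b + d) + (1 - (1 - l)) * a = a + (b + d) - l * (b + d)"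
    by (simp add: algebra_simps)
  then have e2: "(1 - l) * (a + b + d) + (1 - (1 - l)) * a = a + d" using lb by simp
  have "l * (a + b + d) powr \<theta> + (1 - l) * a powr \<theta> \<le> (a + b) powr \<theta>"
    using powr_concave_comb[of "a + b + d" a \<theta> l] e1 assms l by simp
  moreover have "(1 - l) * (a + b + d) powr \<theta> + (1 - (1 - l)) * a powr \<theta> \<le> (a + d) powr \<theta>"
    using powr_concave_comb[of "a + b + d" a \<theta> "1 - l"] e2 assms l by simp
  ultimately show ?thesis by (simp add: algebra_simps)
qed

lemma powr_convex_comb:
  fixes x y q l :: real
  assumes "0 \<le> x" "0 \<le> y" "1 \<le> q" "0 \<le> l" "l \<le> 1"
  shows "(l * x + (1 - l) * y) powr q \<le> l * x powr q + (1 - l) * y powr q"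
proof -
  have "l * (x powr q) powr (1/q) + (1 - l) * (y powr q) powr (1/q)
     \<le> (l * x powr q + (1 - l) * y powr q) powr (1/q)"
    using assms by (intro powr_concave_comb) auto
  then have "l * x + (1 - l) * y \<le> (l * x powr q + (1 - l) * y powr q) powr (1/q)"
    using assms by (simp add: powr_powr)
  then have "(l * x + (1 - l) * y) powr q \<le> ((l * x powr q + (1 - l) * y powr q) powr (1/q)) powr q"
    using assms by (intro powr_mono2) auto
  then show ?thesis using assms by (simp add: powr_powr)
qed

text \<open>The difference of the two sides vanishes at \<open>x = 1\<close> and is strictly decreasing on \<open>[0, 1]\<close>.\<close>

lemma powr_midpoint_strict:
  fixes q x :: real
  assumes "1 < q" "0 \<le> x" "x < 1"
  shows "((1 + x) / 2) powr q < (1 + x powr q) / 2"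
proof -
  define k where "k x = (1 + x powr q) / 2 - ((1 + x) / 2) powr q" for x :: real
  have "k 1 < k x"
  proof (rule DERIV_neg_imp_decreasing_open[of x 1])
    show "x < 1" using assms by simp
    show "continuous_on {x..1} k"
      unfolding k_def using assms by (intro continuous_intros continuous_on_powr') auto
    fix t assume t: "x < t" "t < 1"
    have "(k has_real_derivative (q / 2) * (t powr (q - 1) - ((1 + t) / 2) powr (q - 1))) (at t)"
      unfolding k_def using t assms by (auto intro!: derivative_eq_intros simp: algebra_simps)
    moreover have "t powr (q - 1) < ((1 + t) / 2) powr (q - 1)"
      using t assms by (intro powr_less_mono2) auto
    ultimately show "\<exists>y. DERIV k t :> y \<and> y < 0"
      using assms by (intro exI conjI) (auto intro!: mult_pos_neg)
  qed
  then show ?thesis by (simp add: k_def)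
qed

text \<open>Strict midpoint convexity becomes uniform, with a factor \<open>1 - c\<close>, as long as the ratio of the two
points stays away from \<open>1\<close>: a continuous function that is less than \<open>1\<close> on a compact interval has a
maximum less than \<open>1\<close>.\<close>

lemma powr_midpoint_gap:
  fixes q r :: real
  assumes "1 < q" "0 \<le> r" "r < 1"
  obtains c where "0 < c" "c < 1"
    "\<And>x. 0 \<le> x \<Longrightarrow> x \<le> r \<Longrightarrow> ((1 + x) / 2) powr q \<le> (1 - c) * ((1 + x powr q) / 2)"
proof -
  define k where "k x = ((1 + x) / 2) powr q / ((1 + x powr q) / 2)" for x :: real
  have pos: "0 < 1 + x powr q" for x :: real
    by (rule add_pos_nonneg) auto
  have "continuous_on {0..r} k"
    unfolding k_def
  proof (intro continuous_on_divide continuous_on_powr' continuous_on_add continuous_on_const continuous_on_id ballI)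
    show "(1 + x powr q) / 2 \<noteq> 0" for x :: real using pos[of x] by simp
  qed (use assms in auto)
  then have "\<exists>x\<in>{0..r}. \<forall>y\<in>{0..r}. k y \<le> k x"
    using assms by (intro continuous_attains_sup) auto
  then obtain x where x: "x \<in> {0..r}" "\<forall>y\<in>{0..r}. k y \<le> k x" by blast
  have "((1 + x) / 2) powr q < (1 + x powr q) / 2"
    using x assms by (intro powr_midpoint_strict) auto
  then have k1: "k x < 1" unfolding k_def using pos[of x] by simp
  have k0: "0 < k x" unfolding k_def using pos[of x] x by (auto intro!: divide_pos_pos)
  show ?thesis
  proof (rule that[of "1 - k x"])
    show "0 < 1 - k x" "1 - k x < 1" using k0 k1 by auto
    fix y :: real assume "0 \<le> y" "y \<le> r"
    then have "k y \<le> k x" using x by auto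
    then show "((1 + y) / 2) powr q \<le> (1 - (1 - k x)) * ((1 + y powr q) / 2)"
      unfolding k_def[of y] using pos[of y] by (simp add: divide_le_eq)
  qed
qed

text \<open>Compare \<open>b\<^sup>\<theta>\<close> with \<open>(b + d)\<^sup>\<theta>\<close>. Either \<open>d\<close> is a negligible fraction of the total, and then \<open>d\<^sup>\<theta>\<close> is
at most \<open>\<kappa> (b + d)\<^sup>\<theta>\<close>; or passing from \<open>b + d\<close> to \<open>b\<close> loses a fixed proportion of the power, and a
multiple \<open>K\<close> of this loss dominates \<open>d\<^sup>\<theta>\<close>. Integrated, this turns the smallness of a loss into the
smallness of what was removed.\<close>

lemma powr_split_gap:
  fixes \<theta> \<kappa> :: real
  assumes "0 < \<theta>" "0 < \<kappa>"
  obtains K where "0 < K"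
    "\<And>b d. 0 \<le> d \<Longrightarrow> 0 \<le> b \<Longrightarrow> d powr \<theta> + K * b powr \<theta> \<le> (\<kappa> + K) * (b + d) powr \<theta>"
proof -
  \<comment> \<open>Below the fraction z0 the first alternative holds; above it, the loss is at least 1 / K.\<close>
  define z0 where "z0 = min 1 \<kappa> powr (1 / \<theta>)"
  have z0: "0 < z0" "z0 \<le> 1" using assms by (auto simp: z0_def powr_le1)
  have lt: "(1 - z0) powr \<theta> < 1"
    using z0 assms powr_less_mono2[of \<theta> "1 - z0" 1] by auto
  define K where "K = 1 / (1 - (1 - z0) powr \<theta>)"
  have K: "0 < K" using lt by (simp add: K_def)
  have K1: "1 + K * (1 - z0) powr \<theta> = K"
    using lt by (simp add: K_def field_simps)
  have unit: "z powr \<theta> + K * (1 - z) powr \<theta> \<le> \<kappa> + K" if "0 \<le> z" "z \<le> 1" for z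
  proof (cases "z \<le> z0")
    case True
    then have "z powr \<theta> \<le> z0 powr \<theta>" using assms that by (intro powr_mono2) auto
    also have "\<dots> \<le> \<kappa>" using assms by (simp add: z0_def powr_powr)
    finally have "z powr \<theta> \<le> \<kappa>" .
    moreover have "(1 - z) powr \<theta> \<le> 1" using assms that by (intro powr_le1) auto
    ultimately show ?thesis using mult_left_mono[of "(1 - z) powr \<theta>" 1 K] K by linarith
  next
    case False
    have "z powr \<theta> \<le> 1" using assms that by (intro powr_le1) auto
    moreover have "(1 - z) powr \<theta> \<le> (1 - z0) powr \<theta>"
      using False assms that by (intro powr_mono2) auto
    then have "K * (1 - z) powr \<theta> \<le> K * (1 - z0) powr \<theta>" using K by simp
    ultimately show ?thesis using K1 assms by linarith
  qed
  show ?thesis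
  proof (rule that[OF K])
    fix b d :: real assume bd: "0 \<le> d" "0 \<le> b"
    show "d powr \<theta> + K * b powr \<theta> \<le> (\<kappa> + K) * (b + d) powr \<theta>"
    proof (cases "b + d = 0")
      case True then show ?thesis using bd by (auto simp: add_nonneg_eq_0_iff)
    next
      case False
      then have s: "0 < b + d" using bd by auto
      have "(d / (b + d)) powr \<theta> + K * (1 - d / (b + d)) powr \<theta> \<le> \<kappa> + K"
        using bd s by (intro unit) auto
      moreover have "1 - d / (b + d) = b / (b + d)" using s by (simp add: field_simps)
      ultimately have "(d powr \<theta> + K * b powr \<theta>) / (b + d) powr \<theta> \<le> \<kappa> + K"
        using bd by (simp add: powr_divide add_divide_distrib)
      then show ?thesis using s by (simp add: divide_le_eq)
    qed
  qed
qed

section \<open>Powers of extended nonnegative reals\<close>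

lemma double_half_ennreal: "2 * (ennreal (1 / 2) * y) = y"
  using ennreal_mult[of 2 "1 / 2"] by (simp add: mult.assoc[symmetric])

lemma half_double_le_iff: "ennreal (1 / 2) * x \<le> y \<longleftrightarrow> x \<le> 2 * y"
proof -
  have "ennreal (1 / 2) * x \<le> y \<longleftrightarrow> 2 * (ennreal (1 / 2) * x) \<le> 2 * y"
    by (rule ennreal_mult_le_mult_iff[symmetric]) auto
  then show ?thesis by (simp only: double_half_ennreal)
qed

lemma ennpow_0 [simp]: "ennpow 0 a = 0"
  by (simp add: ennpow_def)

lemma ennpow_top [simp]: "ennpow top a = top"
  by (simp add: ennpow_def infinity_ennreal_def)

lemma ennpow_ennreal: "0 \<le> x \<Longrightarrow> ennpow (ennreal x) a = ennreal (x powr a)"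
  by (simp add: ennpow_def infinity_ennreal_def)

lemma ennpow_mono: "0 \<le> a \<Longrightarrow> x \<le> y \<Longrightarrow> ennpow x a \<le> ennpow y a"
  by (cases x; cases y) (auto simp: ennpow_ennreal top_unique intro!: ennreal_leI powr_mono2)

lemma ennpow_exp_one [simp]: "ennpow x 1 = x"
  by (cases x) (auto simp: ennpow_ennreal)

lemma ennpow_ennpow: "ennpow (ennpow x a) b = ennpow x (a * b)"
  by (cases x) (auto simp: ennpow_ennreal powr_powr)

lemma ennpow_inverse [simp]:
  "a \<noteq> 0 \<Longrightarrow> ennpow (ennpow x a) (1 / a) = x" "a \<noteq> 0 \<Longrightarrow> ennpow (ennpow x (1 / a)) a = x"
  by (simp_all add: ennpow_ennpow)

lemma ennpow_mult: "0 < a \<Longrightarrow> ennpow (x * y) a = ennpow x a * ennpow y a"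
proof (cases x; cases y)
  fix r s :: real assume "0 < a" "0 \<le> r" "x = ennreal r" "0 \<le> s" "y = ennreal s"
  then show ?thesis by (simp add: ennpow_ennreal powr_mult flip: ennreal_mult)
qed (auto simp: ennpow_ennreal ennreal_mult_top ennreal_top_mult ennreal_mult_eq_top_iff)

lemma ennpow_le_swap: "0 < a \<Longrightarrow> ennpow x a \<le> y \<longleftrightarrow> x \<le> ennpow y (1 / a)"
  using ennpow_mono[of a x "ennpow y (1/a)"] ennpow_mono[of "1/a" "ennpow x a" y] by auto

lemma le_ennpow_swap: "0 < a \<Longrightarrow> y \<le> ennpow x a \<longleftrightarrow> ennpow y (1 / a) \<le> x"
  using ennpow_le_swap[of "1/a" y x] by simp

lemma less_ennpow_swap: "0 < a \<Longrightarrow> y < ennpow x a \<longleftrightarrow> ennpow y (1 / a) < x"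
  using ennpow_le_swap[of a x y] by (simp flip: not_le)

lemma ennpow_le_iff: "0 < a \<Longrightarrow> ennpow x a \<le> ennpow y a \<longleftrightarrow> x \<le> y"
  by (simp add: ennpow_le_swap)

lemma ennpow_eq_top_iff [simp]: "ennpow x a = top \<longleftrightarrow> x = top"
  by (cases x) (auto simp: ennpow_ennreal)

lemma ennpow_eq_0_iff [simp]: "ennpow x a = 0 \<longleftrightarrow> x = 0"
  by (cases x) (auto simp: ennpow_ennreal)

lemma ennpow_SUP:
  assumes "0 < a" "I \<noteq> {}"
  shows "ennpow (SUP i\<in>I. f i) a = (SUP i\<in>I. ennpow (f i) a)"
proof (rule antisym)
  show "ennpow (SUP i\<in>I. f i) a \<le> (SUP i\<in>I. ennpow (f i) a)"
    unfolding ennpow_le_swap[OF assms(1)]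
    by (intro SUP_least) (metis ennpow_le_swap[OF assms(1)] SUP_upper)
  show "(SUP i\<in>I. ennpow (f i) a) \<le> ennpow (SUP i\<in>I. f i) a"
    using assms by (intro SUP_least ennpow_mono SUP_upper) auto
qed

lemma ennpow_INF:
  assumes "0 < a"
  shows "ennpow (INF i\<in>I. f i) a = (INF i\<in>I. ennpow (f i) a)"
proof (rule antisym)
  show "(INF i\<in>I. ennpow (f i) a) \<le> ennpow (INF i\<in>I. f i) a"
    unfolding le_ennpow_swap[OF assms(1)]
    by (intro INF_greatest) (metis le_ennpow_swap[OF assms(1)] INF_lower)
  show "ennpow (INF i\<in>I. f i) a \<le> (INF i\<in>I. ennpow (f i) a)"
    using assms by (intro INF_greatest ennpow_mono INF_lower) auto
qed

lemma measurable_ennpow [measurable]: "(\<lambda>x. ennpow x a) \<in> borel_measurable borel"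
  unfolding ennpow_def by measurable

lemma ennpow_submodular:
  assumes "0 < \<theta>" "\<theta> \<le> 1"
  shows "ennpow (a + b + d) \<theta> + ennpow a \<theta> \<le> ennpow (a + b) \<theta> + ennpow (a + d) \<theta>"
proof (cases "a = top \<or> b = top \<or> d = top")
  case True then show ?thesis by auto
next
  case False
  then obtain x y z where "a = ennreal x" "0 \<le> x" "b = ennreal y" "0 \<le> y" "d = ennreal z" "0 \<le> z"
    by (metis ennreal_cases)
  then show ?thesis using powr_submodular[of x y z \<theta>] assms
    by (simp add: ennpow_ennreal flip: ennreal_plus)
qed

lemma ennpow_add_le:
  assumes "0 < \<theta>" "\<theta> \<le> 1"
  shows "ennpow (a + b) \<theta> \<le> ennpow a \<theta> + ennpow b \<theta>"
  using ennpow_submodular[of \<theta> 0 a b] assms by simp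

lemma ennpow_suminf_le:
  assumes "0 < \<theta>" "\<theta> \<le> 1"
  shows "ennpow (\<Sum>i. f i) \<theta> \<le> (\<Sum>i. ennpow (f i) \<theta>)"
proof -
  have fin: "ennpow (\<Sum>i<n. f i) \<theta> \<le> (\<Sum>i<n. ennpow (f i) \<theta>)" for n
  proof (induction n)
    case (Suc n)
    then show ?case using ennpow_add_le[OF assms, of "\<Sum>i<n. f i" "f n"]
      by (simp add: order.trans[OF _ add_right_mono])
  qed simp
  have "ennpow (\<Sum>i. f i) \<theta> = (SUP n. ennpow (\<Sum>i<n. f i) \<theta>)"
    using assms by (simp add: suminf_eq_SUP ennpow_SUP)
  also have "\<dots> \<le> (SUP n. \<Sum>i<n. ennpow (f i) \<theta>)"
    using fin by (intro SUP_mono) auto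
  finally show ?thesis by (simp add: suminf_eq_SUP)
qed

lemma ennpow_convex_comb:
  assumes "1 \<le> q" "0 \<le> l" "l \<le> 1"
  shows "ennpow (ennreal l * x + ennreal (1 - l) * y) q
    \<le> ennreal l * ennpow x q + ennreal (1 - l) * ennpow y q"
proof (cases "l = 0 \<or> l = 1 \<or> x = top \<or> y = top")
  case True then show ?thesis using assms by (auto simp: ennreal_mult_top)
next
  case False
  then obtain r s where "x = ennreal r" "0 \<le> r" "y = ennreal s" "0 \<le> s"
    by (metis ennreal_cases)
  then show ?thesis using powr_convex_comb[of r s q l] assms
    by (simp add: ennpow_ennreal flip: ennreal_plus ennreal_mult)
qed

text \<open>By homogeneity only the ratio of the two points matters, and here it is at most
\<open>1 / (1 + \<eta>)\<close>.\<close>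

lemma ennpow_midpoint_gap:
  assumes "1 < q" "0 < \<eta>"
  obtains c where "0 < c" "c < 1"
    "\<And>x y. ennreal (1 + \<eta>) * x < y \<Longrightarrow>
       ennpow (ennreal (1 / 2) * (x + y)) q \<le> ennreal ((1 - c) / 2) * (ennpow x q + ennpow y q)"
proof -
  obtain c where c: "0 < c" "c < 1"
    "\<And>x. 0 \<le> x \<Longrightarrow> x \<le> 1 / (1 + \<eta>) \<Longrightarrow> ((1 + x) / 2) powr q \<le> (1 - c) * ((1 + x powr q) / 2)"
    using powr_midpoint_gap[of q "1 / (1 + \<eta>)"] assms by auto
  show ?thesis
  proof (rule that[OF c(1,2)])
    fix x y assume xy: "ennreal (1 + \<eta>) * x < y"
    show "ennpow (ennreal (1 / 2) * (x + y)) q \<le> ennreal ((1 - c) / 2) * (ennpow x q + ennpow y q)"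
    proof (cases "y = top")
      case True then show ?thesis using c by (simp add: ennreal_mult_top)
    next
      case False
      have "x \<noteq> top" using xy assms by (auto simp: ennreal_mult_top)
      with False obtain r s where rs: "x = ennreal r" "0 \<le> r" "y = ennreal s" "0 \<le> s"
        by (metis ennreal_cases)
      then have lt: "(1 + \<eta>) * r < s" using xy assms by (simp add: ennreal_less_iff flip: ennreal_mult del: ennreal_plus)
      then have s: "0 < s" using rs assms by (smt (verit) mult_nonneg_nonneg)
      have "((1 + r / s) / 2) powr q \<le> (1 - c) * ((1 + (r / s) powr q) / 2)"
        using lt s rs assms by (intro c(3)) (auto simp: field_simps)
      then have "s powr q * ((1 + r / s) / 2) powr q \<le> s powr q * ((1 - c) * ((1 + (r / s) powr q) / 2))"
        by (intro mult_left_mono) auto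
      moreover have "s powr q * ((1 + r / s) / 2) powr q = ((r + s) / 2) powr q"
        using s rs by (simp add: distrib_left add.commute flip: powr_mult)
      moreover have "s powr q * ((1 - c) * ((1 + (r / s) powr q) / 2)) = (1 - c) / 2 * (r powr q + s powr q)"
        using s rs by (simp add: powr_divide field_simps)
      ultimately have fin: "((r + s) / 2) powr q \<le> (1 - c) / 2 * (r powr q + s powr q)"
        by linarith
      have "ennreal (1 / 2) * (x + y) = ennreal ((r + s) / 2)"
        using rs ennreal_mult[of "1 / 2" "r + s"] by simp
      then have "ennpow (ennreal (1 / 2) * (x + y)) q = ennreal (((r + s) / 2) powr q)"
        using rs ennpow_ennreal[of "(r + s) / 2" q] by (metis add_nonneg_nonneg divide_nonneg_pos zero_less_numeral)
      also have "\<dots> \<le> ennreal ((1 - c) / 2 * (r powr q + s powr q))"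
        using fin by (rule ennreal_leI)
      also have "\<dots> = ennreal ((1 - c) / 2) * (ennpow x q + ennpow y q)"
        using rs c ennreal_mult[of "(1 - c) / 2" "r powr q + s powr q"] by (simp add: ennpow_ennreal)
      finally show ?thesis .
    qed
  qed
qed

lemma ennpow_split_gap:
  assumes "0 < \<theta>" "0 < \<kappa>"
  obtains K where "0 < K"
    "\<And>b d. ennpow d \<theta> + ennreal K * ennpow b \<theta> \<le> ennreal (\<kappa> + K) * ennpow (b + d) \<theta>"
proof -
  obtain K where K: "0 < K"
    "\<And>b d. 0 \<le> d \<Longrightarrow> 0 \<le> b \<Longrightarrow> d powr \<theta> + K * b powr \<theta> \<le> (\<kappa> + K) * (b + d) powr \<theta>"
    using powr_split_gap[OF assms] by blast
  show ?thesis
  proof (rule that[OF K(1)])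
    fix b d :: ennreal
    show "ennpow d \<theta> + ennreal K * ennpow b \<theta> \<le> ennreal (\<kappa> + K) * ennpow (b + d) \<theta>"
    proof (cases "b = top \<or> d = top")
      case True then show ?thesis using K(1) assms by (auto simp: ennreal_mult_top)
    next
      case False
      then obtain r s where "b = ennreal r" "0 \<le> r" "d = ennreal s" "0 \<le> s"
        by (metis ennreal_cases)
      then show ?thesis using K(2)[of s r] K(1) assms
        by (simp add: ennpow_ennreal flip: ennreal_plus ennreal_mult)
    qed
  qed
qed

section \<open>The Lorentz quasinorm as a Choquet integral\<close>

text \<open>The superlevel sets of a monotone function on the line are intervals.\<close>

lemma borel_measurable_antimono_ennreal:
  fixes m :: "real \<Rightarrow> ennreal"
  assumes "antimono m"
  shows "m \<in> borel_measurable borel"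
proof (rule borel_measurableI_greater)
  fix y
  have "is_interval {x. y < m x}"
    unfolding is_interval_1 using assms by (auto dest: antimonoD order.strict_trans2)
  then show "{x \<in> space borel. y < m x} \<in> sets borel"
    by (simp add: real_interval_borel_measurable)
qed

definition tail :: "'a measure \<Rightarrow> ('a \<Rightarrow> ennreal) \<Rightarrow> real \<Rightarrow> ennreal" where
  "tail M F \<tau> = emeasure M {x \<in> space M. ennreal \<tau> < F x}"

text \<open>The Choquet integral of \<open>F\<close> with respect to the set function \<open>A \<mapsto> \<mu>(A)\<^sup>\<theta>\<close>; for \<open>\<theta> = 1\<close> it is the layer
cake formula for the integral of \<open>F\<close>. In this form, suprema and sums of functions are
easier to handle than in terms of the decreasing rearrangement.\<close>

definition choquet :: "'a measure \<Rightarrow> real \<Rightarrow> ('a \<Rightarrow> ennreal) \<Rightarrow> ennreal" where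
  "choquet M \<theta> F = (\<integral>\<^sup>+\<tau>\<in>{0<..}. ennpow (tail M F \<tau>) \<theta> \<partial>lborel)"

lemma tail_antimono:
  assumes "F \<in> borel_measurable M"
  shows "antimono (tail M F)"
  unfolding tail_def using assms
  by (intro antimonoI emeasure_mono) (auto dest: ennreal_leI intro: order.strict_trans1)

lemma borel_measurable_tail [measurable (raw)]:
  assumes "F \<in> borel_measurable M" "g \<in> borel_measurable N"
  shows "(\<lambda>x. tail M F (g x)) \<in> borel_measurable N"
  using borel_measurable_antimono_ennreal[OF tail_antimono[OF assms(1)]] assms(2) by measurable

lemma borel_measurable_ennpow [measurable (raw)]:
  "f \<in> borel_measurable N \<Longrightarrow> (\<lambda>x. ennpow (f x) a) \<in> borel_measurable N"
  using measurable_ennpow by measurable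

lemma tail_mono:
  assumes "G \<in> borel_measurable M" "\<And>x. x \<in> space M \<Longrightarrow> F x \<le> G x"
  shows "tail M F \<tau> \<le> tail M G \<tau>"
  unfolding tail_def using assms by (intro emeasure_mono) (auto intro: order.strict_trans2)

lemma choquet_mono:
  assumes "0 \<le> \<theta>" "G \<in> borel_measurable M" "\<And>x. x \<in> space M \<Longrightarrow> F x \<le> G x"
  shows "choquet M \<theta> F \<le> choquet M \<theta> G"
  unfolding choquet_def using assms
  by (intro nn_integral_mono mult_right_mono ennpow_mono tail_mono) auto

lemma tail_SUP:
  fixes F :: "nat \<Rightarrow> 'a \<Rightarrow> ennreal"
  assumes "\<And>n. F n \<in> borel_measurable M" "\<And>x. incseq (\<lambda>n. F n x)"
  shows "tail M (\<lambda>x. SUP n. F n x) \<tau> = (SUP n. tail M (F n) \<tau>)"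
proof -
  have "{x \<in> space M. ennreal \<tau> < (SUP n. F n x)} = (\<Union>n. {x \<in> space M. ennreal \<tau> < F n x})"
    by (auto simp: less_SUP_iff)
  moreover have "incseq (\<lambda>n. {x \<in> space M. ennreal \<tau> < F n x})"
    using assms(2) by (fastforce intro!: incseq_SucI dest: incseq_SucD order.strict_trans2)
  ultimately show ?thesis
    unfolding tail_def using assms(1) by (simp add: SUP_emeasure_incseq image_subset_iff)
qed

lemma choquet_SUP:
  fixes F :: "nat \<Rightarrow> 'a \<Rightarrow> ennreal"
  assumes "0 < \<theta>" and [measurable]: "\<And>n. F n \<in> borel_measurable M"
    and inc: "\<And>x. incseq (\<lambda>n. F n x)"
  shows "choquet M \<theta> (\<lambda>x. SUP n. F n x) = (SUP n. choquet M \<theta> (F n))"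
proof -
  have "choquet M \<theta> (\<lambda>x. SUP n. F n x)
      = (\<integral>\<^sup>+\<tau>. (SUP n. ennpow (tail M (F n) \<tau>) \<theta> * indicator {0<..} \<tau>) \<partial>lborel)"
    unfolding choquet_def tail_SUP[OF assms(2) inc]
    using assms(1) by (simp add: ennpow_SUP SUP_mult_right_ennreal)
  also have "\<dots> = (SUP n. \<integral>\<^sup>+\<tau>. ennpow (tail M (F n) \<tau>) \<theta> * indicator {0<..} \<tau> \<partial>lborel)"
    using assms(1) inc
    by (intro nn_integral_monotone_convergence_SUP incseq_SucI le_funI mult_right_mono ennpow_mono tail_mono)
      (auto dest: incseq_SucD)
  finally show ?thesis by (simp add: choquet_def)
qed

lemma choquet_cmult:
  assumes c: "0 < c" and [measurable]: "F \<in> borel_measurable M"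
  shows "choquet M \<theta> (\<lambda>x. ennreal c * F x) = ennreal c * choquet M \<theta> F"
proof -
  have t: "tail M (\<lambda>x. ennreal c * F x) (c * \<tau>) = tail M F \<tau>" if "0 < \<tau>" for \<tau>
  proof -
    have "ennreal (c * \<tau>) < ennreal c * y \<longleftrightarrow> ennreal \<tau> < y" for y
      using that c by (cases y) (auto simp: ennreal_mult_top ennreal_less_iff simp flip: ennreal_mult)
    then show ?thesis by (simp add: tail_def)
  qed
  have "choquet M \<theta> (\<lambda>x. ennreal c * F x)
     = ennreal \<bar>c\<bar> * (\<integral>\<^sup>+\<tau>. ennpow (tail M (\<lambda>x. ennreal c * F x) (0 + c * \<tau>)) \<theta> * indicator {0<..} (0 + c * \<tau>) \<partial>lborel)"
    unfolding choquet_def using c by (intro nn_integral_real_affine) auto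
  also have "(\<integral>\<^sup>+\<tau>. ennpow (tail M (\<lambda>x. ennreal c * F x) (0 + c * \<tau>)) \<theta> * indicator {0<..} (0 + c * \<tau>) \<partial>lborel)
     = choquet M \<theta> F"
    unfolding choquet_def using c
    by (intro nn_integral_cong) (auto simp: t indicator_def zero_less_mult_iff)
  finally show ?thesis using c by simp
qed

text \<open>The weight \<open>t\<^sup>\<theta>\<^sup>-\<^sup>1\<close> is singular at \<open>0\<close> when \<open>\<theta> < 1\<close>, and \<open>b\<close> may be infinite; the latter case follows
from the finite one by exhaustion.\<close>

lemma nn_integral_powr_below:
  assumes \<theta>: "0 < \<theta>"
  shows "(\<integral>\<^sup>+t\<in>{0<..}. (ennreal (t powr (\<theta> - 1)) * indicator {t. ennreal t < b} t) \<partial>lborel)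
     = ennpow b \<theta> * ennreal (1 / \<theta>)"
proof -
  have fin: "(\<integral>\<^sup>+t\<in>{0<..}. (ennreal (t powr (\<theta> - 1)) * indicator {t. ennreal t < ennreal r} t) \<partial>lborel)
     = ennreal (r powr \<theta> * (1 / \<theta>))" if "0 \<le> r" for r
  proof -
    have "((\<lambda>t. t powr (\<theta> - 1)) has_integral (r powr (\<theta> - 1 + 1) / (\<theta> - 1 + 1))) {0..r}"
      using \<theta> that by (intro has_integral_powr_from_0) auto
    then have h: "((\<lambda>t. t powr (\<theta> - 1)) has_integral (r powr \<theta> * (1 / \<theta>))) {0..r}"
      by simp
    have "(\<lambda>t. indicator {0..r} t * t powr (\<theta> - 1)) = (\<lambda>t. if t \<in> {0..r} then t powr (\<theta> - 1) else 0)"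
      by (rule ext) (simp add: indicator_def)
    with h have "((\<lambda>t. indicator {0..r} t * t powr (\<theta> - 1)) has_integral (r powr \<theta> * (1 / \<theta>))) UNIV"
      by (simp only: has_integral_restrict_UNIV)
    then have "(\<integral>\<^sup>+t. ennreal (indicator {0..r} t * t powr (\<theta> - 1)) \<partial>lborel) = ennreal (r powr \<theta> * (1 / \<theta>))"
      by (intro nn_integral_has_integral_lborel) auto
    moreover have "AE t in lborel. t \<noteq> (0::real)" "AE t in lborel. t \<noteq> r"
      by (simp_all add: AE_lborel_singleton)
    then have "(\<integral>\<^sup>+t\<in>{0<..}. (ennreal (t powr (\<theta> - 1)) * indicator {t. ennreal t < ennreal r} t) \<partial>lborel)
        = (\<integral>\<^sup>+t. ennreal (indicator {0..r} t * t powr (\<theta> - 1)) \<partial>lborel)"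
      by (intro nn_integral_cong_AE, eventually_elim) (auto simp: indicator_def ennreal_less_iff)
    ultimately show ?thesis by simp
  qed
  show ?thesis
  proof (cases b)
    case (real r)
    then show ?thesis using fin[of r] \<theta> by (simp add: ennpow_ennreal flip: ennreal_mult)
  next
    case top
    have "ennreal (real n * (1 / \<theta>)) \<le> (\<integral>\<^sup>+t\<in>{0<..}. (ennreal (t powr (\<theta> - 1)) * indicator {t. ennreal t < b} t) \<partial>lborel)" for n
    proof -
      have "ennreal (real n * (1 / \<theta>)) = ennreal ((real n powr (1 / \<theta>)) powr \<theta> * (1 / \<theta>))"
        using \<theta> by (simp add: powr_powr)
      also have "\<dots> \<le> (\<integral>\<^sup>+t\<in>{0<..}. (ennreal (t powr (\<theta> - 1)) * indicator {t. ennreal t < b} t) \<partial>lborel)"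
        unfolding fin[of "real n powr (1 / \<theta>)", OF powr_ge_zero, symmetric] using top
        by (intro nn_integral_mono mult_right_mono mult_left_mono) (auto simp: indicator_def)
      finally show ?thesis .
    qed
    then have "(SUP n. ennreal (real n) * ennreal (1 / \<theta>)) \<le> (\<integral>\<^sup>+t\<in>{0<..}. (ennreal (t powr (\<theta> - 1)) * indicator {t. ennreal t < b} t) \<partial>lborel)"
      using \<theta> by (intro SUP_least) (simp flip: ennreal_mult)
    moreover have "(SUP n. ennreal (real n) * ennreal (1 / \<theta>)) = top"
      using \<theta> by (simp add: SUP_mult_right_ennreal[symmetric] ennreal_SUP_of_nat_eq_top ennreal_of_nat_eq_real_of_nat[symmetric] ennreal_top_mult)
    ultimately show ?thesis using \<theta> top by (simp add: top_unique ennreal_top_mult)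
  qed
qed

lemma distribution_eq_tail:
  assumes "0 \<le> t"
  shows "distribution M (\<lambda>x. enn2ereal (f x)) t = tail M f t"
proof -
  have "ereal t < \<bar>enn2ereal y\<bar> \<longleftrightarrow> ennreal t < y" for y
    using assms by (simp add: less_ennreal.rep_eq)
  then show ?thesis by (simp add: distribution_def tail_def)
qed

text \<open>The distribution function is right continuous, since the sets \<open>{f > v + 1/n}\<close> increase to \<open>{f > v}\<close>. Hence
the infimum that defines the rearrangement is attained, and the rearrangement and the distribution
function are inverse to each other in the sense of strict inequalities.\<close>

lemma less_rearrangement_iff:
  assumes [measurable]: "f \<in> borel_measurable M" and v: "0 \<le> v"
  shows "ennreal v < rearrangement M (\<lambda>x. enn2ereal (f x)) t \<longleftrightarrow> ennreal t < tail M f v"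
proof
  assume "ennreal v < rearrangement M (\<lambda>x. enn2ereal (f x)) t"
  then show "ennreal t < tail M f v"
    unfolding rearrangement_def using v
    by (metis (mono_tags, lifting) INF_lower distribution_eq_tail mem_Collect_eq not_le)
next
  assume t: "ennreal t < tail M f v"
  define A where "A n = {x \<in> space M. ennreal (v + 1 / real (Suc n)) < f x}" for n
  have [measurable]: "A n \<in> sets M" for n unfolding A_def by measurable
  have "{x \<in> space M. ennreal v < f x} = (\<Union>n. A n)"
  proof (intro equalityI subsetI)
    fix x assume "x \<in> {x \<in> space M. ennreal v < f x}"
    then have x: "x \<in> space M" "ennreal v < f x" by auto
    obtain y where y: "ennreal v < y" "y < f x" using x(2) dense by blast
    then obtain r where r: "y = ennreal r" "0 \<le> r" by (cases y) auto
    with y v have "0 < r - v" by (simp add: ennreal_less_iff)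
    then obtain n where "1 / real (Suc n) < r - v"
      by (rule nat_approx_posE)
    then have "v + 1 / real (Suc n) < r" by linarith
    then have "ennreal (v + 1 / real (Suc n)) < ennreal r"
      using y(1) r(1) by (intro ennreal_lessI) (metis ennreal_less_zero_iff order.strict_trans1 zero_le)
    then have "ennreal (v + 1 / real (Suc n)) < f x"
      using r(1) y(2) by (blast intro: order.strict_trans)
    with x(1) show "x \<in> (\<Union>n. A n)" unfolding A_def by blast
  next
    fix x assume "x \<in> (\<Union>n. A n)"
    then obtain n where "x \<in> space M" "ennreal (v + 1 / real (Suc n)) < f x"
      unfolding A_def by blast
    moreover have "ennreal v \<le> ennreal (v + 1 / real (Suc n))" by (intro ennreal_leI) simp
    ultimately show "x \<in> {x \<in> space M. ennreal v < f x}" by (blast intro: order.strict_trans1)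
  qed
  moreover have "incseq A"
  proof (intro incseq_SucI subsetI)
    fix n x assume "x \<in> A n"
    moreover have "ennreal (v + 1 / real (Suc (Suc n))) \<le> ennreal (v + 1 / real (Suc n))"
      by (intro ennreal_leI add_left_mono divide_left_mono) auto
    ultimately show "x \<in> A (Suc n)"
      unfolding A_def by (blast intro: order.strict_trans1)
  qed
  ultimately have "tail M f v = (SUP n. tail M f (v + 1 / real (Suc n)))"
    unfolding tail_def A_def[symmetric] using SUP_emeasure_incseq[of A M] by (simp add: image_subset_iff)
  with t have "ennreal t < (SUP n. tail M f (v + 1 / real (Suc n)))" by (simp only:)
  then obtain n where n: "ennreal t < tail M f (v + 1 / real (Suc n))"
    unfolding less_SUP_iff by blast
  have "ennreal v < ennreal (v + 1 / real (Suc n))"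
    using v by (intro ennreal_lessI add_nonneg_pos) auto
  also have "\<dots> \<le> rearrangement M (\<lambda>x. enn2ereal (f x)) t"
    unfolding rearrangement_def
  proof (intro INF_greatest ennreal_leI)
    fix w assume w: "w \<in> {w. 0 \<le> w \<and> distribution M (\<lambda>x. enn2ereal (f x)) w \<le> ennreal t}"
    show "v + 1 / real (Suc n) \<le> w"
    proof (rule ccontr)
      assume "\<not> v + 1 / real (Suc n) \<le> w"
      then have "w \<le> v + 1 / real (Suc n)" by linarith
      then have "tail M f (v + 1 / real (Suc n)) \<le> tail M f w"
        by (rule antimonoD[OF tail_antimono[OF assms(1)]])
      also have "\<dots> \<le> ennreal t" using w distribution_eq_tail[of w M f] by auto
      finally show False using n by (meson leD)
    qed
  qed
  finally show "ennreal v < rearrangement M (\<lambda>x. enn2ereal (f x)) t" .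
qed

text \<open>Write the \<open>q\<close>-th power of the rearrangement at \<open>t\<close> as the length of the set of all \<open>\<tau> > 0\<close> below it. This
set consists of the \<open>\<tau>\<close> with \<open>\<mu>(f\<^sup>q > \<tau>) > t\<close>, so exchanging the order of integration leaves the
elementary integral of \<open>t\<^sup>\<theta>\<^sup>-\<^sup>1\<close> over \<open>0 < t < \<mu>(f\<^sup>q > \<tau>)\<close>, with \<open>\<theta> = q/p\<close>.\<close>

lemma lorentz_norm_eq_choquet:
  assumes [measurable]: "f \<in> borel_measurable M" and p: "0 < p" and q: "0 < q"
  shows "lorentz_norm M p (ennreal q) (\<lambda>x. enn2ereal (f x))
    = ennpow (ennreal (p / q) * choquet M (q / p) (\<lambda>x. ennpow (f x) q)) (1 / q)"
proof -
  define \<theta> where "\<theta> = q / p"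
  have \<theta>: "0 < \<theta>" using p q by (simp add: \<theta>_def)
  let ?R = "rearrangement M (\<lambda>x. enn2ereal (f x))"
  let ?n = "tail M (\<lambda>x. ennpow (f x) q)"
  have n: "?n \<tau> = tail M f (\<tau> powr (1 / q))" if "0 < \<tau>" for \<tau>
    using that q by (simp add: tail_def less_ennpow_swap ennpow_ennreal)
  have layer: "ennreal \<tau> < ennpow (?R t) q \<longleftrightarrow> ennreal t < ?n \<tau>" if "0 < \<tau>" for \<tau> t
    using less_rearrangement_iff[of f M "\<tau> powr (1 / q)" t] that q
    by (simp add: n less_ennpow_swap ennpow_ennreal)
  let ?g = "\<lambda>t \<tau>. ennreal (t powr (\<theta> - 1)) * indicator {t. ennreal t < ?n \<tau>} t * indicator {0<..} t * indicator {0<..} \<tau>"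
  have inner: "ennpow (ennreal (t powr (1 / p)) * ?R t) q * ennreal (1 / t) * indicator {0<..} t
     = (\<integral>\<^sup>+\<tau>. ?g t \<tau> \<partial>lborel)" for t :: real
  proof (cases "0 < t")
    case True
    have "ennpow (?R t) q = (\<integral>\<^sup>+\<tau>\<in>{0<..}. (ennreal (\<tau> powr (1 - 1)) * indicator {\<tau>. ennreal \<tau> < ennpow (?R t) q} \<tau>) \<partial>lborel)"
      by (subst nn_integral_powr_below) auto
    also have "\<dots> = (\<integral>\<^sup>+\<tau>. indicator {t. ennreal t < ?n \<tau>} t * indicator {0<..} \<tau> \<partial>lborel)"
      by (intro nn_integral_cong) (auto simp: indicator_def layer)
    finally have R: "ennpow (?R t) q = (\<integral>\<^sup>+\<tau>. indicator {t. ennreal t < ?n \<tau>} t * indicator {0<..} \<tau> \<partial>lborel)" .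
    have "(\<integral>\<^sup>+\<tau>. ?g t \<tau> \<partial>lborel)
       = (\<integral>\<^sup>+\<tau>. ennreal (t powr (\<theta> - 1)) * (indicator {t. ennreal t < ?n \<tau>} t * indicator {0<..} \<tau>) \<partial>lborel)"
      using True by (intro nn_integral_cong) (auto simp: indicator_def)
    also have "\<dots> = ennreal (t powr (\<theta> - 1)) * ennpow (?R t) q"
      unfolding R
    proof (rule nn_integral_cmult)
      have "(\<lambda>\<tau>. indicator {t. ennreal t < ?n \<tau>} t :: ennreal) = indicator {\<tau>. ennreal t < ?n \<tau>}"
        by (auto simp: indicator_def)
      then have [measurable]: "(\<lambda>\<tau>. indicator {t. ennreal t < ?n \<tau>} t :: ennreal) \<in> borel_measurable lborel"
        by simp
      show "(\<lambda>\<tau>. indicator {t. ennreal t < ?n \<tau>} t * indicator {0<..} \<tau> :: ennreal) \<in> borel_measurable lborel"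
        by simp
    qed
    finally have g: "(\<integral>\<^sup>+\<tau>. ?g t \<tau> \<partial>lborel) = ennreal (t powr (\<theta> - 1)) * ennpow (?R t) q" .
    have e: "ennreal (t powr (\<theta> - 1)) = ennpow (ennreal (t powr (1 / p))) q * ennreal (1 / t)"
      using True p q
      by (simp add: ennpow_ennreal powr_powr \<theta>_def powr_diff flip: ennreal_mult)
    show ?thesis unfolding g unfolding e using True q by (simp add: ennpow_mult ac_simps)
  qed simp
  have "(\<integral>\<^sup>+t\<in>{0<..}. (ennpow (ennreal (t powr (1 / p)) * ?R t) q * ennreal (1 / t)) \<partial>lborel)
      = (\<integral>\<^sup>+t. \<integral>\<^sup>+\<tau>. ?g t \<tau> \<partial>lborel \<partial>lborel)"
    using inner by (intro nn_integral_cong) simp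
  also have "\<dots> = (\<integral>\<^sup>+\<tau>. \<integral>\<^sup>+t. ?g t \<tau> \<partial>lborel \<partial>lborel)"
  proof (rule lborel_pair.Fubini'[symmetric])
    have "(\<lambda>z. indicator {t. ennreal t < ?n (snd z)} (fst z) :: ennreal)
        = indicator {z. ennreal (fst z) < ?n (snd z)}" by (auto simp: indicator_def)
    then have [measurable]: "(\<lambda>z. indicator {t. ennreal t < ?n (snd z)} (fst z) :: ennreal) \<in> borel_measurable (lborel \<Otimes>\<^sub>M lborel)"
      by simp
    show "(\<lambda>(t, \<tau>). ?g t \<tau>) \<in> borel_measurable (lborel \<Otimes>\<^sub>M lborel)"
      by (simp add: case_prod_unfold)
  qed
  also have "\<dots> = (\<integral>\<^sup>+\<tau>. ennreal (1 / \<theta>) * (ennpow (?n \<tau>) \<theta> * indicator {0<..} \<tau>) \<partial>lborel)"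
  proof (rule nn_integral_cong)
    fix \<tau> :: real
    have "(\<integral>\<^sup>+t. ?g t \<tau> \<partial>lborel) = (\<integral>\<^sup>+t\<in>{0<..}. (ennreal (t powr (\<theta> - 1)) * indicator {t. ennreal t < ?n \<tau>} t) \<partial>lborel) * indicator {0<..} \<tau>"
      by (intro nn_integral_multc) auto
    then show "(\<integral>\<^sup>+t. ?g t \<tau> \<partial>lborel) = ennreal (1 / \<theta>) * (ennpow (?n \<tau>) \<theta> * indicator {0<..} \<tau>)"
      unfolding nn_integral_powr_below[OF \<theta>] by (simp only: ac_simps)
  qed
  also have "\<dots> = ennreal (p / q) * choquet M (q / p) (\<lambda>x. ennpow (f x) q)"
    unfolding choquet_def by (subst nn_integral_cmult) (auto simp: \<theta>_def)
  finally show ?thesis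
    using q by (simp add: lorentz_norm_def)
qed

section \<open>Countable suprema\<close>

lemma tail_SUP_le:
  fixes F :: "nat \<Rightarrow> 'a \<Rightarrow> ennreal"
  assumes [measurable]: "\<And>i. F i \<in> borel_measurable M"
  shows "tail M (\<lambda>x. SUP i. F i x) \<tau> \<le> (\<Sum>i. tail M (F i) \<tau>)"
proof -
  have "{x \<in> space M. ennreal \<tau> < (SUP i. F i x)} = (\<Union>i. {x \<in> space M. ennreal \<tau> < F i x})"
    by (auto simp: less_SUP_iff)
  then show ?thesis
    unfolding tail_def by (simp only:) (intro emeasure_subadditive_countably, auto)
qed

text \<open>A superlevel set of a supremum is the union of the superlevel sets, and \<open>\<mu>(\<cdot>)\<^sup>\<theta>\<close> is countably subadditive
for \<open>\<theta> \<le> 1\<close>.\<close>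

lemma choquet_SUP_le:
  fixes F :: "nat \<Rightarrow> 'a \<Rightarrow> ennreal"
  assumes [measurable]: "\<And>i. F i \<in> borel_measurable M" and \<theta>: "0 < \<theta>" "\<theta> \<le> 1"
  shows "choquet M \<theta> (\<lambda>x. SUP i. F i x) \<le> (\<Sum>i. choquet M \<theta> (F i))"
proof -
  have "choquet M \<theta> (\<lambda>x. SUP i. F i x)
      \<le> (\<integral>\<^sup>+\<tau>. (\<Sum>i. ennpow (tail M (F i) \<tau>) \<theta> * indicator {0<..} \<tau>) \<partial>lborel)"
    unfolding choquet_def
  proof (intro nn_integral_mono)
    fix \<tau> :: real
    have "ennpow (tail M (\<lambda>x. SUP i. F i x) \<tau>) \<theta> \<le> ennpow (\<Sum>i. tail M (F i) \<tau>) \<theta>"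
      using \<theta> by (intro ennpow_mono tail_SUP_le) auto
    also have "\<dots> \<le> (\<Sum>i. ennpow (tail M (F i) \<tau>) \<theta>)"
      by (rule ennpow_suminf_le[OF \<theta>])
    finally show "ennpow (tail M (\<lambda>x. SUP i. F i x) \<tau>) \<theta> * indicator {0<..} \<tau>
        \<le> (\<Sum>i. ennpow (tail M (F i) \<tau>) \<theta> * indicator {0<..} \<tau>)"
      by (simp add: mult_right_mono)
  qed
  also have "\<dots> = (\<Sum>i. choquet M \<theta> (F i))"
    unfolding choquet_def by (intro nn_integral_suminf) auto
  finally show ?thesis .
qed

text \<open>For any reals \<open>a\<close> and \<open>b\<close> slightly above the two norms, write \<open>f + g\<close> as the convex combination of
\<open>f / l\<close> and \<open>g / (1 - l)\<close> with weight \<open>l = a / (a + b)\<close> and use the convexity of the power. Working with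
\<open>a\<close> and \<open>b\<close> rather than with the norms themselves keeps the weights positive.\<close>

lemma minkowski_nn_integral:
  fixes f g :: "'b \<Rightarrow> ennreal"
  assumes [measurable]: "f \<in> borel_measurable N" "g \<in> borel_measurable N" and \<alpha>: "1 \<le> \<alpha>"
  shows "ennpow (\<integral>\<^sup>+x. ennpow (f x + g x) \<alpha> \<partial>N) (1 / \<alpha>)
    \<le> ennpow (\<integral>\<^sup>+x. ennpow (f x) \<alpha> \<partial>N) (1 / \<alpha>) + ennpow (\<integral>\<^sup>+x. ennpow (g x) \<alpha> \<partial>N) (1 / \<alpha>)"
    (is "_ \<le> ?A + ?B")
proof (rule ennreal_le_epsilon)
  fix e :: real assume fin: "?A + ?B < top" and e: "0 < e"
  obtain a0 b0 where ab0: "?A = ennreal a0" "0 \<le> a0" "?B = ennreal b0" "0 \<le> b0"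
    using fin by (cases ?A; cases ?B) auto
  define a where "a = a0 + e / 2"
  define b where "b = b0 + e / 2"
  have ab: "0 < a" "0 < b" using ab0 e by (auto simp: a_def b_def)
  have "?A \<le> ennreal a" "?B \<le> ennreal b" using ab0 e by (auto simp: a_def b_def intro!: ennreal_leI)
  then have le: "(\<integral>\<^sup>+x. ennpow (f x) \<alpha> \<partial>N) \<le> ennreal (a powr \<alpha>)" "(\<integral>\<^sup>+x. ennpow (g x) \<alpha> \<partial>N) \<le> ennreal (b powr \<alpha>)"
    using \<alpha> ab by (auto simp: ennpow_le_swap ennpow_ennreal)
  define l where "l = a / (a + b)"
  have l: "0 < l" "l < 1" using ab by (auto simp: l_def)
  have l1: "1 - l = b / (a + b)" using ab by (simp add: l_def field_simps)
  have pt: "ennpow (f x + g x) \<alpha> \<le> ennreal (l powr (1 - \<alpha>)) * ennpow (f x) \<alpha> + ennreal ((1 - l) powr (1 - \<alpha>)) * ennpow (g x) \<alpha>" for x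
  proof -
    have inv: "ennreal t * (ennreal (1 / t) * y) = y" if "0 < t" for t y
      using that by (simp add: mult.assoc[symmetric] flip: ennreal_mult)
    have pw: "ennreal t * ennpow (ennreal (1 / t) * y) \<alpha> = ennreal (t powr (1 - \<alpha>)) * ennpow y \<alpha>" if "0 < t" for t y
      using that \<alpha> by (simp add: ennpow_mult ennpow_ennreal mult.assoc[symmetric] powr_divide powr_diff flip: ennreal_mult)
    show ?thesis
      using ennpow_convex_comb[of \<alpha> l "ennreal (1 / l) * f x" "ennreal (1 / (1 - l)) * g x"] l \<alpha>
      by (simp only: inv pw less_imp_le diff_gt_0_iff_gt)
  qed
  have "(\<integral>\<^sup>+x. ennpow (f x + g x) \<alpha> \<partial>N)
     \<le> (\<integral>\<^sup>+x. ennreal (l powr (1 - \<alpha>)) * ennpow (f x) \<alpha> + ennreal ((1 - l) powr (1 - \<alpha>)) * ennpow (g x) \<alpha> \<partial>N)"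
    using pt by (intro nn_integral_mono)
  also have "\<dots> = ennreal (l powr (1 - \<alpha>)) * (\<integral>\<^sup>+x. ennpow (f x) \<alpha> \<partial>N) + ennreal ((1 - l) powr (1 - \<alpha>)) * (\<integral>\<^sup>+x. ennpow (g x) \<alpha> \<partial>N)"
    by (simp add: nn_integral_add nn_integral_cmult)
  also have "\<dots> \<le> ennreal (l powr (1 - \<alpha>)) * ennreal (a powr \<alpha>) + ennreal ((1 - l) powr (1 - \<alpha>)) * ennreal (b powr \<alpha>)"
    using le by (intro add_mono mult_left_mono) auto
  also have "\<dots> = ennreal (l powr (1 - \<alpha>) * a powr \<alpha> + (1 - l) powr (1 - \<alpha>) * b powr \<alpha>)"
    by (simp add: ennreal_mult)
  also have "l powr (1 - \<alpha>) * a powr \<alpha> + (1 - l) powr (1 - \<alpha>) * b powr \<alpha> = (a + b) powr \<alpha>"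
  proof -
    have w: "(y / (a + b)) powr (1 - \<alpha>) * y powr \<alpha> = (a + b) powr \<alpha> * (y / (a + b))" if "0 < y" for y
      using that ab by (simp add: powr_divide powr_diff)
    have "a / (a + b) + b / (a + b) = 1" using ab by (simp flip: add_divide_distrib)
    then show ?thesis unfolding l1 unfolding l_def w[OF ab(1)] w[OF ab(2)]
      by (simp only: distrib_left[symmetric] mult_1_right)
  qed
  also have "ennreal ((a + b) powr \<alpha>) = ennpow (ennreal (a + b)) \<alpha>"
    using ab by (intro ennpow_ennreal[symmetric]) simp
  finally have "ennpow (\<integral>\<^sup>+x. ennpow (f x + g x) \<alpha> \<partial>N) (1 / \<alpha>) \<le> ennreal (a + b)"
    using \<alpha> ennpow_le_swap[of "1/\<alpha>" _ "ennreal (a + b)"] by (simp del: ennreal_plus)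
  also have "a + b = a0 + b0 + e" by (simp add: a_def b_def)
  also have "ennreal (a0 + b0 + e) = ?A + ?B + ennreal e"
    using ab0 e by simp
  finally show "ennpow (\<integral>\<^sup>+x. ennpow (f x + g x) \<alpha> \<partial>N) (1 / \<alpha>) \<le> ?A + ?B + ennreal e" .
qed

lemma minkowski_nn_integral_suminf:
  fixes f :: "nat \<Rightarrow> 'b \<Rightarrow> ennreal"
  assumes [measurable]: "\<And>i. f i \<in> borel_measurable N" and \<alpha>: "1 \<le> \<alpha>"
  shows "ennpow (\<integral>\<^sup>+x. ennpow (\<Sum>i. f i x) \<alpha> \<partial>N) (1 / \<alpha>)
    \<le> (\<Sum>i. ennpow (\<integral>\<^sup>+x. ennpow (f i x) \<alpha> \<partial>N) (1 / \<alpha>))"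
proof -
  have fin: "ennpow (\<integral>\<^sup>+x. ennpow (\<Sum>i<n. f i x) \<alpha> \<partial>N) (1 / \<alpha>)
      \<le> (\<Sum>i<n. ennpow (\<integral>\<^sup>+x. ennpow (f i x) \<alpha> \<partial>N) (1 / \<alpha>))" for n
  proof (induction n)
    case (Suc n)
    show ?case
      using minkowski_nn_integral[of "\<lambda>x. \<Sum>i<n. f i x" N "f n" \<alpha>] \<alpha> Suc
      by (simp add: order.trans[OF _ add_right_mono])
  qed simp
  have "(\<integral>\<^sup>+x. ennpow (\<Sum>i. f i x) \<alpha> \<partial>N) = (\<integral>\<^sup>+x. (SUP n. ennpow (\<Sum>i<n. f i x) \<alpha>) \<partial>N)"
    using \<alpha> by (simp add: suminf_eq_SUP ennpow_SUP)
  also have "\<dots> = (SUP n. \<integral>\<^sup>+x. ennpow (\<Sum>i<n. f i x) \<alpha> \<partial>N)"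
    using \<alpha> by (intro nn_integral_monotone_convergence_SUP incseq_SucI le_funI ennpow_mono) auto
  finally have "ennpow (\<integral>\<^sup>+x. ennpow (\<Sum>i. f i x) \<alpha> \<partial>N) (1 / \<alpha>)
     = (SUP n. ennpow (\<integral>\<^sup>+x. ennpow (\<Sum>i<n. f i x) \<alpha> \<partial>N) (1 / \<alpha>))"
    using \<alpha> by (simp add: ennpow_SUP)
  also have "\<dots> \<le> (SUP n. \<Sum>i<n. ennpow (\<integral>\<^sup>+x. ennpow (f i x) \<alpha> \<partial>N) (1 / \<alpha>))"
    using fin by (intro SUP_mono) auto
  finally show ?thesis by (simp add: suminf_eq_SUP)
qed

text \<open>For \<open>\<theta> \<ge> 1\<close> the power \<open>\<mu>(\<cdot>)\<^sup>\<theta>\<close> is no longer subadditive, but the \<open>\<theta>\<close>-th root of the Choquet integral is the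
\<open>L\<^sup>\<theta>\<close> norm of the distribution function, so Minkowski's inequality takes over.\<close>

lemma choquet_SUP_le_convex:
  fixes F :: "nat \<Rightarrow> 'a \<Rightarrow> ennreal"
  assumes [measurable]: "\<And>i. F i \<in> borel_measurable M" and \<theta>: "1 \<le> \<theta>"
  shows "ennpow (choquet M \<theta> (\<lambda>x. SUP i. F i x)) (1 / \<theta>) \<le> (\<Sum>i. ennpow (choquet M \<theta> (F i)) (1 / \<theta>))"
proof -
  have alt: "choquet M \<theta> F = (\<integral>\<^sup>+\<tau>. ennpow (tail M F \<tau> * indicator {0<..} \<tau>) \<theta> \<partial>lborel)" for F
    unfolding choquet_def by (intro nn_integral_cong) (auto simp: indicator_def)
  have "ennpow (choquet M \<theta> (\<lambda>x. SUP i. F i x)) (1 / \<theta>)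
     \<le> ennpow (\<integral>\<^sup>+\<tau>. ennpow (\<Sum>i. tail M (F i) \<tau> * indicator {0<..} \<tau>) \<theta> \<partial>lborel) (1 / \<theta>)"
    unfolding alt using \<theta>
    by (intro ennpow_mono nn_integral_mono) (auto simp: ennreal_suminf_multc intro!: mult_right_mono tail_SUP_le)
  also have "\<dots> \<le> (\<Sum>i. ennpow (choquet M \<theta> (F i)) (1 / \<theta>))"
    unfolding alt using \<theta> by (intro minkowski_nn_integral_suminf) auto
  finally show ?thesis .
qed

text \<open>This is \<open>min p q\<close>, the exponent that combines the two norms in the Newtonian norm and for which the
Lorentz quasinorm satisfies \<open>\<parallel>sup f\<^sub>i\<parallel>\<^sup>r \<le> \<Sum> \<parallel>f\<^sub>i\<parallel>\<^sup>r\<close>.\<close>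

definition lorentz_exponent :: "real \<Rightarrow> ennreal \<Rightarrow> real" where
  "lorentz_exponent p q = (if q \<le> ennreal p then enn2real q else p)"

abbreviation lnorm :: "'a measure \<Rightarrow> real \<Rightarrow> ennreal \<Rightarrow> ('a \<Rightarrow> ennreal) \<Rightarrow> ennreal" where
  "lnorm M p q f \<equiv> lorentz_norm M p q (\<lambda>x. enn2ereal (f x))"

lemma lnorm_infinity:
  assumes "0 < p"
  shows "ennpow (lnorm M p \<infinity> f) p = (SUP t\<in>{0<..}. ennreal (t powr p) * tail M f t)"
proof -
  have "ennpow (lnorm M p \<infinity> f) p = (SUP t\<in>{0<..}. ennpow (ennreal t * ennpow (distribution M (\<lambda>x. enn2ereal (f x)) t) (1 / p)) p)"
    using assms by (simp add: lorentz_norm_def ennpow_SUP)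
  also have "\<dots> = (SUP t\<in>{0<..}. ennreal (t powr p) * tail M f t)"
    using assms by (intro SUP_cong) (auto simp: ennpow_mult ennpow_ennreal distribution_eq_tail)
  finally show ?thesis .
qed

text \<open>For \<open>q \<le> p\<close> the \<open>q\<close>-th power of the quasinorm is a multiple of a Choquet integral with \<open>\<theta> = q/p \<le> 1\<close>. For
\<open>p < q < \<infinity>\<close> its \<open>p\<close>-th power is a multiple of the \<open>\<theta>\<close>-th root of such an integral, with \<open>\<theta> > 1\<close>. For \<open>q = \<infinity>\<close> it is
\<open>sup t\<^sup>p \<mu>(f > t)\<close>, and subadditivity of \<open>\<mu>\<close> suffices.\<close>

lemma lnorm_SUP_le:
  fixes f :: "nat \<Rightarrow> 'a \<Rightarrow> ennreal"
  assumes [measurable]: "\<And>i. f i \<in> borel_measurable M" and p: "1 < p" and q: "1 \<le> q"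
  shows "ennpow (lnorm M p q (\<lambda>x. SUP i. f i x)) (lorentz_exponent p q)
    \<le> (\<Sum>i. ennpow (lnorm M p q (f i)) (lorentz_exponent p q))"
proof (cases "q = \<infinity>")
  case True
  then have r: "lorentz_exponent p q = p"
    by (auto simp: lorentz_exponent_def top_unique)
  have p0: "0 < p" using p by simp
  have "ennreal (t powr p) * tail M (\<lambda>x. SUP i. f i x) t \<le> (\<Sum>i. ennpow (lnorm M p q (f i)) p)" if "0 < t" for t
  proof -
    have p0: "0 < p" using p by simp
  have "ennreal (t powr p) * tail M (\<lambda>x. SUP i. f i x) t \<le> ennreal (t powr p) * (\<Sum>i. tail M (f i) t)"
      by (intro mult_left_mono tail_SUP_le) auto
    also have "\<dots> = (\<Sum>i. ennreal (t powr p) * tail M (f i) t)" by simp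
    also have "\<dots> \<le> (\<Sum>i. ennpow (lnorm M p q (f i)) p)"
      unfolding True lnorm_infinity[OF p0] using that
      by (intro suminf_le summableI SUP_upper2[where i = t]) auto
    finally show ?thesis .
  qed
  then show ?thesis unfolding r unfolding True lnorm_infinity[OF p0, of M "\<lambda>x. SUP i. f i x"]
    by (intro SUP_least) auto
next
  case False
  define s where "s = enn2real q"
  have qs: "q = ennreal s" using False by (simp add: s_def less_top)
  have s: "1 \<le> s" using q by (simp add: qs)
  have L: "ennpow (lnorm M p q g) r = ennpow (ennreal (p / s) * choquet M (s / p) (\<lambda>x. ennpow (g x) s)) (r / s)"
    if [measurable]: "g \<in> borel_measurable M" for g r
    using p s by (simp add: qs lorentz_norm_eq_choquet ennpow_ennpow)
  have S: "ennpow (SUP i. f i x) s = (SUP i. ennpow (f i x) s)" for x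
    using s by (simp add: ennpow_SUP)
  show ?thesis
  proof (cases "s \<le> p")
    case True
    then have r: "lorentz_exponent p q = s" using p s by (simp add: lorentz_exponent_def qs)
    have "choquet M (s / p) (\<lambda>x. SUP i. ennpow (f i x) s) \<le> (\<Sum>i. choquet M (s / p) (\<lambda>x. ennpow (f i x) s))"
      using True p s by (intro choquet_SUP_le) auto
    then have "ennreal (p / s) * choquet M (s / p) (\<lambda>x. SUP i. ennpow (f i x) s)
       \<le> ennreal (p / s) * (\<Sum>i. choquet M (s / p) (\<lambda>x. ennpow (f i x) s))"
      by (rule mult_left_mono) simp
    then show ?thesis using s by (simp add: r L S)
  next
    case False
    then have r: "lorentz_exponent p q = p" using p s by (simp add: lorentz_exponent_def qs)
    have e: "1 / (s / p) = p / s" by simp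
    have "ennpow (choquet M (s / p) (\<lambda>x. SUP i. ennpow (f i x) s)) (p / s)
        \<le> (\<Sum>i. ennpow (choquet M (s / p) (\<lambda>x. ennpow (f i x) s)) (p / s))"
      using False p s choquet_SUP_le_convex[of "\<lambda>i x. ennpow (f i x) s" M "s / p"] by simp
    then have "ennpow (ennreal (p / s)) (p / s) * ennpow (choquet M (s / p) (\<lambda>x. SUP i. ennpow (f i x) s)) (p / s)
        \<le> ennpow (ennreal (p / s)) (p / s) * (\<Sum>i. ennpow (choquet M (s / p) (\<lambda>x. ennpow (f i x) s)) (p / s))"
      by (rule mult_left_mono) simp
    then show ?thesis using s p by (simp add: r L S ennpow_mult)
  qed
qed

section \<open>Subadditivity of the Choquet integral\<close>

text \<open>At each level \<open>\<tau>\<close> let \<open>P = {F > \<tau>}\<close> and \<open>Q = A \<inter> {F + c > \<tau>}\<close>. The superlevel set of \<open>F + c 1\<^sub>A\<close> is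
\<open>P \<union> Q\<close>, while \<open>P \<inter> Q = A \<inter> {F > \<tau>}\<close>, so submodularity applies. Integrated over \<open>\<tau>\<close>, the contributions of
\<open>Q\<close> and of \<open>P \<inter> Q\<close> differ by a shift of length \<open>c\<close>, that is, by \<open>c \<mu>(A)\<^sup>\<theta>\<close>.\<close>

lemma choquet_add_indicator:
  assumes [measurable]: "F \<in> borel_measurable M" "A \<in> sets M"
    and \<theta>: "0 < \<theta>" "\<theta> \<le> 1" and c: "0 < c"
  shows "choquet M \<theta> (\<lambda>x. F x + ennreal c * indicator A x)
     \<le> choquet M \<theta> F + ennreal c * ennpow (emeasure M A) \<theta>"
proof (cases "choquet M \<theta> F = top")
  case True then show ?thesis by simp
next
  case False
  define J where "J \<tau> = tail M (\<lambda>x. F x * indicator A x) \<tau>" for \<tau>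
  define K where "K \<tau> = emeasure M {x \<in> A. ennreal \<tau> < F x + ennreal c}" for \<tau>
  have [measurable]: "J \<in> borel_measurable borel" unfolding J_def by measurable
  have AM: "A \<subseteq> space M" using sets.sets_into_space assms(2) by blast
  have Km: "K \<tau> = tail M (\<lambda>x. (F x + ennreal c) * indicator A x) \<tau>" for \<tau>
    unfolding K_def tail_def using AM by (intro arg_cong[where f = "emeasure M"]) (auto simp: indicator_def)
  have [measurable]: "K \<in> borel_measurable borel" unfolding Km by measurable
  have J_eq: "J \<tau> = emeasure M {x \<in> A. ennreal \<tau> < F x}" for \<tau>
    unfolding J_def tail_def using AM by (intro arg_cong[where f = "emeasure M"]) (auto simp: indicator_def)
  have sub: "ennpow (tail M (\<lambda>x. F x + ennreal c * indicator A x) \<tau>) \<theta> + ennpow (J \<tau>) \<theta>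
      \<le> ennpow (tail M F \<tau>) \<theta> + ennpow (K \<tau>) \<theta>" for \<tau>
  proof -
    define P where "P = {x \<in> space M. ennreal \<tau> < F x}"
    define Q where "Q = {x \<in> A. ennreal \<tau> < F x + ennreal c}"
    have PQ [measurable]: "P \<in> sets M" "Q \<in> sets M" unfolding P_def Q_def by measurable
    have inter: "{x \<in> A. ennreal \<tau> < F x} = P \<inter> Q"
      unfolding P_def Q_def using AM by (auto intro: order.strict_trans2)
    have union: "{x \<in> space M. ennreal \<tau> < F x + ennreal c * indicator A x} = P \<union> Q"
      unfolding P_def Q_def using AM by (auto simp: indicator_def split: if_splits intro: order.strict_trans2)
    have "emeasure M (P \<union> Q) = emeasure M (P \<inter> Q) + emeasure M (P - Q) + emeasure M (Q - P)"
      using PQ by (simp add: plus_emeasure Int_Diff Un_Diff_Int disjoint_iff)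
        (intro arg_cong[where f = "emeasure M"], auto)
    moreover have "emeasure M P = emeasure M (P \<inter> Q) + emeasure M (P - Q)"
      using PQ by (subst plus_emeasure) (auto intro!: arg_cong[where f = "emeasure M"])
    moreover have "emeasure M Q = emeasure M (P \<inter> Q) + emeasure M (Q - P)"
      using PQ by (subst plus_emeasure) (auto intro!: arg_cong[where f = "emeasure M"])
    ultimately show ?thesis
      using ennpow_submodular[OF \<theta>, of "emeasure M (P \<inter> Q)" "emeasure M (P - Q)" "emeasure M (Q - P)"]
      unfolding J_eq K_def tail_def inter union by (simp add: P_def[symmetric] Q_def[symmetric])
  qed
  have intJ: "(\<integral>\<^sup>+\<tau>\<in>{0<..}. ennpow (J \<tau>) \<theta> \<partial>lborel) \<le> choquet M \<theta> F"
    unfolding J_def choquet_def[symmetric]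
    using \<theta> by (intro choquet_mono) (auto simp: indicator_def)
  have intK: "(\<integral>\<^sup>+\<tau>\<in>{0<..}. ennpow (K \<tau>) \<theta> \<partial>lborel)
     \<le> ennreal c * ennpow (emeasure M A) \<theta> + (\<integral>\<^sup>+\<tau>\<in>{0<..}. ennpow (J \<tau>) \<theta> \<partial>lborel)"
  proof -
    have "AE \<tau> in lborel. ennpow (K \<tau>) \<theta> * indicator {0<..} \<tau>
       \<le> ennpow (emeasure M A) \<theta> * indicator {0<..<c} \<tau> + ennpow (J (- c + 1 * \<tau>)) \<theta> * indicator {0<..} (- c + 1 * \<tau>)"
      \<comment> \<open>The single level c lies in neither of the two intervals below.\<close>
      using AE_lborel_singleton[of c]
    proof eventually_elim
      fix \<tau> :: real assume "\<tau> \<noteq> c"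
      have "K \<tau> \<le> emeasure M A" unfolding K_def by (intro emeasure_mono) auto
      moreover have "K \<tau> \<le> J (\<tau> - c)" if "c < \<tau>"
      proof -
        have eq: "ennreal \<tau> = ennreal (\<tau> - c) + ennreal c"
          using that c by (simp flip: ennreal_plus)
        have "y \<le> ennreal (\<tau> - c) \<Longrightarrow> y + ennreal c \<le> ennreal \<tau>" for y
          unfolding eq by (rule add_right_mono)
        then have "{x \<in> A. ennreal \<tau> < F x + ennreal c} \<subseteq> {x \<in> A. ennreal (\<tau> - c) < F x}"
          by (auto simp: not_le[symmetric])
        then show ?thesis unfolding K_def J_eq by (intro emeasure_mono) auto
      qed
      ultimately show "ennpow (K \<tau>) \<theta> * indicator {0<..} \<tau>
         \<le> ennpow (emeasure M A) \<theta> * indicator {0<..<c} \<tau> + ennpow (J (- c + 1 * \<tau>)) \<theta> * indicator {0<..} (- c + 1 * \<tau>)"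
        using \<open>\<tau> \<noteq> c\<close> \<theta> c by (auto simp: indicator_def ennpow_mono)
    qed
    then have "(\<integral>\<^sup>+\<tau>\<in>{0<..}. ennpow (K \<tau>) \<theta> \<partial>lborel)
      \<le> (\<integral>\<^sup>+\<tau>. ennpow (emeasure M A) \<theta> * indicator {0<..<c} \<tau> + ennpow (J (- c + 1 * \<tau>)) \<theta> * indicator {0<..} (- c + 1 * \<tau>) \<partial>lborel)"
      by (rule nn_integral_mono_AE)
    also have "\<dots> = ennpow (emeasure M A) \<theta> * ennreal c
        + (\<integral>\<^sup>+\<tau>. ennpow (J (- c + 1 * \<tau>)) \<theta> * indicator {0<..} (- c + 1 * \<tau>) \<partial>lborel)"
      using c by (subst nn_integral_add) (auto simp: nn_integral_cmult)
    also have "(\<integral>\<^sup>+\<tau>. ennpow (J (- c + 1 * \<tau>)) \<theta> * indicator {0<..} (- c + 1 * \<tau>) \<partial>lborel)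
       = (\<integral>\<^sup>+\<tau>\<in>{0<..}. ennpow (J \<tau>) \<theta> \<partial>lborel)"
      using nn_integral_real_affine[of "\<lambda>\<tau>. ennpow (J \<tau>) \<theta> * indicator {0<..} \<tau>" 1 "- c"] by simp
    finally show ?thesis by (simp add: mult.commute)
  qed
  have "choquet M \<theta> (\<lambda>x. F x + ennreal c * indicator A x) + (\<integral>\<^sup>+\<tau>\<in>{0<..}. ennpow (J \<tau>) \<theta> \<partial>lborel)
     = (\<integral>\<^sup>+\<tau>\<in>{0<..}. (ennpow (tail M (\<lambda>x. F x + ennreal c * indicator A x) \<tau>) \<theta> + ennpow (J \<tau>) \<theta>) \<partial>lborel)"
    unfolding choquet_def by (simp add: nn_integral_add distrib_right)
  also have "\<dots> \<le> (\<integral>\<^sup>+\<tau>\<in>{0<..}. (ennpow (tail M F \<tau>) \<theta> + ennpow (K \<tau>) \<theta>) \<partial>lborel)"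
    using sub by (intro nn_integral_mono mult_right_mono) auto
  also have "\<dots> = choquet M \<theta> F + (\<integral>\<^sup>+\<tau>\<in>{0<..}. ennpow (K \<tau>) \<theta> \<partial>lborel)"
    unfolding choquet_def by (simp add: nn_integral_add distrib_right)
  also have "\<dots> \<le> choquet M \<theta> F + (ennreal c * ennpow (emeasure M A) \<theta> + (\<integral>\<^sup>+\<tau>\<in>{0<..}. ennpow (J \<tau>) \<theta> \<partial>lborel))"
    using intK by (rule add_left_mono)
  finally have "(\<integral>\<^sup>+\<tau>\<in>{0<..}. ennpow (J \<tau>) \<theta> \<partial>lborel) + choquet M \<theta> (\<lambda>x. F x + ennreal c * indicator A x)
     \<le> (\<integral>\<^sup>+\<tau>\<in>{0<..}. ennpow (J \<tau>) \<theta> \<partial>lborel) + (choquet M \<theta> F + ennreal c * ennpow (emeasure M A) \<theta>)"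
    by (simp only: ac_simps)
  moreover have "(\<integral>\<^sup>+\<tau>\<in>{0<..}. ennpow (J \<tau>) \<theta> \<partial>lborel) \<noteq> top"
    using intJ False by (auto simp: top_unique)
  ultimately show ?thesis by (simp only: ennreal_add_left_cancel_le infinity_ennreal_def simp_thms)
qed

text \<open>For \<open>y > 0\<close> this is the largest multiple \<open>k c\<close> with \<open>k \<le> N\<close> that is strictly smaller than \<open>y\<close>, written as a
sum of indicators. The sets on which successive
layers of a function are present decrease, which is why its Choquet integral is the sum of those of
its layers.\<close>

definition layers :: "real \<Rightarrow> nat \<Rightarrow> ennreal \<Rightarrow> ennreal" where
  "layers c N y = (\<Sum>k<N. ennreal c * indicator {ennreal (real (Suc k) * c)<..} y)"

lemma borel_measurable_layers [measurable]: "layers c N \<in> borel_measurable borel"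
  unfolding layers_def by measurable

lemma layers_mono: "N \<le> N' \<Longrightarrow> layers c N y \<le> layers c N' y"
  unfolding layers_def by (intro sum_mono2) auto

lemma layers_halve: "0 < c \<Longrightarrow> layers c N y \<le> layers (c / 2) (2 * N) y"
proof (induction N)
  case (Suc N)
  have e: "real (Suc (2 * N)) * (c / 2) \<le> real (Suc N) * c" "real (Suc (Suc (2 * N))) * (c / 2) = real (Suc N) * c"
    using Suc.prems by (auto simp: field_simps)
  have "ennreal (real (Suc (2 * N)) * (c / 2)) \<le> ennreal (real (Suc N) * c)"
    using e(1) by (rule ennreal_leI)
  moreover have "ennreal c = ennreal (c / 2) + ennreal (c / 2)"
    using Suc.prems by (simp flip: ennreal_plus)
  ultimately have "ennreal c * indicator {ennreal (real (Suc N) * c)<..} y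
     \<le> ennreal (c / 2) * indicator {ennreal (real (Suc (2 * N)) * (c / 2))<..} y
      + ennreal (c / 2) * indicator {ennreal (real (Suc (Suc (2 * N))) * (c / 2))<..} y"
    unfolding e(2) by (auto simp: indicator_def)
  moreover have "layers c N y \<le> layers (c / 2) (2 * N) y" using Suc by simp
  ultimately show ?case
    unfolding layers_def by (simp add: add_mono add.assoc del: of_nat_Suc)
qed (simp add: layers_def)

lemma layers_full:
  assumes "0 < c" "ennreal (real N * c) < y"
  shows "layers c N y = ennreal (real N * c)"
proof -
  have "layers c N y = (\<Sum>k<N. ennreal c)"
    unfolding layers_def
  proof (intro sum.cong refl)
    fix k assume "k \<in> {..<N}"
    then have "ennreal (real (Suc k) * c) \<le> ennreal (real N * c)"
      using assms(1) by (intro ennreal_leI mult_right_mono) auto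
    then show "ennreal c * indicator {ennreal (real (Suc k) * c)<..} y = ennreal c"
      using assms(2) by (simp add: order.strict_trans1)
  qed
  also have "\<dots> = ennreal (real N * c)"
    using assms(1) by (simp add: ennreal_mult ennreal_of_nat_eq_real_of_nat)
  finally show ?thesis .
qed

lemma layers_le: "0 < c \<Longrightarrow> layers c N y \<le> y"
proof (induction N)
  case (Suc N)
  show ?case
  proof (cases "ennreal (real (Suc N) * c) < y")
    case True
    then show ?thesis using layers_full[of c "Suc N" y] Suc.prems by simp
  next
    case False
    then show ?thesis using Suc by (simp add: layers_def)
  qed
qed (simp add: layers_def)

lemma le_layers: "0 < c \<Longrightarrow> min y (ennreal (real N * c)) \<le> layers c N y + ennreal c"
proof (induction N)
  case (Suc N)
  have s: "ennreal (real (Suc N) * c) = ennreal (real N * c) + ennreal c"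
    using Suc.prems by (simp add: distrib_right flip: ennreal_plus)
  have mono: "layers c N y \<le> layers c (Suc N) y" by (intro layers_mono) simp
  show ?case
  proof (cases "ennreal (real N * c) < y")
    case True
    then have "layers c N y = ennreal (real N * c)" using Suc.prems by (rule layers_full[rotated])
    with mono have "ennreal (real N * c) + ennreal c \<le> layers c (Suc N) y + ennreal c"
      by (intro add_right_mono) simp
    then show ?thesis unfolding s by (rule min.coboundedI2)
  next
    case False
    then have "y \<le> layers c N y + ennreal c" using Suc by (simp add: min_def split: if_splits)
    also have "\<dots> \<le> layers c (Suc N) y + ennreal c" using mono by (rule add_right_mono)
    finally show ?thesis by (rule min.coboundedI1)
  qed
qed simp

definition dyadic :: "nat \<Rightarrow> ennreal \<Rightarrow> ennreal" where
  "dyadic n = layers (1 / 2 ^ n) (n * 2 ^ n)"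

lemma incseq_dyadic: "incseq (\<lambda>n. dyadic n y)"
proof (rule incseq_SucI)
  fix n
  have "layers (1 / 2 ^ n) (n * 2 ^ n) y \<le> layers (1 / 2 ^ n / 2) (2 * (n * 2 ^ n)) y"
    by (intro layers_halve) simp
  also have "\<dots> \<le> layers (1 / 2 ^ n / 2) (Suc n * 2 ^ Suc n) y"
    by (intro layers_mono) simp
  finally show "dyadic n y \<le> dyadic (Suc n) y"
    by (simp add: dyadic_def field_simps)
qed

text \<open>Every \<open>y\<close>, cut off at a level \<open>m\<close>, exceeds its dyadic approximation of order \<open>n \<ge> m\<close> by at most
\<open>2\<^sup>-\<^sup>n\<close>. The cut-off lets one argument cover \<open>y = \<infinity>\<close>.\<close>

lemma SUP_dyadic: "(SUP n. dyadic n y) = y"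
proof (rule antisym)
  show "(SUP n. dyadic n y) \<le> y"
    by (intro SUP_least) (simp add: dyadic_def layers_le)
  have min: "min y (of_nat m) \<le> (SUP n. dyadic n y)" for m
  proof (rule ennreal_le_epsilon)
    fix e :: real assume "0 < e"
    then obtain k where k: "(1 / 2) ^ k < e" using real_arch_pow_inv[of e "1/2"] by auto
    define n where "n = max m k"
    have "(1 / 2 :: real) ^ n \<le> (1 / 2) ^ k" unfolding n_def by (intro power_decreasing) auto
    then have n: "1 / 2 ^ n \<le> e" "m \<le> n" using k by (auto simp: n_def power_divide)
    have "min y (of_nat m) \<le> min y (ennreal (real (n * 2 ^ n) * (1 / 2 ^ n)))"
      using n(2) by (intro min.mono) (auto simp: ennreal_of_nat_eq_real_of_nat)
    also have "\<dots> \<le> dyadic n y + ennreal (1 / 2 ^ n)"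
      unfolding dyadic_def by (intro le_layers) simp
    also have "\<dots> \<le> (SUP n. dyadic n y) + ennreal e"
      using n(1) by (intro add_mono SUP_upper ennreal_leI) auto
    finally show "min y (of_nat m) \<le> (SUP n. dyadic n y) + ennreal e" .
  qed
  have "y = (SUP m. min y (of_nat m))"
    by (subst inf_min[symmetric], subst inf_SUP[symmetric])
      (simp add: ennreal_SUP_of_nat_eq_top)
  also have "\<dots> \<le> (SUP n. dyadic n y)" using min by (intro SUP_least)
  finally show "y \<le> (SUP n. dyadic n y)" .
qed

text \<open>The layers of \<open>G\<close> are added one at a time. The cost \<open>c \<mu>(G > k c)\<^sup>\<theta>\<close> of the \<open>k\<close>-th layer is at most the
part of the Choquet integral of \<open>G\<close> over the levels from \<open>(k - 1) c\<close> to \<open>k c\<close>, by monotonicity of the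
distribution function.\<close>

lemma choquet_add_layers:
  assumes [measurable]: "F \<in> borel_measurable M" "G \<in> borel_measurable M"
    and \<theta>: "0 < \<theta>" "\<theta> \<le> 1" and c: "0 < c"
  shows "choquet M \<theta> (\<lambda>x. F x + layers c N (G x))
     \<le> choquet M \<theta> F + (\<integral>\<^sup>+\<tau>\<in>{0<..real N * c}. ennpow (tail M G \<tau>) \<theta> \<partial>lborel)"
proof (induction N)
  case 0 then show ?case by (simp add: layers_def)
next
  case (Suc N)
  let ?t = "real (Suc N) * c"
  let ?A = "{x \<in> space M. ennreal ?t < G x}"
  have "choquet M \<theta> (\<lambda>x. F x + layers c (Suc N) (G x))
     = choquet M \<theta> (\<lambda>x. (F x + layers c N (G x)) + ennreal c * indicator ?A x)"
    unfolding choquet_def tail_def layers_def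
    by (intro nn_integral_cong arg_cong2[where f = times] arg_cong2[where f = ennpow] arg_cong[where f = "emeasure M"] refl)
      (auto simp: indicator_def add.assoc simp del: of_nat_Suc)
  also have "\<dots> \<le> choquet M \<theta> (\<lambda>x. F x + layers c N (G x)) + ennreal c * ennpow (tail M G ?t) \<theta>"
    unfolding tail_def using \<theta> c by (intro choquet_add_indicator) measurable
  finally have first: "choquet M \<theta> (\<lambda>x. F x + layers c (Suc N) (G x))
     \<le> choquet M \<theta> (\<lambda>x. F x + layers c N (G x)) + ennreal c * ennpow (tail M G ?t) \<theta>" .
  have "ennreal c * ennpow (tail M G ?t) \<theta> = (\<integral>\<^sup>+\<tau>. ennpow (tail M G ?t) \<theta> * indicator {real N * c<..?t} \<tau> \<partial>lborel)"
    using c by (subst nn_integral_cmult) (auto simp: algebra_simps)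
  also have "\<dots> \<le> (\<integral>\<^sup>+\<tau>\<in>{real N * c<..?t}. ennpow (tail M G \<tau>) \<theta> \<partial>lborel)"
    using \<theta> antimonoD[OF tail_antimono[OF assms(2)]]
    by (intro nn_integral_mono) (auto simp: indicator_def intro!: ennpow_mono)
  finally have second: "ennreal c * ennpow (tail M G ?t) \<theta>
     \<le> (\<integral>\<^sup>+\<tau>\<in>{real N * c<..?t}. ennpow (tail M G \<tau>) \<theta> \<partial>lborel)" .
  note first
  also have "choquet M \<theta> (\<lambda>x. F x + layers c N (G x)) + ennreal c * ennpow (tail M G ?t) \<theta>
     \<le> choquet M \<theta> F + (\<integral>\<^sup>+\<tau>\<in>{0<..real N * c}. ennpow (tail M G \<tau>) \<theta> \<partial>lborel) + (\<integral>\<^sup>+\<tau>\<in>{real N * c<..?t}. ennpow (tail M G \<tau>) \<theta> \<partial>lborel)"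
    using Suc.IH second by (rule add_mono)
  also have "\<dots> = choquet M \<theta> F + (\<integral>\<^sup>+\<tau>. ennpow (tail M G \<tau>) \<theta> * indicator {0<..real N * c} \<tau> + ennpow (tail M G \<tau>) \<theta> * indicator {real N * c<..?t} \<tau> \<partial>lborel)"
    by (simp add: nn_integral_add add.assoc)
  also have "(\<integral>\<^sup>+\<tau>. ennpow (tail M G \<tau>) \<theta> * indicator {0<..real N * c} \<tau> + ennpow (tail M G \<tau>) \<theta> * indicator {real N * c<..?t} \<tau> \<partial>lborel)
      = (\<integral>\<^sup>+\<tau>\<in>{0<..?t}. ennpow (tail M G \<tau>) \<theta> \<partial>lborel)"
  proof (intro nn_integral_cong)
    fix \<tau> :: real
    have "real N * c \<le> ?t" "0 \<le> real N * c" using c by (auto simp: algebra_simps)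
    then show "ennpow (tail M G \<tau>) \<theta> * indicator {0<..real N * c} \<tau> + ennpow (tail M G \<tau>) \<theta> * indicator {real N * c<..?t} \<tau>
       = ennpow (tail M G \<tau>) \<theta> * indicator {0<..?t} \<tau>"
      by (auto simp: indicator_def simp del: of_nat_Suc)
  qed
  finally show ?case .
qed

text \<open>Approximating \<open>G\<close> from below by finitely many layers reduces the claim to sums in which the second
function is built from indicators, and monotone convergence removes the approximation.\<close>

lemma choquet_add_le:
  assumes [measurable]: "F \<in> borel_measurable M" "G \<in> borel_measurable M"
    and \<theta>: "0 < \<theta>" "\<theta> \<le> 1"
  shows "choquet M \<theta> (\<lambda>x. F x + G x) \<le> choquet M \<theta> F + choquet M \<theta> G"
proof -
  have [measurable]: "dyadic n \<in> borel_measurable borel" for n unfolding dyadic_def by measurable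
  have "F x + G x = (SUP n. F x + dyadic n (G x))" for x
    by (simp add: SUP_dyadic flip: ennreal_SUP_add_right)
  then have "choquet M \<theta> (\<lambda>x. F x + G x) = choquet M \<theta> (\<lambda>x. SUP n. F x + dyadic n (G x))"
    by simp
  also have "\<dots> = (SUP n. choquet M \<theta> (\<lambda>x. F x + dyadic n (G x)))"
    using \<theta> incseq_dyadic by (intro choquet_SUP) (auto simp: incseq_def)
  also have "\<dots> \<le> choquet M \<theta> F + choquet M \<theta> G"
  proof (rule SUP_least)
    fix n
    have "choquet M \<theta> (\<lambda>x. F x + dyadic n (G x))
       \<le> choquet M \<theta> F + (\<integral>\<^sup>+\<tau>\<in>{0<..real (n * 2 ^ n) * (1 / 2 ^ n)}. ennpow (tail M G \<tau>) \<theta> \<partial>lborel)"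
      unfolding dyadic_def using \<theta> by (intro choquet_add_layers) auto
    also have "\<dots> \<le> choquet M \<theta> F + choquet M \<theta> G"
      unfolding choquet_def by (intro add_left_mono nn_integral_mono mult_left_mono) (auto simp: indicator_def)
    finally show "choquet M \<theta> (\<lambda>x. F x + dyadic n (G x)) \<le> choquet M \<theta> F + choquet M \<theta> G" .
  qed
  finally show ?thesis .
qed

section \<open>Uniform convexity\<close>

lemma choquet_midpoint_le:
  assumes [measurable]: "f \<in> borel_measurable M" "g \<in> borel_measurable M"
    and q: "1 \<le> q" and \<theta>: "0 < \<theta>" "\<theta> \<le> 1"
  shows "2 * choquet M \<theta> (\<lambda>x. ennpow (ennreal (1 / 2) * (f x + g x)) q)
     \<le> choquet M \<theta> (\<lambda>x. ennpow (f x) q) + choquet M \<theta> (\<lambda>x. ennpow (g x) q)"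
proof -
  have "choquet M \<theta> (\<lambda>x. ennpow (ennreal (1 / 2) * (f x + g x)) q)
     \<le> choquet M \<theta> (\<lambda>x. ennreal (1 / 2) * (ennpow (f x) q + ennpow (g x) q))"
    using \<theta> ennpow_convex_comb[of q "1 / 2"] q by (intro choquet_mono) (auto simp: distrib_left)
  also have "\<dots> = ennreal (1 / 2) * choquet M \<theta> (\<lambda>x. ennpow (f x) q + ennpow (g x) q)"
    by (intro choquet_cmult) auto
  finally have "2 * choquet M \<theta> (\<lambda>x. ennpow (ennreal (1 / 2) * (f x + g x)) q)
     \<le> 2 * (ennreal (1 / 2) * choquet M \<theta> (\<lambda>x. ennpow (f x) q + ennpow (g x) q))"
    by (rule mult_left_mono) simp
  also have "\<dots> = choquet M \<theta> (\<lambda>x. ennpow (f x) q + ennpow (g x) q)"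
    by (rule double_half_ennreal)
  also have "\<dots> \<le> choquet M \<theta> (\<lambda>x. ennpow (f x) q) + choquet M \<theta> (\<lambda>x. ennpow (g x) q)"
    using \<theta> by (intro choquet_add_le) auto
  finally show ?thesis .
qed

text \<open>Let \<open>S = {g > (1 + \<eta>) f}\<close> and \<open>T = f\<^sup>q + g\<^sup>q\<close>. On \<open>S\<close> the \<open>q\<close>-th power of the midpoint is at most
\<open>(1 - c) T / 2\<close>, elsewhere at most \<open>T / 2\<close>. So if \<open>C\<close> of this power is nearly the mean of \<open>C(f\<^sup>q)\<close> and \<open>C(g\<^sup>q)\<close>,
then lowering \<open>T\<close> by the factor \<open>1 - c\<close> on \<open>S\<close> hardly changes its Choquet integral; subadditivity of
\<open>C\<close> is what allows \<open>C(T)\<close> to be compared with \<open>C(f\<^sup>q) + C(g\<^sup>q)\<close>. Let \<open>d(\<tau>)\<close> be the measure that the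
superlevel set at \<open>\<tau>\<close> loses by this lowering. The integral of \<open>d\<^sup>\<theta>\<close> is then small by
\<open>ennpow_split_gap\<close>, and it controls \<open>C(T 1\<^sub>S)\<close>, because \<open>\<mu>(S \<inter> {T > \<tau>}) = \<mu>(S \<inter> {(1 - c) T > \<tau>}) + d(\<tau>)\<close> gives
\<open>C(T 1\<^sub>S) \<le> (1 - c) C(T 1\<^sub>S) + \<integral> d\<^sup>\<theta>\<close>. Finally \<open>g\<^sup>q \<le> T\<close>.\<close>

lemma choquet_uniform_convexity:
  fixes M :: "'a measure"
  assumes q: "1 < q" and \<theta>: "0 < \<theta>" "\<theta> \<le> 1" and \<eta>: "0 < \<eta>" and \<epsilon>: "0 < \<epsilon>" and B: "0 \<le> B"
  obtains \<delta> where "0 < \<delta>"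
    "\<And>f g. f \<in> borel_measurable M \<Longrightarrow> g \<in> borel_measurable M \<Longrightarrow>
       choquet M \<theta> (\<lambda>x. ennpow (f x) q) \<le> ennreal B \<Longrightarrow>
       choquet M \<theta> (\<lambda>x. ennpow (g x) q) \<le> ennreal B \<Longrightarrow>
       choquet M \<theta> (\<lambda>x. ennpow (f x) q) + choquet M \<theta> (\<lambda>x. ennpow (g x) q)
         \<le> 2 * choquet M \<theta> (\<lambda>x. ennpow (ennreal (1 / 2) * (f x + g x)) q) + ennreal \<delta> \<Longrightarrow>
       choquet M \<theta> (\<lambda>x. ennpow (if ennreal (1 + \<eta>) * f x < g x then g x else 0) q) \<le> ennreal \<epsilon>"
proof -
  obtain c where c: "0 < c" "c < 1" and gap:
    "\<And>x y. ennreal (1 + \<eta>) * x < y \<Longrightarrow>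
       ennpow (ennreal (1 / 2) * (x + y)) q \<le> ennreal ((1 - c) / 2) * (ennpow x q + ennpow y q)"
    using ennpow_midpoint_gap[OF q \<eta>] by metis
  \<comment> \<open>The two error terms are each given half of the budget c * eps.\<close>
  define \<kappa> where "\<kappa> = c * \<epsilon> / (4 * (B + 1))"
  have \<kappa>: "0 < \<kappa>" using c \<epsilon> B by (simp add: \<kappa>_def)
  obtain K where K: "0 < K" and split:
    "\<And>b d. ennpow d \<theta> + ennreal K * ennpow b \<theta> \<le> ennreal (\<kappa> + K) * ennpow (b + d) \<theta>"
    using ennpow_split_gap[OF \<theta>(1) \<kappa>] by metis
  define \<delta> where "\<delta> = c * \<epsilon> / (2 * K)"
  have \<delta>: "0 < \<delta>" using c \<epsilon> K by (simp add: \<delta>_def)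
  have budget: "\<kappa> * (B + B) + K * \<delta> \<le> c * \<epsilon>"
  proof -
    have "\<kappa> * (B + B) = c * \<epsilon> / 2 * (B / (B + 1))" using B by (simp add: \<kappa>_def field_simps)
    also have "\<dots> \<le> c * \<epsilon> / 2 * 1" using B c \<epsilon> by (intro mult_left_mono) auto
    finally show ?thesis using K by (simp add: \<delta>_def field_simps)
  qed
  show ?thesis
  proof (rule that[OF \<delta>])
    fix f g :: "'a \<Rightarrow> ennreal"
    assume [measurable]: "f \<in> borel_measurable M" "g \<in> borel_measurable M"
      and fB: "choquet M \<theta> (\<lambda>x. ennpow (f x) q) \<le> ennreal B"
      and gB: "choquet M \<theta> (\<lambda>x. ennpow (g x) q) \<le> ennreal B"
      and mid: "choquet M \<theta> (\<lambda>x. ennpow (f x) q) + choquet M \<theta> (\<lambda>x. ennpow (g x) q)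
         \<le> 2 * choquet M \<theta> (\<lambda>x. ennpow (ennreal (1 / 2) * (f x + g x)) q) + ennreal \<delta>"
    define S where "S = {x \<in> space M. ennreal (1 + \<eta>) * f x < g x}"
    have [measurable]: "S \<in> sets M" unfolding S_def by measurable
    define T where "T x = ennpow (f x) q + ennpow (g x) q" for x
    define T' where "T' x = (if x \<in> S then ennreal (1 - c) * T x else T x)" for x
    define U where "U x = (if x \<in> S then T x else 0)" for x
    have [measurable]: "T \<in> borel_measurable M" unfolding T_def by measurable
    have [measurable]: "T' \<in> borel_measurable M" unfolding T'_def by measurable
    have [measurable]: "U \<in> borel_measurable M" unfolding U_def by measurable
    have shrink: "ennreal (1 - c) * y \<le> y" for y
      using mult_right_mono[of "ennreal (1 - c)" 1 y] c by simp
    have CT: "choquet M \<theta> T \<le> choquet M \<theta> (\<lambda>x. ennpow (f x) q) + choquet M \<theta> (\<lambda>x. ennpow (g x) q)"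
      unfolding T_def using \<theta> by (intro choquet_add_le) auto
    also have "\<dots> \<le> ennreal (B + B)"
      using add_mono[OF fB gB] B by (simp flip: ennreal_plus)
    finally have CTB: "choquet M \<theta> T \<le> ennreal (B + B)" .
    have CT'T: "choquet M \<theta> T' \<le> choquet M \<theta> T"
      using \<theta> shrink by (intro choquet_mono) (auto simp: T'_def)
    have "choquet M \<theta> (\<lambda>x. ennpow (ennreal (1 / 2) * (f x + g x)) q) \<le> choquet M \<theta> (\<lambda>x. ennreal (1 / 2) * T' x)"
    proof (rule choquet_mono)
      fix x assume x: "x \<in> space M"
      show "ennpow (ennreal (1 / 2) * (f x + g x)) q \<le> ennreal (1 / 2) * T' x"
      proof (cases "x \<in> S")
        case True
        then have "ennpow (ennreal (1 / 2) * (f x + g x)) q \<le> ennreal ((1 - c) / 2) * T x"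
          unfolding T_def S_def by (intro gap) auto
        also have "ennreal ((1 - c) / 2) = ennreal (1 / 2) * ennreal (1 - c)"
          using c ennreal_mult[of "1 / 2" "1 - c"] by simp
        finally show ?thesis using True by (simp only: T'_def if_True mult.assoc)
      next
        case False
        then show ?thesis
          using ennpow_convex_comb[of q "1 / 2" "f x" "g x"] q by (simp add: T'_def T_def distrib_left)
      qed
    qed (use \<theta> in auto)
    also have "\<dots> = ennreal (1 / 2) * choquet M \<theta> T'"
      by (intro choquet_cmult) auto
    finally have "2 * choquet M \<theta> (\<lambda>x. ennpow (ennreal (1 / 2) * (f x + g x)) q) \<le> 2 * (ennreal (1 / 2) * choquet M \<theta> T')"
      by (rule mult_left_mono) simp
    also have "\<dots> = choquet M \<theta> T'"
      by (rule double_half_ennreal)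
    finally have CTT': "choquet M \<theta> T \<le> choquet M \<theta> T' + ennreal \<delta>"
      using CT mid by (meson add_right_mono order_trans)
    \<comment> \<open>When both measures are infinite the truncated difference is infinite, so that the sums below stay correct.\<close>
    define d where "d \<tau> = tail M U \<tau> - tail M (\<lambda>x. ennreal (1 - c) * U x) \<tau>" for \<tau>
    have [measurable]: "d \<in> borel_measurable borel" unfolding d_def by measurable
    have Ule: "tail M (\<lambda>x. ennreal (1 - c) * U x) \<tau> \<le> tail M U \<tau>" for \<tau>
      using shrink by (intro tail_mono) auto
    have dU: "tail M U \<tau> = tail M (\<lambda>x. ennreal (1 - c) * U x) \<tau> + d \<tau>" for \<tau>
      unfolding d_def by (rule add_diff_inverse_ennreal[OF Ule, symmetric])
    have off: "tail M H \<tau> = emeasure M {x \<in> space M - S. ennreal \<tau> < T x} + tail M V \<tau>"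
      if [measurable]: "H \<in> borel_measurable M" "V \<in> borel_measurable M"
        and "\<And>x. x \<in> S \<Longrightarrow> H x = V x" "\<And>x. x \<notin> S \<Longrightarrow> H x = T x" "\<And>x. x \<notin> S \<Longrightarrow> V x = 0"
      for H V \<tau>
    proof -
      have "{x \<in> space M. ennreal \<tau> < H x} = {x \<in> space M - S. ennreal \<tau> < T x} \<union> {x \<in> space M. ennreal \<tau> < V x}"
      proof (rule set_eqI)
        fix x
        show "x \<in> {x \<in> space M. ennreal \<tau> < H x} \<longleftrightarrow> x \<in> {x \<in> space M - S. ennreal \<tau> < T x} \<union> {x \<in> space M. ennreal \<tau> < V x}"
          by (cases "x \<in> S") (simp_all add: that(3-5))
      qed
      moreover have "{x \<in> space M - S. ennreal \<tau> < T x} \<inter> {x \<in> space M. ennreal \<tau> < V x} = {}"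
        using that(5) by auto
      ultimately show ?thesis unfolding tail_def by (simp add: plus_emeasure)
    qed
    have tT: "tail M T \<tau> = tail M T' \<tau> + d \<tau>" for \<tau>
    proof -
      have "tail M T \<tau> = emeasure M {x \<in> space M - S. ennreal \<tau> < T x} + tail M U \<tau>"
        by (rule off) (auto simp: U_def)
      moreover have "tail M T' \<tau> = emeasure M {x \<in> space M - S. ennreal \<tau> < T x} + tail M (\<lambda>x. ennreal (1 - c) * U x) \<tau>"
        by (rule off) (auto simp: U_def T'_def)
      ultimately show ?thesis using dU by (simp add: add.assoc)
    qed
    let ?D = "\<integral>\<^sup>+\<tau>\<in>{0<..}. ennpow (d \<tau>) \<theta> \<partial>lborel"
    have "?D + ennreal K * choquet M \<theta> T'
       = (\<integral>\<^sup>+\<tau>\<in>{0<..}. (ennpow (d \<tau>) \<theta> + ennreal K * ennpow (tail M T' \<tau>) \<theta>) \<partial>lborel)"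
      unfolding choquet_def
      by (simp add: nn_integral_add distrib_right nn_integral_cmult mult.assoc)
    also have "\<dots> \<le> (\<integral>\<^sup>+\<tau>. ennreal (\<kappa> + K) * (ennpow (tail M T \<tau>) \<theta> * indicator {0<..} \<tau>) \<partial>lborel)"
      unfolding mult.assoc[symmetric] tT using split by (intro nn_integral_mono mult_right_mono) auto
    also have "\<dots> = ennreal (\<kappa> + K) * choquet M \<theta> T"
      unfolding choquet_def by (intro nn_integral_cmult) auto
    also have "\<dots> = ennreal \<kappa> * choquet M \<theta> T + ennreal K * choquet M \<theta> T"
      using \<kappa> K by (simp add: distrib_right)
    also have "\<dots> \<le> ennreal \<kappa> * ennreal (B + B) + ennreal K * (choquet M \<theta> T' + ennreal \<delta>)"
      using CTB CTT' by (intro add_mono mult_left_mono) auto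
    also have "\<dots> = ennreal K * choquet M \<theta> T' + ennreal (\<kappa> * (B + B) + K * \<delta>)"
      using \<kappa> K \<delta> B by (simp add: ennreal_mult distrib_left ac_simps)
    finally have "ennreal K * choquet M \<theta> T' + ?D \<le> ennreal K * choquet M \<theta> T' + ennreal (\<kappa> * (B + B) + K * \<delta>)"
      by (simp only: add.commute)
    moreover have "ennreal K * choquet M \<theta> T' \<noteq> top"
      using CT'T CTB by (auto simp: ennreal_mult_eq_top_iff top_unique)
    ultimately have "?D \<le> ennreal (\<kappa> * (B + B) + K * \<delta>)"
      by (simp only: ennreal_add_left_cancel_le infinity_ennreal_def simp_thms)
    also have "\<dots> \<le> ennreal (c * \<epsilon>)" using budget by (rule ennreal_leI)
    finally have D: "?D \<le> ennreal (c * \<epsilon>)" .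
    have "choquet M \<theta> U \<le> (\<integral>\<^sup>+\<tau>\<in>{0<..}. (ennpow (tail M (\<lambda>x. ennreal (1 - c) * U x) \<tau>) \<theta> + ennpow (d \<tau>) \<theta>) \<partial>lborel)"
      unfolding choquet_def[of M \<theta> U] dU
      by (intro nn_integral_mono mult_right_mono ennpow_add_le[OF \<theta>]) auto
    also have "\<dots> = choquet M \<theta> (\<lambda>x. ennreal (1 - c) * U x) + ?D"
      unfolding choquet_def by (simp add: nn_integral_add distrib_right)
    also have "choquet M \<theta> (\<lambda>x. ennreal (1 - c) * U x) = ennreal (1 - c) * choquet M \<theta> U"
      using c by (intro choquet_cmult) auto
    finally have U1: "choquet M \<theta> U \<le> ennreal (1 - c) * choquet M \<theta> U + ennreal (c * \<epsilon>)"
      using D by (meson add_left_mono order_trans)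
    have "choquet M \<theta> U \<le> choquet M \<theta> T"
      using \<theta> by (intro choquet_mono) (auto simp: U_def)
    then have "choquet M \<theta> U \<noteq> top" using CTB by (auto simp: top_unique)
    then obtain y where y: "choquet M \<theta> U = ennreal y" "0 \<le> y" by (cases "choquet M \<theta> U") auto
    have "ennreal y \<le> ennreal ((1 - c) * y + c * \<epsilon>)"
      using U1 y c \<epsilon> by (simp add: ennreal_mult)
    then have "y \<le> (1 - c) * y + c * \<epsilon>"
      using y c \<epsilon> by (subst (asm) ennreal_le_iff) auto
    then have "c * y \<le> c * \<epsilon>" by (simp add: algebra_simps)
    then have "y \<le> \<epsilon>" using c by simp
    then have "choquet M \<theta> U \<le> ennreal \<epsilon>" using y by (simp add: ennreal_leI)
    moreover have "choquet M \<theta> (\<lambda>x. ennpow (if ennreal (1 + \<eta>) * f x < g x then g x else 0) q) \<le> choquet M \<theta> U"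
      using \<theta> by (intro choquet_mono) (auto simp: U_def S_def T_def)
    ultimately show "choquet M \<theta> (\<lambda>x. ennpow (if ennreal (1 + \<eta>) * f x < g x then g x else 0) q) \<le> ennreal \<epsilon>"
      by (rule order_trans[rotated])
  qed
qed

lemma lnorm_powr:
  assumes "f \<in> borel_measurable M" "0 < p" "0 < s"
  shows "ennpow (lnorm M p (ennreal s) f) s = ennreal (p / s) * choquet M (s / p) (\<lambda>x. ennpow (f x) s)"
  using assms by (simp add: lorentz_norm_eq_choquet)

lemma lnorm_powr_cmult:
  assumes [measurable]: "f \<in> borel_measurable M" and p: "0 < p" and s: "0 < s" and c: "0 < c"
  shows "ennpow (lnorm M p (ennreal s) (\<lambda>x. ennreal c * f x)) s
    = ennreal (c powr s) * ennpow (lnorm M p (ennreal s) f) s"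
proof -
  have "choquet M (s / p) (\<lambda>x. ennpow (ennreal c * f x) s)
      = choquet M (s / p) (\<lambda>x. ennreal (c powr s) * ennpow (f x) s)"
    using c s by (simp add: ennpow_mult ennpow_ennreal)
  also have "\<dots> = ennreal (c powr s) * choquet M (s / p) (\<lambda>x. ennpow (f x) s)"
    using c by (intro choquet_cmult) auto
  finally show ?thesis using p s by (simp add: lnorm_powr mult.left_commute)
qed

lemma lnorm_powr_mono:
  assumes [measurable]: "f \<in> borel_measurable M" "g \<in> borel_measurable M"
    and p: "0 < p" and s: "0 < s" and le: "\<And>x. f x \<le> g x"
  shows "ennpow (lnorm M p (ennreal s) f) s \<le> ennpow (lnorm M p (ennreal s) g) s"
  using p s le by (simp add: lnorm_powr mult_left_mono choquet_mono ennpow_mono)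

lemma lnorm_powr_midpoint_le:
  assumes [measurable]: "f \<in> borel_measurable M" "g \<in> borel_measurable M"
    and s: "1 \<le> s" and p: "s \<le> p"
  shows "2 * ennpow (lnorm M p (ennreal s) (\<lambda>x. ennreal (1 / 2) * (f x + g x))) s
     \<le> ennpow (lnorm M p (ennreal s) f) s + ennpow (lnorm M p (ennreal s) g) s"
proof -
  have "ennreal (p / s) * (2 * choquet M (s / p) (\<lambda>x. ennpow (ennreal (1 / 2) * (f x + g x)) s))
     \<le> ennreal (p / s) * (choquet M (s / p) (\<lambda>x. ennpow (f x) s) + choquet M (s / p) (\<lambda>x. ennpow (g x) s))"
    using s p by (intro mult_left_mono choquet_midpoint_le) auto
  then show ?thesis using s p by (simp add: lnorm_powr distrib_left mult.left_commute)
qed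

text \<open>The preceding lemma in terms of the Lorentz quasinorm: the bounds are rescaled by the constant
\<open>p/s\<close> that relates its power to the Choquet integral.\<close>

lemma lnorm_uniform_convexity:
  fixes M :: "'a measure"
  assumes s: "1 < s" and p: "s \<le> p" and \<eta>: "0 < \<eta>" and \<epsilon>: "0 < \<epsilon>" and B: "0 \<le> B"
  obtains \<delta> where "0 < \<delta>"
    "\<And>f g. f \<in> borel_measurable M \<Longrightarrow> g \<in> borel_measurable M \<Longrightarrow>
       ennpow (lnorm M p (ennreal s) f) s \<le> ennreal B \<Longrightarrow>
       ennpow (lnorm M p (ennreal s) g) s \<le> ennreal B \<Longrightarrow>
       ennpow (lnorm M p (ennreal s) f) s + ennpow (lnorm M p (ennreal s) g) s
         \<le> 2 * ennpow (lnorm M p (ennreal s) (\<lambda>x. ennreal (1 / 2) * (f x + g x))) s + ennreal \<delta> \<Longrightarrow>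
       ennpow (lnorm M p (ennreal s) (\<lambda>x. if ennreal (1 + \<eta>) * f x < g x then g x else 0)) s \<le> ennreal \<epsilon>"
proof -
  define k where "k = p / s"
  have k: "0 < k" using s p by (simp add: k_def)
  have scale: "ennreal k * y \<le> ennreal z \<longleftrightarrow> y \<le> ennreal (z / k)" if "0 \<le> z" for y z
    using that k by (cases y) (auto simp: ennreal_mult_top top_unique field_simps simp flip: ennreal_mult)
  obtain \<delta> where \<delta>: "0 < \<delta>" and uc:
    "\<And>f g. f \<in> borel_measurable M \<Longrightarrow> g \<in> borel_measurable M \<Longrightarrow>
       choquet M (s / p) (\<lambda>x. ennpow (f x) s) \<le> ennreal (B / k) \<Longrightarrow>
       choquet M (s / p) (\<lambda>x. ennpow (g x) s) \<le> ennreal (B / k) \<Longrightarrow>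
       choquet M (s / p) (\<lambda>x. ennpow (f x) s) + choquet M (s / p) (\<lambda>x. ennpow (g x) s)
         \<le> 2 * choquet M (s / p) (\<lambda>x. ennpow (ennreal (1 / 2) * (f x + g x)) s) + ennreal \<delta> \<Longrightarrow>
       choquet M (s / p) (\<lambda>x. ennpow (if ennreal (1 + \<eta>) * f x < g x then g x else 0) s) \<le> ennreal (\<epsilon> / k)"
  proof (rule choquet_uniform_convexity[of s "s / p" \<eta> "\<epsilon> / k" "B / k" M])
    show "1 < s" "0 < s / p" "s / p \<le> 1" "0 < \<eta>" "0 < \<epsilon> / k" "0 \<le> B / k"
      using s p \<eta> \<epsilon> B k by auto
  qed blast
  show ?thesis
  proof (rule that[of "k * \<delta>"])
    show "0 < k * \<delta>" using k \<delta> by simp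
    fix f g :: "'a \<Rightarrow> ennreal"
    assume [measurable]: "f \<in> borel_measurable M" "g \<in> borel_measurable M"
      and fB: "ennpow (lnorm M p (ennreal s) f) s \<le> ennreal B"
      and gB: "ennpow (lnorm M p (ennreal s) g) s \<le> ennreal B"
      and mid: "ennpow (lnorm M p (ennreal s) f) s + ennpow (lnorm M p (ennreal s) g) s
         \<le> 2 * ennpow (lnorm M p (ennreal s) (\<lambda>x. ennreal (1 / 2) * (f x + g x))) s + ennreal (k * \<delta>)"
    have norm: "ennpow (lnorm M p (ennreal s) h) s = ennreal k * choquet M (s / p) (\<lambda>x. ennpow (h x) s)"
      if "h \<in> borel_measurable M" for h
      using that s p by (simp add: lnorm_powr k_def)
    have "ennreal k * (choquet M (s / p) (\<lambda>x. ennpow (f x) s) + choquet M (s / p) (\<lambda>x. ennpow (g x) s))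
       \<le> ennreal k * (2 * choquet M (s / p) (\<lambda>x. ennpow (ennreal (1 / 2) * (f x + g x)) s) + ennreal \<delta>)"
      using mid k \<delta> by (simp add: norm distrib_left mult.left_commute ennreal_mult)
    then have "choquet M (s / p) (\<lambda>x. ennpow (f x) s) + choquet M (s / p) (\<lambda>x. ennpow (g x) s)
       \<le> 2 * choquet M (s / p) (\<lambda>x. ennpow (ennreal (1 / 2) * (f x + g x)) s) + ennreal \<delta>"
      by (subst (asm) ennreal_mult_le_mult_iff) (use k in auto)
    then show "ennpow (lnorm M p (ennreal s) (\<lambda>x. if ennreal (1 + \<eta>) * f x < g x then g x else 0)) s \<le> ennreal \<epsilon>"
      using uc[of f g] fB gB B \<epsilon> by (simp add: norm scale)
  qed
qed

lemma suminf_half_powers: "(\<Sum>k. ennreal (\<epsilon> * (1 / 2) ^ Suc k)) = ennreal \<epsilon>" if "0 \<le> \<epsilon>"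
proof (rule suminf_ennreal_eq)
  show "(\<lambda>k. \<epsilon> * (1 / 2) ^ Suc k) sums \<epsilon>"
    using sums_mult[OF power_half_series, of \<epsilon>] by simp
qed (use that in auto)

text \<open>Uniform convexity for consecutive terms gives \<open>f\<^sub>k\<^sub>+\<^sub>1 \<le> max (l\<^sub>k f\<^sub>k, e\<^sub>k)\<close> with small \<open>e\<^sub>k\<close> and factors
\<open>l\<^sub>k\<close> whose product stays below \<open>1 + \<eta>\<close>. Hence every \<open>f\<^sub>n\<close> is at most \<open>(1 + \<eta>) max (f\<^sub>0, sup e\<^sub>k)\<close>, and
\<open>lnorm_SUP_le\<close> bounds the quasinorm of this maximum. The point is that the supremum of the whole
sequence, and not only its limit, costs hardly more than its first term.\<close>

lemma lnorm_SUP_chain: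
  fixes M :: "'a measure"
  assumes s: "1 < s" and p: "s \<le> p" and \<eta>: "0 < \<eta>" and \<epsilon>: "0 < \<epsilon>" and B: "0 \<le> B"
  obtains \<delta> :: "nat \<Rightarrow> real" where "\<And>k. 0 < \<delta> k"
    "\<And>f. (\<And>k. f k \<in> borel_measurable M) \<Longrightarrow>
       (\<And>k. ennpow (lnorm M p (ennreal s) (f k)) s \<le> ennreal B) \<Longrightarrow>
       (\<And>k. ennpow (lnorm M p (ennreal s) (f k)) s + ennpow (lnorm M p (ennreal s) (f (Suc k))) s
         \<le> 2 * ennpow (lnorm M p (ennreal s) (\<lambda>x. ennreal (1 / 2) * (f k x + f (Suc k) x))) s + ennreal (\<delta> k)) \<Longrightarrow>
       ennpow (lnorm M p (ennreal s) (\<lambda>x. SUP k. f k x)) s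
         \<le> ennreal ((1 + \<eta>) powr s) * (ennpow (lnorm M p (ennreal s) (f 0)) s + ennreal \<epsilon>)"
proof -
  \<comment> \<open>The exponents 1/2, 1/4, ... add up to 1.\<close>
  define l where "l k = (1 + \<eta>) powr ((1 / 2) ^ Suc k)" for k :: nat
  have l: "1 < l k" for k unfolding l_def using \<eta> by (intro gr_one_powr) auto
  define Q where "Q k d \<longleftrightarrow> (\<forall>f g. f \<in> borel_measurable M \<longrightarrow> g \<in> borel_measurable M \<longrightarrow>
       ennpow (lnorm M p (ennreal s) f) s \<le> ennreal B \<longrightarrow>
       ennpow (lnorm M p (ennreal s) g) s \<le> ennreal B \<longrightarrow>
       ennpow (lnorm M p (ennreal s) f) s + ennpow (lnorm M p (ennreal s) g) s
         \<le> 2 * ennpow (lnorm M p (ennreal s) (\<lambda>x. ennreal (1 / 2) * (f x + g x))) s + ennreal d \<longrightarrow>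
       ennpow (lnorm M p (ennreal s) (\<lambda>x. if ennreal (l k) * f x < g x then g x else 0)) s \<le> ennreal (\<epsilon> * (1 / 2) ^ Suc k))"
    for k d
  have "\<exists>d>0. Q k d" for k
  proof -
    have pos: "0 < l k - 1" "0 < \<epsilon> * (1 / 2) ^ Suc k" using l[of k] \<epsilon> by auto
    show ?thesis
    proof (rule lnorm_uniform_convexity[OF s p pos B, where M = M])
      fix d :: real
      assume d: "0 < d" and uc: "\<And>f g. f \<in> borel_measurable M \<Longrightarrow> g \<in> borel_measurable M \<Longrightarrow>
       ennpow (lnorm M p (ennreal s) f) s \<le> ennreal B \<Longrightarrow>
       ennpow (lnorm M p (ennreal s) g) s \<le> ennreal B \<Longrightarrow>
       ennpow (lnorm M p (ennreal s) f) s + ennpow (lnorm M p (ennreal s) g) s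
         \<le> 2 * ennpow (lnorm M p (ennreal s) (\<lambda>x. ennreal (1 / 2) * (f x + g x))) s + ennreal d \<Longrightarrow>
       ennpow (lnorm M p (ennreal s) (\<lambda>x. if ennreal (1 + (l k - 1)) * f x < g x then g x else 0)) s \<le> ennreal (\<epsilon> * (1 / 2) ^ Suc k)"
      have "1 + (l k - 1) = l k" by simp
      then have "Q k d" unfolding Q_def by (intro allI impI) (drule (4) uc, simp only:)
      with d show ?thesis by blast
    qed
  qed
  then obtain \<delta> where \<delta>: "\<And>k. 0 < \<delta> k" and Q: "\<And>k. Q k (\<delta> k)"
    by metis
  show ?thesis
  proof (rule that[OF \<delta>])
    fix f :: "nat \<Rightarrow> 'a \<Rightarrow> ennreal"
    assume f [measurable]: "\<And>k. f k \<in> borel_measurable M"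
      and fB: "\<And>k. ennpow (lnorm M p (ennreal s) (f k)) s \<le> ennreal B"
      and mid: "\<And>k. ennpow (lnorm M p (ennreal s) (f k)) s + ennpow (lnorm M p (ennreal s) (f (Suc k))) s
         \<le> 2 * ennpow (lnorm M p (ennreal s) (\<lambda>x. ennreal (1 / 2) * (f k x + f (Suc k) x))) s + ennreal (\<delta> k)"
    define e where "e k x = (if ennreal (l k) * f k x < f (Suc k) x then f (Suc k) x else 0)" for k x
    have [measurable]: "e k \<in> borel_measurable M" for k unfolding e_def by measurable
    have eb: "ennpow (lnorm M p (ennreal s) (e k)) s \<le> ennreal (\<epsilon> * (1 / 2) ^ Suc k)" for k
      using Q[of k] f fB mid[of k] unfolding Q_def e_def by simp
    \<comment> \<open>The maximum of f 0 and all e k as the supremum of one sequence.\<close>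
    define h where "h k = (case k of 0 \<Rightarrow> f 0 | Suc k \<Rightarrow> e k)" for k
    have [measurable]: "h k \<in> borel_measurable M" for k by (cases k) (auto simp: h_def)
    have chain: "f n x \<le> ennreal ((1 + \<eta>) powr (1 - (1 / 2) ^ n)) * (SUP k. h k x)" for n x
    proof (induction n)
      case 0
      show ?case using SUP_upper[of 0 UNIV "\<lambda>k. h k x"] \<eta> by (simp add: h_def)
    next
      case (Suc n)
      let ?c = "(1 + \<eta>) powr (1 - (1 / 2) ^ Suc n)"
      have c: "l n * (1 + \<eta>) powr (1 - (1 / 2) ^ n) = ?c" using \<eta> by (simp add: l_def flip: powr_add)
      have "(1 / 2 :: real) ^ Suc n \<le> 1" by (rule power_le_one) auto
      then have c1: "1 \<le> ?c" using \<eta> by (intro ge_one_powr_ge_zero) (auto simp del: power_Suc)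
      show ?case
      proof (cases "ennreal (l n) * f n x < f (Suc n) x")
        case True
        then have "f (Suc n) x = h (Suc n) x" by (simp add: h_def e_def)
        also have "\<dots> \<le> (SUP k. h k x)" by (rule SUP_upper) simp
        also have "\<dots> \<le> ennreal ?c * (SUP k. h k x)"
          using mult_right_mono[of 1 "ennreal ?c" "SUP k. h k x"] c1 by simp
        finally show ?thesis .
      next
        case False
        then have "f (Suc n) x \<le> ennreal (l n) * f n x" by simp
        also have "\<dots> \<le> ennreal (l n) * (ennreal ((1 + \<eta>) powr (1 - (1 / 2) ^ n)) * (SUP k. h k x))"
          using Suc by (intro mult_left_mono) auto
        also have "\<dots> = ennreal ?c * (SUP k. h k x)"
          unfolding mult.assoc[symmetric] c[symmetric] using l[of n] by (subst ennreal_mult) auto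
        finally show ?thesis .
      qed
    qed
    have up: "(SUP k. f k x) \<le> ennreal (1 + \<eta>) * (SUP k. h k x)" for x
    proof (rule SUP_least)
      fix n
      have "(1 + \<eta>) powr (1 - (1 / 2) ^ n) \<le> (1 + \<eta>) powr 1"
        using \<eta> by (intro powr_mono) auto
      then have "ennreal ((1 + \<eta>) powr (1 - (1 / 2) ^ n)) * (SUP k. h k x) \<le> ennreal (1 + \<eta>) * (SUP k. h k x)"
        using \<eta> by (intro mult_right_mono ennreal_leI) auto
      then show "f n x \<le> ennreal (1 + \<eta>) * (SUP k. h k x)"
        using chain[of n x] by (rule order_trans[rotated])
    qed
    have r: "lorentz_exponent p (ennreal s) = s" using s p by (simp add: lorentz_exponent_def)
    have "ennpow (lnorm M p (ennreal s) (\<lambda>x. SUP k. f k x)) s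
      \<le> ennpow (lnorm M p (ennreal s) (\<lambda>x. ennreal (1 + \<eta>) * (SUP k. h k x))) s"
      using s p up by (intro lnorm_powr_mono) auto
    also have "\<dots> = ennreal ((1 + \<eta>) powr s) * ennpow (lnorm M p (ennreal s) (\<lambda>x. SUP k. h k x)) s"
      using s p \<eta> by (intro lnorm_powr_cmult) auto
    also have "\<dots> \<le> ennreal ((1 + \<eta>) powr s) * (ennpow (lnorm M p (ennreal s) (f 0)) s + ennreal \<epsilon>)"
    proof (rule mult_left_mono)
      have "ennpow (lnorm M p (ennreal s) (\<lambda>x. SUP k. h k x)) s \<le> (\<Sum>k. ennpow (lnorm M p (ennreal s) (h k)) s)"
        using lnorm_SUP_le[of h M p "ennreal s"] s p by (simp add: r)
      also have "\<dots> = (\<Sum>k. ennpow (lnorm M p (ennreal s) (h (Suc k))) s) + ennpow (lnorm M p (ennreal s) (h 0)) s"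
        using suminf_offset[of "\<lambda>k. ennpow (lnorm M p (ennreal s) (h k)) s" 1] by (simp add: add.commute)
      also have "\<dots> \<le> (\<Sum>k. ennreal (\<epsilon> * (1 / 2) ^ Suc k)) + ennpow (lnorm M p (ennreal s) (f 0)) s"
        using eb by (intro add_mono suminf_le) (auto simp: h_def)
      also have "\<dots> = ennpow (lnorm M p (ennreal s) (f 0)) s + ennreal \<epsilon>"
        using \<epsilon> by (simp only: suminf_half_powers less_imp_le add.commute)
      finally show "ennpow (lnorm M p (ennreal s) (\<lambda>x. SUP k. h k x)) s \<le> ennpow (lnorm M p (ennreal s) (f 0)) s + ennreal \<epsilon>" .
    qed simp
    finally show "ennpow (lnorm M p (ennreal s) (\<lambda>x. SUP k. f k x)) s
         \<le> ennreal ((1 + \<eta>) powr s) * (ennpow (lnorm M p (ennreal s) (f 0)) s + ennreal \<epsilon>)" .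
  qed
qed

section \<open>Exceptional families of curves\<close>

text \<open>The sigma-algebra of \<open>M\<close> contains the Borel sets, but may be larger.\<close>

lemma borel_measurable_metric_measure_space:
  fixes f :: "'a::metric_space \<Rightarrow> 'b::topological_space"
  assumes "metric_measure_space M" "f \<in> borel_measurable borel"
  shows "f \<in> borel_measurable M"
proof (rule measurableI)
  fix A :: "'b set" assume "A \<in> sets borel"
  then have "f -` A \<inter> space borel \<in> sets borel" using assms(2) by (rule measurable_sets[rotated])
  then show "f -` A \<inter> space M \<in> sets M"
    using assms(1) by (auto simp: metric_measure_space_def)
qed auto

lemma lorentz_norm_mono:
  assumes "f \<in> borel_measurable M" "\<And>x. \<bar>h x\<bar> \<le> \<bar>f x\<bar>" "0 < p"
  shows "lorentz_norm M p q h \<le> lorentz_norm M p q f"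
proof -
  have d: "distribution M h t \<le> distribution M f t" for t
    unfolding distribution_def using assms(1,2) by (intro emeasure_mono) (auto intro: order.strict_trans2)
  have R: "rearrangement M h t \<le> rearrangement M f t" for t
    unfolding rearrangement_def using d by (intro INF_superset_mono) (auto intro: order_trans)
  have q0: "0 \<le> enn2real q" "0 \<le> 1 / enn2real q" by auto
  show ?thesis
  proof (cases "q = \<infinity>")
    case True
    then show ?thesis unfolding lorentz_norm_def using d assms(3)
      by (auto intro!: SUP_mono' mult_left_mono ennpow_mono)
  next
    case False
    then show ?thesis unfolding lorentz_norm_def using R q0
      by (simp add: ennpow_mono nn_integral_mono mult_left_mono mult_right_mono)
  qed
qed

lemma lorentz_norm_zero: "lorentz_norm M p q (\<lambda>x. 0) = 0"
proof -
  have d: "distribution M (\<lambda>x. 0) t = 0" if "0 \<le> t" for t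
    using that by (simp add: distribution_def)
  have "rearrangement M (\<lambda>x. 0) t \<le> ennreal 0" for t
    unfolding rearrangement_def by (intro INF_lower) (simp add: d)
  then have "rearrangement M (\<lambda>x. 0) t = 0" for t by simp
  then show ?thesis by (simp add: lorentz_norm_def d)
qed

lemma lorentz_exponent_pos: "1 < p \<Longrightarrow> 1 \<le> q \<Longrightarrow> 0 < lorentz_exponent p q"
  by (auto simp: lorentz_exponent_def enn2real_positive_iff
      intro: order.strict_trans2[OF zero_less_one] order.strict_trans1[OF _ ennreal_less_top])

lemma modulus_empty: "modulus M p q {} = 0"
proof -
  have "modulus M p q {} \<le> ennpow (lorentz_norm M p q (\<lambda>x. enn2ereal ((\<lambda>_. 0) x))) p"
    unfolding modulus_def by (rule INF_lower) (simp add: admissible_def)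
  then show ?thesis by (simp add: lorentz_norm_zero zero_ennreal.rep_eq)
qed

lemma ae_curve_all:
  assumes "\<And>\<gamma>. P \<gamma>"
  shows "ae_curve M p q P"
  unfolding ae_curve_def using assms modulus_empty by blast

lemma ae_curve_mono:
  assumes "ae_curve M p q P" "\<And>\<gamma>. P \<gamma> \<Longrightarrow> Q \<gamma>"
  shows "ae_curve M p q Q"
  using assms unfolding ae_curve_def by blast

lemma line_integral_mono: "(\<And>x. g x \<le> h x) \<Longrightarrow> line_integral \<gamma> g \<le> line_integral \<gamma> h"
  unfolding line_integral_def by (intro nn_integral_mono mult_right_mono) auto

text \<open>Given functions that witness small moduli of the single families, their supremum is admissible for
the union, and \<open>lnorm_SUP_le\<close> bounds its quasinorm.\<close>

lemma modulus_UN_null: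
  fixes \<Gamma> :: "nat \<Rightarrow> (real \<Rightarrow> 'a::metric_space) set"
  assumes M: "metric_measure_space M" and p: "1 < p" and q: "1 \<le> q"
    and null: "\<And>i. modulus M p q (\<Gamma> i) = 0"
  shows "modulus M p q (\<Union>i. \<Gamma> i) = 0"
proof -
  define r where "r = lorentz_exponent p q"
  have r: "0 < r" using p q by (simp add: r_def lorentz_exponent_pos)
  have "ennpow (modulus M p q (\<Union>i. \<Gamma> i)) (r / p) \<le> 0"
  proof (rule ennreal_le_epsilon)
    fix e :: real assume e: "0 < e"
    have "\<exists>\<rho>\<in>admissible (\<Gamma> i). ennpow (lnorm M p q \<rho>) r < ennreal (e * (1 / 2) ^ Suc i)" for i
    proof -
      have "0 < ennpow (ennreal (e * (1 / 2) ^ Suc i)) (p / r)"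
        using e by (simp add: zero_less_iff_neq_zero del: power_Suc)
      then have "modulus M p q (\<Gamma> i) < ennpow (ennreal (e * (1 / 2) ^ Suc i)) (p / r)"
        by (simp only: null)
      then obtain \<rho> where \<rho>: "\<rho> \<in> admissible (\<Gamma> i)"
        "ennpow (lnorm M p q \<rho>) p < ennpow (ennreal (e * (1 / 2) ^ Suc i)) (p / r)"
        unfolding modulus_def INF_less_iff by blast
      have "ennpow (ennpow (lnorm M p q \<rho>) p) (1 / (p / r)) < ennreal (e * (1 / 2) ^ Suc i)"
        using \<rho>(2) p r by (subst (asm) less_ennpow_swap) auto
      then show ?thesis using \<rho>(1) p r by (auto simp: ennpow_ennpow simp del: power_Suc)
    qed
    then obtain \<rho> where \<rho>: "\<And>i. \<rho> i \<in> admissible (\<Gamma> i)"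
      "\<And>i. ennpow (lnorm M p q (\<rho> i)) r < ennreal (e * (1 / 2) ^ Suc i)"
      by metis
    then have [measurable]: "\<And>i. \<rho> i \<in> borel_measurable borel" by (auto simp: admissible_def)
    have adm: "(\<lambda>x. SUP i. \<rho> i x) \<in> admissible (\<Union>i. \<Gamma> i)"
    proof -
      have "1 \<le> line_integral \<gamma> (\<lambda>x. SUP i. \<rho> i x)" if "\<gamma> \<in> \<Gamma> i" for \<gamma> i
      proof -
        have "1 \<le> line_integral \<gamma> (\<rho> i)" using \<rho>(1)[of i] that by (simp add: admissible_def)
        also have "\<dots> \<le> line_integral \<gamma> (\<lambda>x. SUP i. \<rho> i x)"
          by (intro line_integral_mono SUP_upper) simp
        finally show ?thesis .
      qed
      then show ?thesis by (auto simp: admissible_def)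
    qed
    have "ennpow (modulus M p q (\<Union>i. \<Gamma> i)) (r / p) \<le> ennpow (ennpow (lnorm M p q (\<lambda>x. SUP i. \<rho> i x)) p) (r / p)"
      unfolding modulus_def using adm r p by (intro ennpow_mono INF_lower) auto
    also have "\<dots> = ennpow (lnorm M p q (\<lambda>x. SUP i. \<rho> i x)) r" using p by (simp add: ennpow_ennpow)
    also have "\<dots> \<le> (\<Sum>i. ennpow (lnorm M p q (\<rho> i)) r)"
      unfolding r_def using p q
      by (intro lnorm_SUP_le borel_measurable_metric_measure_space[OF M]) auto
    also have "\<dots> \<le> (\<Sum>i. ennreal (e * (1 / 2) ^ Suc i))"
      using \<rho>(2) by (intro suminf_le summableI less_imp_le)
    also have "\<dots> = 0 + ennreal e"
      using e by (simp only: suminf_half_powers less_imp_le add_0)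
    finally show "ennpow (modulus M p q (\<Union>i. \<Gamma> i)) (r / p) \<le> 0 + ennreal e" .
  qed
  then show ?thesis by simp
qed

lemma ae_curve_countable:
  fixes P :: "nat \<Rightarrow> (real \<Rightarrow> 'a::metric_space) \<Rightarrow> bool"
  assumes "metric_measure_space M" "1 < p" "1 \<le> q" and ae: "\<And>i. ae_curve M p q (P i)"
  shows "ae_curve M p q (\<lambda>\<gamma>. \<forall>i. P i \<gamma>)"
proof -
  obtain \<Gamma> where \<Gamma>: "\<And>i. \<Gamma> i \<subseteq> rect_curves" "\<And>i. modulus M p q (\<Gamma> i) = 0"
    "\<And>i \<gamma>. \<gamma> \<in> rect_curves - \<Gamma> i \<Longrightarrow> P i \<gamma>"
    using ae unfolding ae_curve_def by metis
  show ?thesis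
    unfolding ae_curve_def
  proof (intro exI[of _ "\<Union>i. \<Gamma> i"] conjI)
    show "modulus M p q (\<Union>i. \<Gamma> i) = 0" using assms(1-3) \<Gamma>(2) by (rule modulus_UN_null)
  qed (use \<Gamma>(1,3) in auto)
qed

lemma ae_curve_conj:
  fixes P :: "(real \<Rightarrow> 'a::metric_space) \<Rightarrow> bool"
  assumes "metric_measure_space M" "1 < p" "1 \<le> q" "ae_curve M p q P" "ae_curve M p q Q"
  shows "ae_curve M p q (\<lambda>\<gamma>. P \<gamma> \<and> Q \<gamma>)"
proof -
  have "ae_curve M p q (\<lambda>\<gamma>. \<forall>i::nat. if i = 0 then P \<gamma> else Q \<gamma>)"
  proof (rule ae_curve_countable[OF assms(1-3)])
    show "ae_curve M p q (\<lambda>\<gamma>. if i = 0 then P \<gamma> else Q \<gamma>)" for i :: nat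
      using assms(4,5) by (cases "i = 0") auto
  qed
  then show ?thesis
    by (rule ae_curve_mono) (metis zero_neq_one)
qed

section \<open>Capacity as a minimal energy of truncated pairs\<close>

text \<open>Equivalent to the upper gradient inequality for functions with values in \<open>[0, 1]\<close>, but without subtraction.\<close>

definition oscillation_le :: "('a::metric_space \<Rightarrow> ennreal) \<Rightarrow> ('a \<Rightarrow> ennreal) \<Rightarrow> (real \<Rightarrow> 'a) \<Rightarrow> bool" where
  "oscillation_le u g \<gamma> \<longleftrightarrow>
     u (pathstart \<gamma>) \<le> u (pathfinish \<gamma>) + line_integral \<gamma> g \<and>
     u (pathfinish \<gamma>) \<le> u (pathstart \<gamma>) + line_integral \<gamma> g"

text \<open>Truncated competitors for the capacity together with a weak upper gradient. Quasinorms may be infinite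
here: such pairs have infinite energy and do not affect the infimum.\<close>

definition cap_pairs ::
    "'a::metric_space measure \<Rightarrow> real \<Rightarrow> ennreal \<Rightarrow> 'a set \<Rightarrow> (('a \<Rightarrow> ennreal) \<times> ('a \<Rightarrow> ennreal)) set" where
  "cap_pairs M p q E = {(u, g). u \<in> borel_measurable borel \<and> g \<in> borel_measurable borel \<and>
     (\<forall>x. u x \<le> 1) \<and> (\<forall>x\<in>E. u x = 1) \<and> ae_curve M p q (oscillation_le u g)}"

definition energy :: "'a measure \<Rightarrow> real \<Rightarrow> ennreal \<Rightarrow> ('a \<Rightarrow> ennreal) \<times> ('a \<Rightarrow> ennreal) \<Rightarrow> ennreal" where
  "energy M p q = (\<lambda>(u, g). ennpow (lnorm M p q u) (lorentz_exponent p q)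
     + ennpow (lnorm M p q g) (lorentz_exponent p q))"

definition min_energy :: "'a::metric_space measure \<Rightarrow> real \<Rightarrow> ennreal \<Rightarrow> 'a set \<Rightarrow> ennreal" where
  "min_energy M p q E = (INF w\<in>cap_pairs M p q E. energy M p q w)"

lemma gradient_ineq_ennreal:
  assumes "\<And>x. u x \<le> (1 :: ennreal)"
  shows "gradient_ineq (\<lambda>x. enn2ereal (u x)) g \<gamma> \<longleftrightarrow> oscillation_le u g \<gamma>"
proof -
  have "u x < top" for x using assms[of x] by (rule order.strict_trans1) simp
  then obtain a b where ab: "u (pathstart \<gamma>) = ennreal a" "0 \<le> a" "u (pathfinish \<gamma>) = ennreal b" "0 \<le> b"
    by (metis ennreal_cases less_irrefl)
  show ?thesis
  proof (cases "line_integral \<gamma> g")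
    case (real c)
    then show ?thesis using ab
      by (auto simp: gradient_ineq_def oscillation_le_def abs_le_iff simp flip: ennreal_plus)
  next
    case top
    then show ?thesis using ab by (simp add: gradient_ineq_def oscillation_le_def)
  qed
qed

text \<open>Truncation to \<open>[0, 1]\<close> is a contraction; where \<open>u\<close> is infinite at an end point, so is the line integral.\<close>

lemma oscillation_le_truncate:
  assumes "gradient_ineq u g \<gamma>"
  shows "oscillation_le (\<lambda>x. min 1 (e2ennreal (u x))) g \<gamma>"
proof (cases "line_integral \<gamma> g = top")
  case True then show ?thesis by (simp add: oscillation_le_def)
next
  case False
  then have fin: "\<bar>u (pathstart \<gamma>)\<bar> \<noteq> \<infinity>" "\<bar>u (pathfinish \<gamma>)\<bar> \<noteq> \<infinity>"
    and ineq: "\<bar>u (pathstart \<gamma>) - u (pathfinish \<gamma>)\<bar> \<le> enn2ereal (line_integral \<gamma> g)"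
    using assms by (auto simp: gradient_ineq_def split: if_splits)
  obtain a b where ab: "u (pathstart \<gamma>) = ereal a" "u (pathfinish \<gamma>) = ereal b"
    using fin by (cases "u (pathstart \<gamma>)"; cases "u (pathfinish \<gamma>)") auto
  obtain c where c: "line_integral \<gamma> g = ennreal c" "0 \<le> c"
    using False by (cases "line_integral \<gamma> g") auto
  have abc: "\<bar>a - b\<bar> \<le> c" using ineq ab c by simp
  have e: "min 1 (e2ennreal (ereal t)) = ennreal (min 1 (max 0 t))" for t
  proof (cases "0 \<le> t")
    case True
    then show ?thesis using min_ennreal[of 1 t] by (simp add: max_absorb2)
  next
    case False
    then show ?thesis by (simp add: ennreal_neg max_absorb1)
  qed
  have step: "ennreal (min 1 (max 0 x)) \<le> ennreal (min 1 (max 0 y)) + ennreal c" if "\<bar>x - y\<bar> \<le> c" for x y :: real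
  proof -
    have "min 1 (max 0 x) \<le> min 1 (max 0 y) + c" using that by linarith
    then have "ennreal (min 1 (max 0 x)) \<le> ennreal (min 1 (max 0 y) + c)" by (rule ennreal_leI)
    also have "\<dots> = ennreal (min 1 (max 0 y)) + ennreal c" using c(2) by (intro ennreal_plus) auto
    finally show ?thesis .
  qed
  show ?thesis
    unfolding oscillation_le_def ab e c(1) using step[OF abc] step[of b a] abc by (simp only: abs_minus_commute simp_thms)
qed

text \<open>Every function is equivalent to itself, because the zero function has the zero weak upper gradient.
So passing to equivalence classes and back loses no representative.\<close>

lemma Union_newtonian: "\<Union> (newtonian M p q) = pre_newtonian M p q"
proof -
  have z: "ereal_fun_diff u u = (\<lambda>x. 0)" for u :: "'a \<Rightarrow> ereal" by (auto simp: ereal_fun_diff_def)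
  have ln: "lorentz_norm M p q (\<lambda>x. 0) = 0" by (rule lorentz_norm_zero)
  have ae: "ae_curve M p q (gradient_ineq (\<lambda>x. 0) (\<lambda>x. 0))"
    by (intro ae_curve_all) (auto simp: gradient_ineq_def line_integral_def zero_ennreal.rep_eq)
  have "(\<lambda>x. 0) \<in> lorentz_weak_gradients M p q (\<lambda>x. 0)"
    using ln ae by (simp add: lorentz_weak_gradients_def weak_upper_gradient_def lorentz_space_def zero_ennreal.rep_eq)
  then have "(INF g\<in>lorentz_weak_gradients M p q (\<lambda>x. 0). ennpow (lorentz_norm M p q (\<lambda>x. enn2ereal (g x))) r)
     \<le> ennpow (lorentz_norm M p q (\<lambda>x. enn2ereal ((\<lambda>x. 0) x))) r" for r
    by (rule INF_lower)
  then have "newtonian_norm M p q (\<lambda>x. 0) = 0"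
    by (simp add: newtonian_norm_def ln zero_ennreal.rep_eq Let_def)
  then have "newtonian_norm M p q (ereal_fun_diff u u) = 0" for u :: "'a \<Rightarrow> ereal"
    by (simp add: z)
  then show ?thesis
    by (force simp: newtonian_def quotient_def Image_def)
qed

lemma INF_const_add_le:
  fixes c :: ennreal
  shows "(INF i\<in>I. c + f i) \<le> c + (INF i\<in>I. f i)"
proof (cases "c = top")
  case False
  have "(INF i\<in>I. c + f i) - c \<le> (INF i\<in>I. f i)"
    using False by (intro INF_greatest) (auto simp: ennreal_minus_le_iff intro: INF_lower)
  then show ?thesis using False by (simp add: ennreal_minus_le_iff)
qed simp

lemma newtonian_norm_powr:
  assumes "lorentz_weak_gradients M p q u \<noteq> {}" and r: "0 < lorentz_exponent p q"
  shows "ennpow (newtonian_norm M p q u) (lorentz_exponent p q)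
    = (INF g\<in>lorentz_weak_gradients M p q u. ennpow (lorentz_norm M p q u) (lorentz_exponent p q)
         + ennpow (lnorm M p q g) (lorentz_exponent p q))"
proof -
  have "ennpow (newtonian_norm M p q u) (lorentz_exponent p q)
    = ennpow (lorentz_norm M p q u) (lorentz_exponent p q)
       + (INF g\<in>lorentz_weak_gradients M p q u. ennpow (lnorm M p q g) (lorentz_exponent p q))"
    using r by (simp add: newtonian_norm_def Let_def lorentz_exponent_def[symmetric])
  also have "\<dots> = (INF g\<in>lorentz_weak_gradients M p q u. ennpow (lorentz_norm M p q u) (lorentz_exponent p q)
         + ennpow (lnorm M p q g) (lorentz_exponent p q))"
  proof (rule antisym)
    show "ennpow (lorentz_norm M p q u) (lorentz_exponent p q)
       + (INF g\<in>lorentz_weak_gradients M p q u. ennpow (lnorm M p q g) (lorentz_exponent p q))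
      \<le> (INF g\<in>lorentz_weak_gradients M p q u. ennpow (lorentz_norm M p q u) (lorentz_exponent p q)
         + ennpow (lnorm M p q g) (lorentz_exponent p q))"
      by (intro INF_greatest add_left_mono INF_lower)
    show "(INF g\<in>lorentz_weak_gradients M p q u. ennpow (lorentz_norm M p q u) (lorentz_exponent p q)
         + ennpow (lnorm M p q g) (lorentz_exponent p q))
      \<le> ennpow (lorentz_norm M p q u) (lorentz_exponent p q)
       + (INF g\<in>lorentz_weak_gradients M p q u. ennpow (lnorm M p q g) (lorentz_exponent p q))"
      by (rule INF_const_add_le)
  qed
  finally show ?thesis .
qed

text \<open>Truncating an admissible \<open>u\<close> to \<open>[0, 1]\<close> keeps its weak upper gradients and does not increase its
quasinorm, which gives \<open>\<ge>\<close> for the capacity. Conversely, a truncated pair of finite energy is itself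
admissible. The power \<open>r/p\<close> undoes the power \<open>p/r\<close> hidden in the definition of the capacity.\<close>

lemma capacity_eq_min_energy:
  assumes M: "metric_measure_space M" and p: "1 < p" and q: "1 \<le> q"
  shows "ennpow (capacity M p q E) (lorentz_exponent p q / p) = min_energy M p q E"
proof -
  define r where "r = lorentz_exponent p q"
  have r: "0 < r" using p q by (simp add: r_def lorentz_exponent_pos)
  let ?W = "lorentz_weak_gradients M p q"
  have pre: "u \<in> capacity_admissible M p q E \<longleftrightarrow> u \<in> pre_newtonian M p q \<and> (\<forall>x\<in>E. 1 \<le> u x)" for u
    using Union_newtonian[of M p q] by (auto simp: capacity_admissible_def)
  have "ennpow (capacity M p q E) (r / p) = (INF u\<in>capacity_admissible M p q E. ennpow (newtonian_norm M p q u) r)"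
    unfolding capacity_def using r p by (subst ennpow_INF) (auto simp: ennpow_ennpow)
  also have "\<dots> = (INF u\<in>capacity_admissible M p q E. INF g\<in>?W u. ennpow (lorentz_norm M p q u) r + ennpow (lnorm M p q g) r)"
    using r unfolding r_def by (intro INF_cong refl newtonian_norm_powr) (auto simp: pre pre_newtonian_def)
  also have "\<dots> = min_energy M p q E"
  proof (rule antisym)
    show "min_energy M p q E \<le> (INF u\<in>capacity_admissible M p q E. INF g\<in>?W u. ennpow (lorentz_norm M p q u) r + ennpow (lnorm M p q g) r)"
    proof (intro INF_greatest)
      fix u g assume u: "u \<in> capacity_admissible M p q E" and g: "g \<in> ?W u"
      define v where "v x = min 1 (e2ennreal (u x))" for x
      have [measurable]: "u \<in> borel_measurable borel" using u by (auto simp: pre pre_newtonian_def)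
      have "(v, g) \<in> cap_pairs M p q E"
        unfolding cap_pairs_def
      proof (intro CollectI case_prodI conjI ballI allI)
        show "v \<in> borel_measurable borel" unfolding v_def by measurable
        show "g \<in> borel_measurable borel" using g by (simp add: lorentz_weak_gradients_def weak_upper_gradient_def)
        show "v x \<le> 1" for x by (simp add: v_def)
        show "v x = 1" if "x \<in> E" for x
        proof -
          have "1 \<le> u x" using u that by (simp add: pre)
          then have "e2ennreal 1 \<le> e2ennreal (u x)" by (rule e2ennreal_mono)
          then show ?thesis by (simp add: v_def min_def one_ennreal_def[symmetric])
        qed
        have "ae_curve M p q (gradient_ineq u g)"
          using g by (simp add: lorentz_weak_gradients_def weak_upper_gradient_def)
        then show "ae_curve M p q (oscillation_le v g)"
          unfolding v_def by (rule ae_curve_mono) (rule oscillation_le_truncate)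
      qed
      then have "min_energy M p q E \<le> energy M p q (v, g)"
        unfolding min_energy_def by (rule INF_lower)
      also have "\<dots> \<le> ennpow (lorentz_norm M p q u) r + ennpow (lnorm M p q g) r"
      proof -
        have "\<bar>enn2ereal (v x)\<bar> \<le> \<bar>u x\<bar>" for x
        proof -
          have "enn2ereal (v x) \<le> enn2ereal (e2ennreal (u x))"
            unfolding v_def by (simp add: less_eq_ennreal.rep_eq[symmetric])
          also have "\<dots> \<le> enn2ereal (e2ennreal \<bar>u x\<bar>)"
            unfolding less_eq_ennreal.rep_eq[symmetric]
            by (intro e2ennreal_mono) (cases "u x", auto)
          also have "\<dots> = \<bar>u x\<bar>" by (simp add: enn2ereal_e2ennreal)
          finally show ?thesis by simp
        qed
        then have "lnorm M p q v \<le> lorentz_norm M p q u"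
          using p by (intro lorentz_norm_mono borel_measurable_metric_measure_space[OF M]) auto
        then show ?thesis
          using r by (auto simp: energy_def r_def[symmetric] intro!: add_right_mono ennpow_mono)
      qed
      finally show "min_energy M p q E \<le> ennpow (lorentz_norm M p q u) r + ennpow (lnorm M p q g) r" .
    qed
    show "(INF u\<in>capacity_admissible M p q E. INF g\<in>?W u. ennpow (lorentz_norm M p q u) r + ennpow (lnorm M p q g) r)
       \<le> min_energy M p q E"
      unfolding min_energy_def
    proof (intro INF_greatest, clarify)
      fix u g assume ug: "(u, g) \<in> cap_pairs M p q E"
      show "(INF u\<in>capacity_admissible M p q E. INF g\<in>?W u. ennpow (lorentz_norm M p q u) r + ennpow (lnorm M p q g) r)
         \<le> energy M p q (u, g)"
      proof (cases "energy M p q (u, g) = top")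
        case True then show ?thesis by simp
      next
        case False
        then have fin: "lnorm M p q u < \<infinity>" "lnorm M p q g < \<infinity>"
          by (auto simp: energy_def top.not_eq_extremum)
        have [measurable]: "u \<in> borel_measurable borel" "g \<in> borel_measurable borel"
          using ug by (auto simp: cap_pairs_def)
        have le1: "u x \<le> 1" for x using ug by (auto simp: cap_pairs_def)
        let ?u = "\<lambda>x. enn2ereal (u x)"
        have gW: "g \<in> ?W ?u"
          using ug fin borel_measurable_metric_measure_space[OF M, of "\<lambda>x. enn2ereal (g x)"]
          by (auto simp: cap_pairs_def lorentz_weak_gradients_def weak_upper_gradient_def lorentz_space_def
              gradient_ineq_ennreal[OF le1, abs_def])
        moreover have "?u \<in> capacity_admissible M p q E"
          using ug fin gW borel_measurable_metric_measure_space[OF M, of ?u]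
          by (auto simp: pre pre_newtonian_def lorentz_space_def cap_pairs_def one_ennreal.rep_eq)
        ultimately have "(INF u\<in>capacity_admissible M p q E. INF g\<in>?W u. ennpow (lorentz_norm M p q u) r + ennpow (lnorm M p q g) r)
          \<le> ennpow (lnorm M p q u) r + ennpow (lnorm M p q g) r"
          by (intro INF_lower2[of ?u] INF_lower2[of g]) auto
        then show ?thesis by (simp add: energy_def r_def)
      qed
    qed
  qed
  finally show ?thesis by (simp add: r_def)
qed

section \<open>Midpoints and suprema of truncated pairs\<close>

text \<open>For arbitrary functions the integral is a supremum over simple functions below them, a lower
integral, and sums of such simple functions lie below \<open>f + g\<close>. The intended integrands are compositions
with an arc length parametrization, which is chosen pointwise.\<close>

lemma nn_integral_superadditive:
  "(\<integral>\<^sup>+x. f x \<partial>N) + (\<integral>\<^sup>+x. g x \<partial>N) \<le> (\<integral>\<^sup>+x. f x + g x \<partial>N)"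
proof -
  let ?S = "\<lambda>f. {s. simple_function N s \<and> s \<le> f}"
  have ne: "?S f \<noteq> {}" for f :: "_ \<Rightarrow> ennreal"
    using simple_function_const[of N 0] by (auto simp: le_fun_def intro!: exI[of _ "\<lambda>_. 0"])
  have "integral\<^sup>S N s + integral\<^sup>S N t \<le> (\<integral>\<^sup>+x. f x + g x \<partial>N)" if "s \<in> ?S f" "t \<in> ?S g" for s t
  proof -
    have st: "simple_function N s" "simple_function N t" using that by auto
    have "integral\<^sup>S N s + integral\<^sup>S N t = (\<integral>\<^sup>+x. s x \<partial>N) + (\<integral>\<^sup>+x. t x \<partial>N)"
      using st by (simp add: nn_integral_eq_simple_integral)
    also have "\<dots> = (\<integral>\<^sup>+x. s x + t x \<partial>N)"
      using st by (intro nn_integral_add[symmetric] borel_measurable_simple_function)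
    also have "\<dots> \<le> (\<integral>\<^sup>+x. f x + g x \<partial>N)"
      using that by (intro nn_integral_mono add_mono) (auto simp: le_fun_def)
    finally show ?thesis .
  qed
  then have "(SUP t\<in>?S g. SUP s\<in>?S f. integral\<^sup>S N s + integral\<^sup>S N t) \<le> (\<integral>\<^sup>+x. f x + g x \<partial>N)"
    by (intro SUP_least)
  also have "(SUP t\<in>?S g. SUP s\<in>?S f. integral\<^sup>S N s + integral\<^sup>S N t)
      = (\<integral>\<^sup>+x. f x \<partial>N) + (\<integral>\<^sup>+x. g x \<partial>N)"
    unfolding nn_integral_def using ne[of f] ne[of g]
    by (simp only: ennreal_SUP_add_left ennreal_SUP_add_right not_False_eq_True)
  finally show ?thesis .
qed

lemma line_integral_superadditive:
  "line_integral \<gamma> g + line_integral \<gamma> h \<le> line_integral \<gamma> (\<lambda>x. g x + h x)"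
  unfolding line_integral_def distrib_right by (rule nn_integral_superadditive)

text \<open>One direction of homogeneity, again for the lower integral and hence by scaling simple functions.\<close>

lemma line_integral_half:
  "line_integral \<gamma> g \<le> 2 * line_integral \<gamma> (\<lambda>x. ennreal (1 / 2) * g x)"
proof -
  have "line_integral \<gamma> g = (\<integral>\<^sup>+s\<in>{0..enn2real (curve_length \<gamma>)}. g (arc_length_param \<gamma> s) \<partial>lborel)"
    by (simp add: line_integral_def)
  also have "\<dots> \<le> 2 * line_integral \<gamma> (\<lambda>x. ennreal (1 / 2) * g x)"
    unfolding nn_integral_def[of lborel "\<lambda>s. g (arc_length_param \<gamma> s) * indicator {0..enn2real (curve_length \<gamma>)} s"]
  proof (rule SUP_least, clarify)
    fix s :: "real \<Rightarrow> ennreal"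
    assume s: "simple_function lborel s" "s \<le> (\<lambda>s. g (arc_length_param \<gamma> s) * indicator {0..enn2real (curve_length \<gamma>)} s)"
    have "integral\<^sup>S lborel s = (\<integral>\<^sup>+t. 2 * (ennreal (1 / 2) * s t) \<partial>lborel)"
      using s(1) by (simp only: double_half_ennreal nn_integral_eq_simple_integral)
    also have "\<dots> = 2 * (\<integral>\<^sup>+t. ennreal (1 / 2) * s t \<partial>lborel)"
      using s(1) by (intro nn_integral_cmult borel_measurable_times borel_measurable_simple_function) auto
    also have "\<dots> \<le> 2 * line_integral \<gamma> (\<lambda>x. ennreal (1 / 2) * g x)"
      unfolding line_integral_def mult.assoc using s(2)
      by (intro mult_left_mono nn_integral_mono) (auto simp: le_fun_def)
    finally show "integral\<^sup>S lborel s \<le> 2 * line_integral \<gamma> (\<lambda>x. ennreal (1 / 2) * g x)" .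
  qed
  finally show ?thesis .
qed

lemma oscillation_le_midpoint:
  assumes "oscillation_le u g \<gamma>" "oscillation_le v h \<gamma>"
  shows "oscillation_le (\<lambda>x. ennreal (1 / 2) * (u x + v x)) (\<lambda>x. ennreal (1 / 2) * (g x + h x)) \<gamma>"
proof -
  let ?L = "line_integral \<gamma> (\<lambda>x. ennreal (1 / 2) * (g x + h x))"
  have L: "line_integral \<gamma> g + line_integral \<gamma> h \<le> 2 * ?L"
    using line_integral_superadditive line_integral_half by (rule order_trans)
  have "ennreal (1 / 2) * (a + b) \<le> ennreal (1 / 2) * (c + d) + ?L"
    if "a \<le> c + line_integral \<gamma> g" "b \<le> d + line_integral \<gamma> h" for a b c d
  proof -
    have "a + b \<le> (c + line_integral \<gamma> g) + (d + line_integral \<gamma> h)" using that by (rule add_mono)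
    also have "\<dots> = (c + d) + (line_integral \<gamma> g + line_integral \<gamma> h)" by (simp only: ac_simps)
    also have "\<dots> \<le> (c + d) + 2 * ?L" using L by (rule add_left_mono)
    also have "\<dots> = 2 * (ennreal (1 / 2) * (c + d) + ?L)"
      by (simp only: distrib_left[of 2] double_half_ennreal)
    finally show ?thesis by (simp only: half_double_le_iff)
  qed
  then show ?thesis using assms unfolding oscillation_le_def by blast
qed

text \<open>The gradient inequality for the midpoint only uses a lower bound for the line integral of a sum, so
superadditivity suffices.\<close>

lemma cap_pairs_midpoint:
  assumes "metric_measure_space M" "1 < p" "1 \<le> q"
    and uv: "(u, g) \<in> cap_pairs M p q E" "(v, h) \<in> cap_pairs M p q E"
  shows "(\<lambda>x. ennreal (1 / 2) * (u x + v x), \<lambda>x. ennreal (1 / 2) * (g x + h x)) \<in> cap_pairs M p q E"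
  unfolding cap_pairs_def
proof (intro CollectI case_prodI conjI allI ballI)
  have [measurable]: "u \<in> borel_measurable borel" "g \<in> borel_measurable borel"
      "v \<in> borel_measurable borel" "h \<in> borel_measurable borel"
    using uv by (auto simp: cap_pairs_def)
  show "(\<lambda>x. ennreal (1 / 2) * (u x + v x)) \<in> borel_measurable borel"
    "(\<lambda>x. ennreal (1 / 2) * (g x + h x)) \<in> borel_measurable borel" by measurable
  show "ennreal (1 / 2) * (u x + v x) \<le> 1" for x
    unfolding half_double_le_iff using add_mono[of "u x" 1 "v x" 1] uv by (auto simp: cap_pairs_def)
  show "ennreal (1 / 2) * (u x + v x) = 1" if "x \<in> E" for x
  proof -
    have "u x + v x = 2 * 1" using uv that by (auto simp: cap_pairs_def)
    then show ?thesis
      by (simp only: mult.left_commute[of "ennreal (1 / 2)" 2] double_half_ennreal)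
  qed
  have "ae_curve M p q (\<lambda>\<gamma>. oscillation_le u g \<gamma> \<and> oscillation_le v h \<gamma>)"
    using assms by (intro ae_curve_conj) (auto simp: cap_pairs_def)
  then show "ae_curve M p q (oscillation_le (\<lambda>x. ennreal (1 / 2) * (u x + v x)) (\<lambda>x. ennreal (1 / 2) * (g x + h x)))"
    by (rule ae_curve_mono) (blast intro: oscillation_le_midpoint)
qed

text \<open>The inequality for \<open>(u\<^sub>i, g\<^sub>i)\<close> at a curve implies the one with both right-hand terms replaced by the
suprema, and only then is the supremum taken on the left. The exceptional families of all \<open>i\<close>
together are negligible.\<close>

lemma cap_pairs_SUP:
  fixes u g :: "nat \<Rightarrow> 'a::metric_space \<Rightarrow> ennreal"
  assumes "metric_measure_space M" "1 < p" "1 \<le> q"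
    and ug: "\<And>i. (u i, g i) \<in> cap_pairs M p q (E i)"
  shows "(\<lambda>x. SUP i. u i x, \<lambda>x. SUP i. g i x) \<in> cap_pairs M p q (\<Union>i. E i)"
  unfolding cap_pairs_def
proof (intro CollectI case_prodI conjI allI ballI)
  have [measurable]: "u i \<in> borel_measurable borel" "g i \<in> borel_measurable borel" for i
    using ug[of i] by (auto simp: cap_pairs_def)
  show "(\<lambda>x. SUP i. u i x) \<in> borel_measurable borel" "(\<lambda>x. SUP i. g i x) \<in> borel_measurable borel"
    by measurable
  have le1: "u i x \<le> 1" for i x using ug[of i] by (auto simp: cap_pairs_def)
  then show "(SUP i. u i x) \<le> 1" for x by (intro SUP_least)
  show "(SUP i. u i x) = 1" if "x \<in> (\<Union>i. E i)" for x
  proof (rule antisym)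
    from that obtain i where "x \<in> E i" by blast
    then have "1 = u i x" using ug[of i] by (auto simp: cap_pairs_def)
    then show "1 \<le> (SUP i. u i x)" by (metis SUP_upper UNIV_I)
  qed (use le1 in \<open>auto intro: SUP_least\<close>)
  have "ae_curve M p q (\<lambda>\<gamma>. \<forall>i. oscillation_le (u i) (g i) \<gamma>)"
    using assms by (intro ae_curve_countable) (auto simp: cap_pairs_def)
  then show "ae_curve M p q (oscillation_le (\<lambda>x. SUP i. u i x) (\<lambda>x. SUP i. g i x))"
  proof (rule ae_curve_mono)
    fix \<gamma> assume osc: "\<forall>i. oscillation_le (u i) (g i) \<gamma>"
    have L: "line_integral \<gamma> (g i) \<le> line_integral \<gamma> (\<lambda>x. SUP i. g i x)" for i
      by (intro line_integral_mono SUP_upper) simp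
    have up: "u i y + line_integral \<gamma> (g i) \<le> (SUP i. u i y) + line_integral \<gamma> (\<lambda>x. SUP i. g i x)" for i y
      using L by (intro add_mono SUP_upper) auto
    show "oscillation_le (\<lambda>x. SUP i. u i x) (\<lambda>x. SUP i. g i x) \<gamma>"
      unfolding oscillation_le_def
      using osc unfolding oscillation_le_def by (intro conjI SUP_least) (rule order_trans[OF _ up], blast)+
  qed
qed

lemma energy_SUP_le:
  fixes u g :: "nat \<Rightarrow> 'a::metric_space \<Rightarrow> ennreal"
  assumes M: "metric_measure_space M" and p: "1 < p" and q: "1 \<le> q"
    and ug: "\<And>i. (u i, g i) \<in> cap_pairs M p q (E i)"
  shows "energy M p q (\<lambda>x. SUP i. u i x, \<lambda>x. SUP i. g i x) \<le> (\<Sum>i. energy M p q (u i, g i))"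
proof -
  have "u i \<in> borel_measurable M" "g i \<in> borel_measurable M" for i
    using ug[of i] by (auto simp: cap_pairs_def intro: borel_measurable_metric_measure_space[OF M])
  then show ?thesis
    unfolding energy_def using p q by (simp add: suminf_add[symmetric] add_mono lnorm_SUP_le)
qed

section \<open>Subadditivity and continuity from below\<close>

lemma cap_pairs_antimono: "E \<subseteq> F \<Longrightarrow> cap_pairs M p q F \<subseteq> cap_pairs M p q E"
  unfolding cap_pairs_def by blast

lemma min_energy_mono: "E \<subseteq> F \<Longrightarrow> min_energy M p q E \<le> min_energy M p q F"
  unfolding min_energy_def by (intro INF_superset_mono cap_pairs_antimono) auto

lemma near_minimizer:
  assumes "min_energy M p q E < top" "0 < e"
  obtains u g where "(u, g) \<in> cap_pairs M p q E" "energy M p q (u, g) \<le> min_energy M p q E + ennreal e"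
proof -
  have "min_energy M p q E < min_energy M p q E + ennreal e"
    using assms by (cases "min_energy M p q E") (auto simp: ennreal_less_iff simp flip: ennreal_plus)
  then obtain w where "w \<in> cap_pairs M p q E" "energy M p q w < min_energy M p q E + ennreal e"
    unfolding min_energy_def INF_less_iff by blast
  then show ?thesis using that by (cases w) auto
qed

lemma min_energy_countable_subadditive:
  assumes M: "metric_measure_space M" and p: "1 < p" and q: "1 \<le> q"
  shows "min_energy M p q (\<Union>i. E i) \<le> (\<Sum>i. min_energy M p q (E i))"
proof (rule ennreal_le_epsilon)
  fix e :: real assume fin: "(\<Sum>i. min_energy M p q (E i)) < top" and e: "0 < e"
  have "min_energy M p q (E i) < top" for i
    using fin ennreal_suminf_lessD by blast
  moreover have "0 < e * (1 / 2) ^ Suc i" for i using e by simp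
  ultimately have "\<exists>u g. (u, g) \<in> cap_pairs M p q (E i) \<and>
      energy M p q (u, g) \<le> min_energy M p q (E i) + ennreal (e * (1 / 2) ^ Suc i)" for i
    by (meson near_minimizer)
  then obtain u g where ug: "\<And>i. (u i, g i) \<in> cap_pairs M p q (E i)"
    and en: "\<And>i. energy M p q (u i, g i) \<le> min_energy M p q (E i) + ennreal (e * (1 / 2) ^ Suc i)"
    by metis
  have "min_energy M p q (\<Union>i. E i) \<le> energy M p q (\<lambda>x. SUP i. u i x, \<lambda>x. SUP i. g i x)"
    unfolding min_energy_def using M p q ug by (intro INF_lower cap_pairs_SUP)
  also have "\<dots> \<le> (\<Sum>i. energy M p q (u i, g i))"
    using M p q ug by (rule energy_SUP_le)
  also have "\<dots> \<le> (\<Sum>i. min_energy M p q (E i) + ennreal (e * (1 / 2) ^ Suc i))"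
    using en by (intro suminf_le summableI)
  also have "\<dots> = (\<Sum>i. min_energy M p q (E i)) + (\<Sum>i. ennreal (e * (1 / 2) ^ Suc i))"
    by (intro suminf_add[symmetric] summableI)
  also have "\<dots> = (\<Sum>i. min_energy M p q (E i)) + ennreal e"
    using e by (simp only: suminf_half_powers less_imp_le)
  finally show "min_energy M p q (\<Union>i. E i) \<le> (\<Sum>i. min_energy M p q (E i)) + ennreal e" .
qed

text \<open>Choose indices \<open>n\<^sub>k\<close> with minimal energy within \<open>t\<^sub>k\<close> of its limit \<open>a\<close>, and pairs \<open>(u\<^sub>k, g\<^sub>k)\<close> for \<open>E\<^bsub>n\<^sub>k\<^esub>\<close> of
energy at most \<open>a + t\<^sub>k\<close>. The midpoint of the \<open>k\<close>-th and the next pair is again a competitor for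
\<open>E\<^bsub>n\<^sub>k\<^esub>\<close>, so its energy is at least \<open>a - t\<^sub>k\<close>: nearly the mean of the energies of the two pairs. By
convexity no compensation between the two summands of the energy is possible, so the same is true
of \<open>u\<close> and of \<open>g\<close> separately, and \<open>lnorm_SUP_chain\<close> applies to both sequences. Their suprema form a
competitor for the union.\<close>

lemma min_energy_Union_le:
  fixes E :: "nat \<Rightarrow> 'a::metric_space set"
  assumes M: "metric_measure_space M" and s: "1 < s" "s \<le> p"
    and E: "\<And>i. E i \<subseteq> E (Suc i)"
    and a: "(SUP i. min_energy M p (ennreal s) (E i)) = ennreal a" "0 \<le> a"
    and \<eta>: "0 < \<eta>" and \<epsilon>: "0 < \<epsilon>"
  shows "min_energy M p (ennreal s) (\<Union>i. E i) \<le> ennreal ((1 + \<eta>) powr s * (a + 3 * \<epsilon>))"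
proof -
  let ?q = "ennreal s"
  let ?A = "\<lambda>i. min_energy M p ?q (E i)"
  have p: "1 < p" using s by simp
  have q: "1 \<le> ?q" using s by simp
  have r: "lorentz_exponent p ?q = s" using s by (simp add: lorentz_exponent_def)
  define L where "L f = ennpow (lnorm M p ?q f) s" for f
  have en: "energy M p ?q (u, g) = L u + L g" for u g by (simp add: energy_def r L_def)
  have E_mono: "E i \<subseteq> E j" if "i \<le> j" for i j using E that by (rule lift_Suc_mono_le)
  have B: "0 \<le> a + 1" using a by simp
  obtain \<delta> :: "nat \<Rightarrow> real" where \<delta>: "\<And>k. 0 < \<delta> k" and chain:
    "\<And>f. (\<And>k. f k \<in> borel_measurable M) \<Longrightarrow> (\<And>k. L (f k) \<le> ennreal (a + 1)) \<Longrightarrow>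
       (\<And>k. L (f k) + L (f (Suc k)) \<le> 2 * L (\<lambda>x. ennreal (1 / 2) * (f k x + f (Suc k) x)) + ennreal (\<delta> k)) \<Longrightarrow>
       L (\<lambda>x. SUP k. f k x) \<le> ennreal ((1 + \<eta>) powr s) * (L (f 0) + ennreal \<epsilon>)"
  proof -
    show thesis
      by (rule lnorm_SUP_chain[OF s \<eta> \<epsilon> B, where M = M]) (fact that[unfolded L_def])
  qed
  \<comment> \<open>A positive decreasing sequence that is at most 1, at most eps and at most a quarter of each delta.\<close>
  define t where "t k = Min (insert 1 (insert \<epsilon> ((\<lambda>j. \<delta> j / 4) ` {..k})))" for k :: nat
  have t_pos: "0 < t k" for k unfolding t_def using \<epsilon> \<delta> by (subst Min_gr_iff) auto
  have t1: "t k \<le> 1" "t k \<le> \<epsilon>" "t k \<le> \<delta> k / 4" for k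
    unfolding t_def by (rule Min_le; simp)+
  have t_Suc: "t (Suc k) \<le> t k" for k
    unfolding t_def by (intro Min_antimono) auto
  have "\<exists>m. ennreal a \<le> ?A m + ennreal (t k)" for k
  proof (rule ccontr)
    assume "\<nexists>m. ennreal a \<le> ?A m + ennreal (t k)"
    then have "(SUP m. ?A m + ennreal (t k)) \<le> ennreal a" by (intro SUP_least) (simp add: not_le less_imp_le)
    then have "(SUP m. ?A m) + ennreal (t k) \<le> ennreal a" by (simp only: ennreal_SUP_add_left[OF UNIV_not_empty])
    then have "ennreal (a + t k) \<le> ennreal a"
      unfolding a(1) using a(2) t_pos[of k] by simp
    then have "a + t k \<le> a" using a(2) by (subst (asm) ennreal_le_iff) auto
    then show False using t_pos[of k] by simp
  qed
  then obtain m where m: "\<And>k. ennreal a \<le> ?A (m k) + ennreal (t k)" by metis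
  \<comment> \<open>The partial sums make the chosen indices increasing and, by the last summand, unbounded.\<close>
  define n where "n k = (\<Sum>j\<le>k. m j) + k" for k
  have n_mono: "n k \<le> n (Suc k)" and n_ge: "m k \<le> n k" "k \<le> n k" for k
    by (auto simp: n_def intro!: trans_le_add1 member_le_sum)
  have An: "ennreal a \<le> ?A (n k) + ennreal (t k)" for k
    using m[of k] add_right_mono[OF min_energy_mono[OF E_mono[OF n_ge(1)[of k]]]] by (rule order_trans)
  have Aa: "?A k \<le> ennreal a" for k unfolding a(1)[symmetric] by (rule SUP_upper) simp
  have "?A k < top" for k using Aa[of k] by (rule order.strict_trans1) simp
  then have "\<exists>u g. (u, g) \<in> cap_pairs M p ?q (E (n k)) \<and> energy M p ?q (u, g) \<le> ?A (n k) + ennreal (t k)" for k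
    using t_pos[of k] by (meson near_minimizer)
  then obtain u g where ug: "\<And>k. (u k, g k) \<in> cap_pairs M p ?q (E (n k))"
    and "\<And>k. energy M p ?q (u k, g k) \<le> ?A (n k) + ennreal (t k)"
    by metis
  then have ug_en: "L (u k) + L (g k) \<le> ennreal (a + t k)" for k
    using add_right_mono[OF Aa, of "n k" "ennreal (t k)"] a(2) t_pos[of k] unfolding en
    by (metis ennreal_plus less_imp_le order_trans)
  have bound: "L (u k) + L (g k) \<le> ennreal (a + 1)" for k
    using ug_en[of k] t1(1)[of k] by (elim order_trans) (intro ennreal_leI, simp)
  have [measurable]: "u k \<in> borel_measurable M" "g k \<in> borel_measurable M" for k
    using ug[of k] by (auto simp: cap_pairs_def intro: borel_measurable_metric_measure_space[OF M])
  let ?mu = "\<lambda>k x. ennreal (1 / 2) * (u k x + u (Suc k) x)"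
  let ?mg = "\<lambda>k x. ennreal (1 / 2) * (g k x + g (Suc k) x)"
  have total: "(L (u k) + L (u (Suc k))) + (L (g k) + L (g (Suc k)))
      \<le> 2 * L (?mu k) + 2 * L (?mg k) + ennreal (\<delta> k)" for k
  proof -
    have "(u (Suc k), g (Suc k)) \<in> cap_pairs M p ?q (E (n k))"
      using ug[of "Suc k"] cap_pairs_antimono[OF E_mono[OF n_mono[of k]]] by blast
    then have "(?mu k, ?mg k) \<in> cap_pairs M p ?q (E (n k))"
      using ug[of k] M p q by (intro cap_pairs_midpoint)
    then have "?A (n k) \<le> L (?mu k) + L (?mg k)"
      unfolding en[symmetric] min_energy_def by (rule INF_lower)
    then have A: "ennreal a \<le> L (?mu k) + L (?mg k) + ennreal (t k)"
      using An[of k] by (meson add_right_mono order_trans)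
    have "(L (u k) + L (u (Suc k))) + (L (g k) + L (g (Suc k)))
       = (L (u k) + L (g k)) + (L (u (Suc k)) + L (g (Suc k)))" by (simp only: ac_simps)
    also have "\<dots> \<le> ennreal (a + t k) + ennreal (a + t (Suc k))"
      using ug_en by (intro add_mono)
    also have "\<dots> = ennreal ((a + t k) + (a + t (Suc k)))"
      using a(2) t_pos[of k] t_pos[of "Suc k"] by (intro ennreal_plus[symmetric]) auto
    also have "\<dots> \<le> ennreal (2 * a + 2 * t k)"
      using t_Suc[of k] by (intro ennreal_leI) simp
    also have "\<dots> = 2 * ennreal a + ennreal (2 * t k)"
      using a(2) t_pos[of k] by (simp add: ennreal_mult)
    also have "\<dots> \<le> 2 * (L (?mu k) + L (?mg k) + ennreal (t k)) + ennreal (2 * t k)"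
      using A by (intro add_mono mult_left_mono) auto
    also have "\<dots> = 2 * L (?mu k) + 2 * L (?mg k) + ennreal (4 * t k)"
    proof -
      have "ennreal (4 * t k) = 2 * ennreal (t k) + ennreal (2 * t k)"
        using t_pos[of k] ennreal_plus[of "2 * t k" "2 * t k"] by (simp add: ennreal_mult)
      then show ?thesis by (simp only: distrib_left add.assoc)
    qed
    also have "\<dots> \<le> 2 * L (?mu k) + 2 * L (?mg k) + ennreal (\<delta> k)"
      using t1(3)[of k] by (intro add_left_mono ennreal_leI) simp
    finally show ?thesis .
  qed
  \<comment> \<open>If the sum of two inequalities is an equality up to d, then so is each of them.\<close>
  have split: "y \<le> z + d" if "y + y' \<le> z + z' + d" "z' \<le> y'" "y' < top" for y y' z z' d :: ennreal
  proof -
    have "y' + y \<le> z' + (z + d)" using that(1) by (simp only: ac_simps)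
    also have "\<dots> \<le> y' + (z + d)" using that(2) by (rule add_right_mono)
    finally have "y' = \<infinity> \<or> y \<le> z + d" by (simp only: ennreal_add_left_cancel_le)
    then show ?thesis using that(3) by auto
  qed
  have conv: "2 * L (\<lambda>x. ennreal (1 / 2) * (f x + h x)) \<le> L f + L h"
    if "f \<in> borel_measurable M" "h \<in> borel_measurable M" for f h
    unfolding L_def using that s by (intro lnorm_powr_midpoint_le) auto
  have uB: "L (u k) \<le> ennreal (a + 1)" and gB: "L (g k) \<le> ennreal (a + 1)" for k
    using bound[of k] by (auto elim: order_trans[rotated])
  then have fin: "L (u k) < top" "L (g k) < top" for k by (metis ennreal_less_top order.strict_trans1)+
  have su: "L (\<lambda>x. SUP k. u k x) \<le> ennreal ((1 + \<eta>) powr s) * (L (u 0) + ennreal \<epsilon>)"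
  proof (rule chain)
    fix k show "L (u k) + L (u (Suc k)) \<le> 2 * L (?mu k) + ennreal (\<delta> k)"
      by (rule split[OF total conv]) (use fin in auto)
  qed (use uB in auto)
  have sg: "L (\<lambda>x. SUP k. g k x) \<le> ennreal ((1 + \<eta>) powr s) * (L (g 0) + ennreal \<epsilon>)"
  proof (rule chain)
    fix k
    have "(L (g k) + L (g (Suc k))) + (L (u k) + L (u (Suc k))) \<le> 2 * L (?mg k) + 2 * L (?mu k) + ennreal (\<delta> k)"
      using total[of k] by (simp only: add.commute)
    then show "L (g k) + L (g (Suc k)) \<le> 2 * L (?mg k) + ennreal (\<delta> k)"
      by (rule split[OF _ conv]) (use fin in auto)
  qed (use gB in auto)
  have "(\<Union>k. E (n k)) = (\<Union>i. E i)"
    using E_mono[OF n_ge(2)] by blast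
  then have "(\<lambda>x. SUP k. u k x, \<lambda>x. SUP k. g k x) \<in> cap_pairs M p ?q (\<Union>i. E i)"
    using cap_pairs_SUP[OF M p q, of u g "\<lambda>k. E (n k)"] ug by simp
  then have "min_energy M p ?q (\<Union>i. E i) \<le> L (\<lambda>x. SUP k. u k x) + L (\<lambda>x. SUP k. g k x)"
    unfolding en[symmetric] min_energy_def by (rule INF_lower)
  also have "\<dots> \<le> ennreal ((1 + \<eta>) powr s) * (L (u 0) + ennreal \<epsilon>) + ennreal ((1 + \<eta>) powr s) * (L (g 0) + ennreal \<epsilon>)"
    using su sg by (rule add_mono)
  also have "\<dots> = ennreal ((1 + \<eta>) powr s) * ((L (u 0) + L (g 0)) + (ennreal \<epsilon> + ennreal \<epsilon>))"
    by (simp only: distrib_left ac_simps)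
  also have "\<dots> \<le> ennreal ((1 + \<eta>) powr s) * (ennreal (a + t 0) + (ennreal \<epsilon> + ennreal \<epsilon>))"
    using ug_en[of 0] by (intro mult_left_mono add_right_mono) auto
  also have "\<dots> = ennreal ((1 + \<eta>) powr s) * ennreal ((a + t 0) + (\<epsilon> + \<epsilon>))"
    using a(2) t_pos[of 0] \<epsilon> by (simp only: ennreal_plus add_nonneg_nonneg less_imp_le)
  also have "\<dots> = ennreal ((1 + \<eta>) powr s * ((a + t 0) + (\<epsilon> + \<epsilon>)))"
    using a(2) t_pos[of 0] \<epsilon> by (intro ennreal_mult[symmetric]) auto
  also have "\<dots> \<le> ennreal ((1 + \<eta>) powr s * (a + 3 * \<epsilon>))"
    using t1(2)[of 0] by (intro ennreal_leI mult_left_mono) auto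
  finally show ?thesis .
qed

lemma min_energy_continuous_from_below:
  fixes E :: "nat \<Rightarrow> 'a::metric_space set"
  assumes M: "metric_measure_space M" and s: "1 < s" "s \<le> p" and E: "\<And>i. E i \<subseteq> E (Suc i)"
  shows "min_energy M p (ennreal s) (\<Union>i. E i) \<le> (SUP i. min_energy M p (ennreal s) (E i))"
proof (cases "SUP i. min_energy M p (ennreal s) (E i)")
  case (real a)
  let ?f = "\<lambda>n::nat. (1 + 1 / real (Suc n)) powr s * (a + 3 * (1 / real (Suc n)))"
  have le: "min_energy M p (ennreal s) (\<Union>i. E i) \<le> ennreal (?f n)" for n
    using M s E real by (intro min_energy_Union_le) auto
  have "(\<lambda>n. 1 / real (Suc n)) \<longlonglongrightarrow> 0"
    using LIMSEQ_inverse_real_of_nat by (simp add: inverse_eq_divide)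
  then have "?f \<longlonglongrightarrow> (1 + 0) powr s * (a + 3 * 0)"
    by (intro tendsto_intros) auto
  then have "(\<lambda>n. ennreal (?f n)) \<longlonglongrightarrow> ennreal a"
    by (intro tendsto_ennrealI) simp
  then have "min_energy M p (ennreal s) (\<Union>i. E i) \<le> ennreal a"
    using le by (intro LIMSEQ_le_const) auto
  then show ?thesis using real by simp
next
  case top
  then show ?thesis by (simp only: top_greatest)
qed

theorem theorem5p2:
  fixes M :: "'a::complete_space measure" and p :: real and q :: ennreal
  assumes "metric_measure_space M" and "1 < p" and "1 \<le> q"
  shows "(\<forall>E1 E2. E1 \<subseteq> E2 \<longrightarrow> capacity M p q E1 \<le> capacity M p q E2) \<and>
    (nonatomic M \<and> 1 < q \<and> q \<le> ennreal p \<longrightarrow>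
       (\<forall>E :: nat \<Rightarrow> 'a set. (\<forall>i. E i \<subseteq> E (Suc i)) \<longrightarrow>
          (\<lambda>i. capacity M p q (E i)) \<longlonglongrightarrow> capacity M p q (\<Union>i. E i))) \<and>
    (ennreal p < q \<longrightarrow>
       (\<forall>E :: nat \<Rightarrow> 'a set.
          capacity M p q (\<Union>i. E i) \<le> (\<Sum>i. capacity M p q (E i)))) \<and>
    (q \<le> ennreal p \<longrightarrow>
       (\<forall>E :: nat \<Rightarrow> 'a set.
          ennpow (capacity M p q (\<Union>i. E i)) (enn2real q / p)
            \<le> (\<Sum>i. ennpow (capacity M p q (E i)) (enn2real q / p))))"
proof -
  note cap = capacity_eq_min_energy[OF assms]
  have mono: "capacity M p q E1 \<le> capacity M p q E2" if "E1 \<subseteq> E2" for E1 E2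
    unfolding capacity_def using that
    by (intro INF_superset_mono) (auto simp: capacity_admissible_def)
  have sub: "ennpow (capacity M p q (\<Union>i. E i)) (lorentz_exponent p q / p)
      \<le> (\<Sum>i. ennpow (capacity M p q (E i)) (lorentz_exponent p q / p))" for E :: "nat \<Rightarrow> 'a set"
    unfolding cap using assms by (rule min_energy_countable_subadditive)
  have cont: "(\<lambda>i. capacity M p q (E i)) \<longlonglongrightarrow> capacity M p q (\<Union>i. E i)"
    if q: "1 < q" "q \<le> ennreal p" and E: "\<forall>i. E i \<subseteq> E (Suc i)" for E :: "nat \<Rightarrow> 'a set"
  proof -
    define s where "s = enn2real q"
    have "q < top" using q(2) by (rule order.strict_trans1) simp
    then have qs: "q = ennreal s" by (simp add: s_def)
    have s: "1 < s" "s \<le> p" using q assms(2) unfolding qs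
      by (auto simp: ennreal_le_iff ennreal_less_iff simp flip: ennreal_1)
    have r: "lorentz_exponent p q = s" using q by (simp add: lorentz_exponent_def s_def)
    have sp: "0 < s / p" using s by simp
    have "ennpow (capacity M p q (\<Union>i. E i)) (s / p) \<le> (SUP i. ennpow (capacity M p q (E i)) (s / p))"
      using min_energy_continuous_from_below[OF assms(1) s, of E] E
      unfolding qs[symmetric] cap[unfolded r] by simp
    also have "\<dots> = ennpow (SUP i. capacity M p q (E i)) (s / p)"
      using sp by (simp add: ennpow_SUP)
    finally have "capacity M p q (\<Union>i. E i) \<le> (SUP i. capacity M p q (E i))"
      using sp by (simp only: ennpow_le_iff)
    then have "capacity M p q (\<Union>i. E i) = (SUP i. capacity M p q (E i))"
      by (intro antisym SUP_least mono) auto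
    moreover have "incseq (\<lambda>i. capacity M p q (E i))"
      using E by (intro incseq_SucI mono) simp
    ultimately show ?thesis by (simp add: LIMSEQ_SUP)
  qed
  have sub_large: "capacity M p q (\<Union>i. E i) \<le> (\<Sum>i. capacity M p q (E i))" if "ennreal p < q" for E :: "nat \<Rightarrow> 'a set"
  proof -
    have "\<not> q \<le> ennreal p" using that by simp
    then have "lorentz_exponent p q / p = 1" using assms(2) by (simp add: lorentz_exponent_def)
    then show ?thesis using sub[of E] by simp
  qed
  have sub_small: "ennpow (capacity M p q (\<Union>i. E i)) (enn2real q / p)
            \<le> (\<Sum>i. ennpow (capacity M p q (E i)) (enn2real q / p))" if "q \<le> ennreal p" for E :: "nat \<Rightarrow> 'a set"
    using sub[of E] that by (simp add: lorentz_exponent_def)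
  show ?thesis
    by (intro conjI allI impI, erule mono, (elim conjE, rule cont, assumption+),
        erule sub_large, erule sub_small)
qed

end
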